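(* Consider numerical solutions generated by the scheme described in the context, under the standing conventions given there. Suppose that there exist constants $0<\underline h\le\overline h$ such that $$0<\underline h\le h^n_{i,j}\le\overline h$$ uniformly for each $n$ and $(i,j)$. Also assume that $$\|\eth_x^{\mathcal E}h^{n+1}_{\mathcal T}\|_{L^2}\lesssim\Delta x^{-1/2},\qquad \|\eth_y^{\mathcal E}h^{n+1}_{\mathcal T}\|_{L^2}\lesssim\Delta y^{-1/2}.$$ Further, suppose that $\delta_{\mathcal T}\in(0,\delta_0]$ for $\delta_0$ sufficiently small, with $\Delta t\approx\delta_{\mathcal T}$. Then the numerical solutions are consistent with the rotating shallow water system, i.e. (i) for any $\psi\in C_c^\infty([0,T)\times\Omega)$, $$-\iint_\Omega h^0_{\mathcal T}\psi(0,\cdot)\,dx\,dy=\sum_{n=0}^{N-1}\int_{t^n}^{t^{n+1}}\!\!\iint_\Omega\bigl[h^n_{\mathcal T}\partial_t\psi+h^{n+1}_{\mathcal T}u^n_{\mathcal T}\partial_x\psi+h^{n+1}_{\mathcal T}v^n_{\mathcal T}\partial_y\psi\bigr]dx\,dy\,dt+\mathcal C^{mass}_{\mathcal T,\Delta t};$$ (ii) for any $\Psi\in C_c^\infty([0,T)\times\Omega)$, $$-\iint_\Omega h^0_{\mathcal T}u^0_{\mathcal T}\Psi(0,\cdot)\,dx\,dy=\sum_{n=0}^{N-1}\int_{t^n}^{t^{n+1}}\!\!\iint_\Omega\bigl[h^n_{\mathcal T}u^n_{\mathcal T}\partial_t\Psi+m^{n+1}_{x,\mathcal D^x}u^n_{\mathcal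 D^x}\partial_x\Psi+m^{n+1}_{y,\mathcal D^y}u^n_{\mathcal D^y}\partial_y\Psi+p^{n+1}_{\mathcal T}\partial_x\Psi\bigr]dx\,dy\,dt$$ $$+\sum_{n=0}^{N-1}\int_{t^n}^{t^{n+1}}\!\!\iint_\Omega\bigl[-gh^{n+1}_{\mathcal T}\partial_xb\,\Psi+\omega h^{n+1}_{\mathcal T}v^n_{\mathcal T}\Psi\bigr]dx\,dy\,dt+\mathcal C^{mom,x}_{\mathcal T,\Delta t};$$ (iii) for any $\Phi\in C_c^\infty([0,T)\times\Omega)$, $$-\iint_\Omega h^0_{\mathcal T}v^0_{\mathcal T}\Phi(0,\cdot)\,dx\,dy=\sum_{n=0}^{N-1}\int_{t^n}^{t^{n+1}}\!\!\iint_\Omega\bigl[h^n_{\mathcal T}v^n_{\mathcal T}\partial_t\Phi+m^{n+1}_{x,\mathcal D^x}v^n_{\mathcal D^x}\partial_x\Phi+m^{n+1}_{y,\mathcal D^y}v^n_{\mathcal D^y}\partial_y\Phi+p^{n+1}_{\mathcal T}\partial_y\Phi\bigr]dx\,dy\,dt$$ $$+\sum_{n=0}^{N-1}\int_{t^n}^{t^{n+1}}\!\!\iint_\Omega\bigl[-gh^{n+1}_{\mathcal T}\partial_yb\,\Phi-\omega h^{n+1}_{\mathcal T}u^n_{\mathcal T}\Phi\bigr]dx\,dy\,dt+\mathcal C^{mom,y}_{\mathcal T,\Delta t};$$ where the consistency errors satisfy $|\mathcal C^{mass}_{\mathcal T,\Delta t}|,\ |\mathcal C^{mom,x}_{\mathcal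 T,\Delta t}|,\ |\mathcal C^{mom,y}_{\mathcal T,\Delta t}|\to0$ as $\delta_{\mathcal T}\to0$.
   Context: **Setting.** $\Omega$ is the two-dimensional torus, partitioned (periodic boundary conditions) by $\mathcal T$ into a uniform rectangular mesh of cells $K_{i,j}=[x_{i-\frac12},x_{i+\frac12}]\times[y_{j-\frac12},y_{j+\frac12}]$ with cell centres $(x_i,y_j)$ and constant space steps $\Delta x,\Delta y>0$; the indices $(i,j)$ are periodic. $\delta_{\mathcal T}=\max_{i,j}\operatorname{diam}(K_{i,j})$. $T>0$, and $0=t^0<\dots<t^N=T$ has constant step $\Delta t$. $g>0$ is the gravitational acceleration, $\omega$ is the Coriolis parameter (a real constant, nonzero where it is divided by), $b\in W^{2,\infty}(\Omega)$ is the bottom topography, and $h_0>0$, $u_0$, $v_0$ in $L^\infty(\Omega)$ are the initial data. $a_1\lesssim a_2$ means $a_1\le ca_2$ with $c$ independent of the mesh parameters; $\Delta t\approx\delta_{\mathcal T}$ means $\Delta t\lesssim\delta_{\mathcal T}\lesssim\Delta t$. **Notation.** For a grid function $z=(z_{i,j})$: $z_{\mathcal T}=\sum_{i,j}z_{i,j}\mathbf 1_{K_{i,j}}$; $\{\{z\}\}_{i+\frac12,j}=\frac12(z_{i,j}+z_{i+1,j})$, $\{\{z\}\}_{i,j+\frac12}=\frac12(z_{i,j}+z_{i,j+1})$; $\eth_xz_{i,j}=\frac{1}{\Delta x}(\{\{z\}\}_{i+\frac12,j}-\{\{z\}\}_{i-\frac12,j})$, $\eth_yz_{i,j}=\frac{1}{\Delta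 y}(\{\{z\}\}_{i,j+\frac12}-\{\{z\}\}_{i,j-\frac12})$. Dual cells: $D_{i+\frac12,j}=[x_i,x_{i+1}]\times[y_{j-\frac12},y_{j+\frac12}]$ (collection $\mathcal D^x$) and $D_{i,j+\frac12}=[x_{i-\frac12},x_{i+\frac12}]\times[y_j,y_{j+1}]$ (collection $\mathcal D^y$). $\eth_x^{\mathcal E}z$ is the function equal to $\frac{z_{i+1,j}-z_{i,j}}{\Delta x}$ on $D_{i+\frac12,j}$, and $\eth_y^{\mathcal E}z$ the function equal to $\frac{z_{i,j+1}-z_{i,j}}{\Delta y}$ on $D_{i,j+\frac12}$. For real $a$, $a^\pm=\frac12(a\pm|a|)$; $F^{n+1,\pm}=(F^{n+1})^\pm$, $G^{n+1,\pm}=(G^{n+1})^\pm$. $b_{i,j},h^0_{i,j},u^0_{i,j},v^0_{i,j}$ are the cell averages over $K_{i,j}$ of $b,h_0,u_0,v_0$. **Scheme.** For $0\le n\le N-1$: $$\frac{h^{n+1}_{i,j}-h^n_{i,j}}{\Delta t}+\frac{F^{n+1}_{i+\frac12,j}-F^{n+1}_{i-\frac12,j}}{\Delta x}+\frac{G^{n+1}_{i,j+\frac12}-G^{n+1}_{i,j-\frac12}}{\Delta y}=0,$$ $$\frac{h^{n+1}_{i,j}u^{n+1}_{i,j}-h^n_{i,j}u^n_{i,j}}{\Delta t}+\frac{F^{n+1}_{i+\frac12,j}u^n_{i+\frac12,j}-F^{n+1}_{i-\frac12,j}u^n_{i-\frac12,j}}{\Delta x}+\frac{G^{n+1}_{i,j+\frac12}u^n_{i,j+\frac12}-G^{n+1}_{i,j-\frac12}u^n_{i,j-\frac12}}{\Delta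 y}+h^{n+1}_{i,j}\eth_x\phi^{n+1}_{i,j}=\omega h^{n+1}_{i,j}v^n_{i,j}-\omega r^{n+1}_{i,j},$$ $$\frac{h^{n+1}_{i,j}v^{n+1}_{i,j}-h^n_{i,j}v^n_{i,j}}{\Delta t}+\frac{F^{n+1}_{i+\frac12,j}v^n_{i+\frac12,j}-F^{n+1}_{i-\frac12,j}v^n_{i-\frac12,j}}{\Delta x}+\frac{G^{n+1}_{i,j+\frac12}v^n_{i,j+\frac12}-G^{n+1}_{i,j-\frac12}v^n_{i,j-\frac12}}{\Delta y}+h^{n+1}_{i,j}\eth_y\phi^{n+1}_{i,j}=-\omega h^{n+1}_{i,j}u^n_{i,j}+\omega q^{n+1}_{i,j}.$$ Here $\phi^{n}_{i,j}=g(h^{n}_{i,j}+b_{i,j})$, $q^{n+1}_{i,j}=\eta\Delta t(\eth_x\phi^{n+1}_{i,j}-\omega v^n_{i,j})$, $r^{n+1}_{i,j}=\eta\Delta t(\eth_y\phi^{n+1}_{i,j}+\omega u^n_{i,j})$, the fluxes are $$F^{n+1}_{i+\frac12,j}=\{\{h^{n+1}u^n\}\}_{i+\frac12,j}-\{\{q^{n+1}\}\}_{i+\frac12,j},\qquad G^{n+1}_{i,j+\frac12}=\{\{h^{n+1}v^n\}\}_{i,j+\frac12}-\{\{r^{n+1}\}\}_{i,j+\frac12},$$ and the edge velocities are upwind: for $w=u,v$, $w^n_{i+\frac12,j}=w^n_{i,j}$ if $F^{n+1}_{i+\frac12,j}\ge0$ and $w^n_{i+1,j}$ otherwise; $w^n_{i,j+\frac12}=w^n_{i,j}$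 if $G^{n+1}_{i,j+\frac12}\ge0$ and $w^n_{i,j+1}$ otherwise. **Standing conventions.** $\eta>\frac32\overline h$ is a constant independent of the mesh parameters, and the scheme is run under its energy-stability conditions: for a fixed $\zeta\in(0,1)$ and all $n,(i,j)$, $$1+\frac{3\Delta t}{h^{n+1}_{i,j}}\Bigl(\frac1{\Delta x}\bigl(F^{n+1,-}_{i+\frac12,j}-F^{n+1,+}_{i-\frac12,j}\bigr)+\frac1{\Delta y}\bigl(G^{n+1,-}_{i,j+\frac12}-G^{n+1,+}_{i,j-\frac12}\bigr)\Bigr)\ge0,\qquad \Delta t^2\le\zeta\,\frac{2h^{n+1}_{i,j}}{3\omega^2\eta^2}\Bigl(\eta-\frac32h^{n+1}_{i,j}\Bigr).$$ **Quantities in the conclusion.** $p^{n+1}_{i,j}=\frac12g(h^{n+1}_{i,j})^2$. The functions with subscript $\mathcal D^x$ (resp. $\mathcal D^y$) are piecewise constant on the dual cells $D_{i+\frac12,j}$ (resp. $D_{i,j+\frac12}$): $(m^{n+1}_{x,\mathcal D^x})_{i+\frac12,j}=\{\{h^{n+1}u^n\}\}_{i+\frac12,j}$, $(m^{n+1}_{y,\mathcal D^y})_{i,j+\frac12}=\{\{h^{n+1}v^n\}\}_{i,j+\frac12}$, and for $w=u,v$, $(w^n_{\mathcal D^x})_{i+\frac12,j}=w^n_{i+\frac12,j}$, $(w^n_{\mathcal D^y})_{i,j+\frac12}=w^n_{i,j+\frac12}$ (upwind values). *)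

theory Defs
  imports "HOL-Analysis.Analysis"
begin

definition pdiff :: "'a::real_normed_vector \<Rightarrow> ('a \<Rightarrow> real) \<Rightarrow> 'a \<Rightarrow> real" where
  "pdiff e f z = frechet_derivative f (at z) e"

primrec C_k :: "nat \<Rightarrow> ('a::real_normed_vector \<Rightarrow> real) \<Rightarrow> bool" where
  "C_k 0 f \<longleftrightarrow> continuous_on UNIV f"
| "C_k (Suc k) f \<longleftrightarrow> (\<forall>z. f differentiable (at z)) \<and> (\<forall>e. C_k k (pdiff e f))"

definition smooth :: "('a::real_normed_vector \<Rightarrow> real) \<Rightarrow> bool" where
  "smooth f \<longleftrightarrow> (\<forall>k. C_k k f)"

(* The torus is R^2 modulo the lattice Lx Z x Ly Z. Functions on it are doubly periodic
   functions on the plane, integrated over one fundamental rectangle. *)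

definition torus :: "real \<Rightarrow> real \<Rightarrow> (real \<times> real) set" where
  "torus Lx Ly = {0..Lx} \<times> {0..Ly}"

definition doubly_periodic :: "real \<Rightarrow> real \<Rightarrow> (real \<times> real \<Rightarrow> real) \<Rightarrow> bool" where
  "doubly_periodic Lx Ly f \<longleftrightarrow> (\<forall>x y. f (x + Lx, y) = f (x, y) \<and> f (x, y + Ly) = f (x, y))"

(* L^p classes are represented by Borel functions. *)

definition L1_torus :: "real \<Rightarrow> real \<Rightarrow> (real \<times> real \<Rightarrow> real) \<Rightarrow> bool" where
  "L1_torus Lx Ly f \<longleftrightarrow>
     f \<in> borel_measurable borel \<and> doubly_periodic Lx Ly f \<and> set_integrable lborel (torus Lx Ly) f"

definition Linf_torus :: "real \<Rightarrow> real \<Rightarrow> (real \<times> real \<Rightarrow> real) \<Rightarrow> bool" where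
  "Linf_torus Lx Ly f \<longleftrightarrow>
     f \<in> borel_measurable borel \<and> doubly_periodic Lx Ly f \<and> (\<exists>C. AE z in lborel. \<bar>f z\<bar> \<le> C)"

definition L2_norm_torus :: "real \<Rightarrow> real \<Rightarrow> (real \<times> real \<Rightarrow> real) \<Rightarrow> real" where
  "L2_norm_torus Lx Ly f = sqrt (LINT z:torus Lx Ly|lborel. (f z)\<^sup>2)"

definition weak_pdiff ::
  "real \<Rightarrow> real \<Rightarrow> real \<times> real \<Rightarrow> (real \<times> real \<Rightarrow> real) \<Rightarrow> (real \<times> real \<Rightarrow> real) \<Rightarrow> bool" where
  "weak_pdiff Lx Ly e f f' \<longleftrightarrow> L1_torus Lx Ly f' \<and>
     (\<forall>\<theta>. smooth \<theta> \<and> doubly_periodic Lx Ly \<theta> \<longrightarrow>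
        (LINT z:torus Lx Ly|lborel. f z * pdiff e \<theta> z) = - (LINT z:torus Lx Ly|lborel. f' z * \<theta> z))"

primrec W_inf :: "nat \<Rightarrow> real \<Rightarrow> real \<Rightarrow> (real \<times> real \<Rightarrow> real) \<Rightarrow> bool" where
  "W_inf 0 Lx Ly f \<longleftrightarrow> Linf_torus Lx Ly f"
| "W_inf (Suc k) Lx Ly f \<longleftrightarrow> Linf_torus Lx Ly f \<and>
     (\<forall>e\<in>{(1, 0), (0, 1)}. \<exists>f'. weak_pdiff Lx Ly e f f' \<and> W_inf k Lx Ly f')"

record sw_problem =
  Lx :: real
  Ly :: real
  Tend :: real
  grav :: real
  cor :: real
  bot :: "real \<times> real \<Rightarrow> real"
  h_init :: "real \<times> real \<Rightarrow> real"
  u_init :: "real \<times> real \<Rightarrow> real"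
  v_init :: "real \<times> real \<Rightarrow> real"

definition valid_problem :: "sw_problem \<Rightarrow> bool" where
  "valid_problem P \<longleftrightarrow> Lx P > 0 \<and> Ly P > 0 \<and> Tend P > 0 \<and> grav P > 0 \<and>
     W_inf 2 (Lx P) (Ly P) (bot P) \<and>
     Linf_torus (Lx P) (Ly P) (h_init P) \<and> (AE z in lborel. h_init P z > 0) \<and>
     Linf_torus (Lx P) (Ly P) (u_init P) \<and> Linf_torus (Lx P) (Ly P) (v_init P)"

abbreviation Omega :: "sw_problem \<Rightarrow> (real \<times> real) set" where
  "Omega P \<equiv> torus (Lx P) (Ly P)"

(* C_c^infinity([0,T) x Omega): restrictions to t >= 0 of smooth functions; smoothness
   includes t = 0, and the support stays away from t = T only. *)
definition test_function :: "sw_problem \<Rightarrow> (real \<times> real \<times> real \<Rightarrow> real) \<Rightarrow> bool" where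
  "test_function P \<psi> \<longleftrightarrow> smooth \<psi> \<and> (\<forall>t. doubly_periodic (Lx P) (Ly P) (\<lambda>z. \<psi> (t, z))) \<and>
     (\<exists>\<tau><Tend P. \<forall>t\<ge>\<tau>. \<forall>z. \<psi> (t, z) = 0)"

abbreviation dt_test :: "(real \<times> real \<times> real \<Rightarrow> real) \<Rightarrow> real \<times> real \<times> real \<Rightarrow> real" where
  "dt_test \<equiv> pdiff (1, 0, 0)"
abbreviation dx_test :: "(real \<times> real \<times> real \<Rightarrow> real) \<Rightarrow> real \<times> real \<times> real \<Rightarrow> real" where
  "dx_test \<equiv> pdiff (0, 1, 0)"
abbreviation dy_test :: "(real \<times> real \<times> real \<Rightarrow> real) \<Rightarrow> real \<times> real \<times> real \<Rightarrow> real" where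
  "dy_test \<equiv> pdiff (0, 0, 1)"

(* Grid functions are indexed by all integers and periodic with periods nx and ny.
   A quantity living at (i+1/2, j) or (i, j+1/2) is stored at index (i, j).
   (x0, y0) is the centre of the cell with index (0, 0). *)

type_synonym grid = "int \<Rightarrow> int \<Rightarrow> real"

record mesh =
  nx :: nat
  ny :: nat
  nt :: nat
  dx :: real
  dy :: real
  dt :: real
  x0 :: real
  y0 :: real

definition mesh_of :: "sw_problem \<Rightarrow> 'm mesh_scheme \<Rightarrow> bool" where
  "mesh_of P M \<longleftrightarrow> dx M > 0 \<and> dy M > 0 \<and> dt M > 0 \<and>
     real (nx M) * dx M = Lx P \<and> real (ny M) * dy M = Ly P \<and> real (nt M) * dt M = Tend P"

definition xc :: "'m mesh_scheme \<Rightarrow> int \<Rightarrow> real" where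
  "xc M i = x0 M + of_int i * dx M"

definition yc :: "'m mesh_scheme \<Rightarrow> int \<Rightarrow> real" where
  "yc M j = y0 M + of_int j * dy M"

definition cell :: "'m mesh_scheme \<Rightarrow> int \<Rightarrow> int \<Rightarrow> (real \<times> real) set" where
  "cell M i j = {xc M i - dx M / 2..xc M i + dx M / 2} \<times> {yc M j - dy M / 2..yc M j + dy M / 2}"

definition mesh_size :: "'m mesh_scheme \<Rightarrow> real" where
  "mesh_size M =
     Max ((\<lambda>(i, j). diameter (cell M i j)) ` ({0..<int (nx M)} \<times> {0..<int (ny M)}))"

definition time :: "'m mesh_scheme \<Rightarrow> nat \<Rightarrow> real" where
  "time M n = real n * dt M"

definition grid_periodic :: "'m mesh_scheme \<Rightarrow> grid \<Rightarrow> bool" where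
  "grid_periodic M z \<longleftrightarrow>
     (\<forall>i j. z (i + int (nx M)) j = z i j \<and> z i (j + int (ny M)) = z i j)"

definition cell_average :: "'m mesh_scheme \<Rightarrow> (real \<times> real \<Rightarrow> real) \<Rightarrow> grid" where
  "cell_average M f i j = (LINT z:cell M i j|lborel. f z) / (dx M * dy M)"

(* Piecewise constant functions on the cells and on the two families of dual cells. Points on
   common edges, a null set, are assigned to the cell on their right, resp. above them. *)

definition pc :: "'m mesh_scheme \<Rightarrow> grid \<Rightarrow> real \<times> real \<Rightarrow> real" where
  "pc M z p = z \<lfloor>(fst p - x0 M) / dx M + 1/2\<rfloor> \<lfloor>(snd p - y0 M) / dy M + 1/2\<rfloor>"

definition pc_Dx :: "'m mesh_scheme \<Rightarrow> grid \<Rightarrow> real \<times> real \<Rightarrow> real" where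
  "pc_Dx M z p = z \<lfloor>(fst p - x0 M) / dx M\<rfloor> \<lfloor>(snd p - y0 M) / dy M + 1/2\<rfloor>"

definition pc_Dy :: "'m mesh_scheme \<Rightarrow> grid \<Rightarrow> real \<times> real \<Rightarrow> real" where
  "pc_Dy M z p = z \<lfloor>(fst p - x0 M) / dx M + 1/2\<rfloor> \<lfloor>(snd p - y0 M) / dy M\<rfloor>"

definition mean_x :: "grid \<Rightarrow> grid" where
  "mean_x z i j = (z i j + z (i + 1) j) / 2"

definition mean_y :: "grid \<Rightarrow> grid" where
  "mean_y z i j = (z i j + z i (j + 1)) / 2"

definition eth_x :: "'m mesh_scheme \<Rightarrow> grid \<Rightarrow> grid" where
  "eth_x M z i j = (mean_x z i j - mean_x z (i - 1) j) / dx M"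

definition eth_y :: "'m mesh_scheme \<Rightarrow> grid \<Rightarrow> grid" where
  "eth_y M z i j = (mean_y z i j - mean_y z i (j - 1)) / dy M"

definition eth_x_E :: "'m mesh_scheme \<Rightarrow> grid \<Rightarrow> real \<times> real \<Rightarrow> real" where
  "eth_x_E M z = pc_Dx M (\<lambda>i j. (z (i + 1) j - z i j) / dx M)"

definition eth_y_E :: "'m mesh_scheme \<Rightarrow> grid \<Rightarrow> real \<times> real \<Rightarrow> real" where
  "eth_y_E M z = pc_Dy M (\<lambda>i j. (z i (j + 1) - z i j) / dy M)"

definition pos_part :: "real \<Rightarrow> real" where
  "pos_part a = (a + \<bar>a\<bar>) / 2"

definition neg_part :: "real \<Rightarrow> real" where
  "neg_part a = (a - \<bar>a\<bar>) / 2"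

record sw_run = mesh +
  hh :: "nat \<Rightarrow> grid"
  uu :: "nat \<Rightarrow> grid"
  vv :: "nat \<Rightarrow> grid"

definition phi :: "sw_problem \<Rightarrow> sw_run \<Rightarrow> nat \<Rightarrow> grid" where
  "phi P S n i j = grav P * (hh S n i j + cell_average S (bot P) i j)"

(* The quantities with superscript n+1 that also involve level n (q, r, m, F, G and the upwind
   values selected by F, G) carry the index n below. *)

definition qq :: "sw_problem \<Rightarrow> real \<Rightarrow> sw_run \<Rightarrow> nat \<Rightarrow> grid" where
  "qq P \<eta> S n i j = \<eta> * dt S * (eth_x S (phi P S (n + 1)) i j - cor P * vv S n i j)"

definition rr :: "sw_problem \<Rightarrow> real \<Rightarrow> sw_run \<Rightarrow> nat \<Rightarrow> grid" where
  "rr P \<eta> S n i j = \<eta> * dt S * (eth_y S (phi P S (n + 1)) i j + cor P * uu S n i j)"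

definition m_x :: "sw_run \<Rightarrow> nat \<Rightarrow> grid" where
  "m_x S n = mean_x (\<lambda>i j. hh S (n + 1) i j * uu S n i j)"

definition m_y :: "sw_run \<Rightarrow> nat \<Rightarrow> grid" where
  "m_y S n = mean_y (\<lambda>i j. hh S (n + 1) i j * vv S n i j)"

definition FF :: "sw_problem \<Rightarrow> real \<Rightarrow> sw_run \<Rightarrow> nat \<Rightarrow> grid" where
  "FF P \<eta> S n i j = m_x S n i j - mean_x (qq P \<eta> S n) i j"

definition GG :: "sw_problem \<Rightarrow> real \<Rightarrow> sw_run \<Rightarrow> nat \<Rightarrow> grid" where
  "GG P \<eta> S n i j = m_y S n i j - mean_y (rr P \<eta> S n) i j"

definition upw_x :: "sw_problem \<Rightarrow> real \<Rightarrow> sw_run \<Rightarrow> (nat \<Rightarrow> grid) \<Rightarrow> nat \<Rightarrow> grid" where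
  "upw_x P \<eta> S w n i j = (if FF P \<eta> S n i j \<ge> 0 then w n i j else w n (i + 1) j)"

definition upw_y :: "sw_problem \<Rightarrow> real \<Rightarrow> sw_run \<Rightarrow> (nat \<Rightarrow> grid) \<Rightarrow> nat \<Rightarrow> grid" where
  "upw_y P \<eta> S w n i j = (if GG P \<eta> S n i j \<ge> 0 then w n i j else w n i (j + 1))"

definition pressure :: "sw_problem \<Rightarrow> sw_run \<Rightarrow> nat \<Rightarrow> grid" where
  "pressure P S n i j = grav P * (hh S n i j)\<^sup>2 / 2"

definition mass_equation :: "sw_problem \<Rightarrow> real \<Rightarrow> sw_run \<Rightarrow> nat \<Rightarrow> int \<Rightarrow> int \<Rightarrow> bool" where
  "mass_equation P \<eta> S n i j \<longleftrightarrow>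
     (hh S (n + 1) i j - hh S n i j) / dt S
     + (FF P \<eta> S n i j - FF P \<eta> S n (i - 1) j) / dx S
     + (GG P \<eta> S n i j - GG P \<eta> S n i (j - 1)) / dy S = 0"

definition transport :: "sw_problem \<Rightarrow> real \<Rightarrow> sw_run \<Rightarrow> (nat \<Rightarrow> grid) \<Rightarrow> nat \<Rightarrow> grid" where
  "transport P \<eta> S w n i j =
     (hh S (n + 1) i j * w (n + 1) i j - hh S n i j * w n i j) / dt S
     + (FF P \<eta> S n i j * upw_x P \<eta> S w n i j
        - FF P \<eta> S n (i - 1) j * upw_x P \<eta> S w n (i - 1) j) / dx S
     + (GG P \<eta> S n i j * upw_y P \<eta> S w n i j
        - GG P \<eta> S n i (j - 1) * upw_y P \<eta> S w n i (j - 1)) / dy S"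

definition x_momentum_equation :: "sw_problem \<Rightarrow> real \<Rightarrow> sw_run \<Rightarrow> nat \<Rightarrow> int \<Rightarrow> int \<Rightarrow> bool" where
  "x_momentum_equation P \<eta> S n i j \<longleftrightarrow>
     transport P \<eta> S (uu S) n i j + hh S (n + 1) i j * eth_x S (phi P S (n + 1)) i j
     = cor P * hh S (n + 1) i j * vv S n i j - cor P * rr P \<eta> S n i j"

definition y_momentum_equation :: "sw_problem \<Rightarrow> real \<Rightarrow> sw_run \<Rightarrow> nat \<Rightarrow> int \<Rightarrow> int \<Rightarrow> bool" where
  "y_momentum_equation P \<eta> S n i j \<longleftrightarrow>
     transport P \<eta> S (vv S) n i j + hh S (n + 1) i j * eth_y S (phi P S (n + 1)) i j
     = - cor P * hh S (n + 1) i j * uu S n i j + cor P * qq P \<eta> S n i j"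

definition numerical_solution :: "sw_problem \<Rightarrow> real \<Rightarrow> sw_run \<Rightarrow> bool" where
  "numerical_solution P \<eta> S \<longleftrightarrow> mesh_of P S \<and>
     (\<forall>n\<le>nt S. grid_periodic S (hh S n) \<and> grid_periodic S (uu S n) \<and> grid_periodic S (vv S n)) \<and>
     (\<forall>i j. hh S 0 i j = cell_average S (h_init P) i j \<and>
            uu S 0 i j = cell_average S (u_init P) i j \<and>
            vv S 0 i j = cell_average S (v_init P) i j) \<and>
     (\<forall>n<nt S. \<forall>i j. mass_equation P \<eta> S n i j \<and>
        x_momentum_equation P \<eta> S n i j \<and> y_momentum_equation P \<eta> S n i j)"

(* For cor P = 0 the second condition is void (its right-hand side is +infinity), whereas
   division by zero in HOL would turn it into dt S = 0. *)
definition energy_stability_conditions :: "sw_problem \<Rightarrow> real \<Rightarrow> real \<Rightarrow> sw_run \<Rightarrow> bool" where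
  "energy_stability_conditions P \<eta> \<zeta> S \<longleftrightarrow> (\<forall>n<nt S. \<forall>i j.
     1 + 3 * dt S / hh S (n + 1) i j *
       ((neg_part (FF P \<eta> S n i j) - pos_part (FF P \<eta> S n (i - 1) j)) / dx S
        + (neg_part (GG P \<eta> S n i j) - pos_part (GG P \<eta> S n i (j - 1))) / dy S) \<ge> 0 \<and>
     (cor P \<noteq> 0 \<longrightarrow>
       (dt S)\<^sup>2 \<le> \<zeta> * (2 * hh S (n + 1) i j / (3 * (cor P)\<^sup>2 * \<eta>\<^sup>2)) * (\<eta> - 3/2 * hh S (n + 1) i j)))"

definition height_bounds :: "real \<Rightarrow> real \<Rightarrow> sw_run \<Rightarrow> bool" where
  "height_bounds hlo hhi S \<longleftrightarrow> (\<forall>n\<le>nt S. \<forall>i j. hlo \<le> hh S n i j \<and> hh S n i j \<le> hhi)"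

definition gradient_bounds :: "sw_problem \<Rightarrow> real \<Rightarrow> sw_run \<Rightarrow> bool" where
  "gradient_bounds P c S \<longleftrightarrow> (\<forall>n<nt S.
     L2_norm_torus (Lx P) (Ly P) (eth_x_E S (hh S (n + 1))) \<le> c * dx S powr (-1/2) \<and>
     L2_norm_torus (Lx P) (Ly P) (eth_y_E S (hh S (n + 1))) \<le> c * dy S powr (-1/2))"

(* c is a common value of the mesh-independent constants hidden in the four relations "lesssim". *)
definition admissible_runs ::
  "sw_problem \<Rightarrow> real \<Rightarrow> real \<Rightarrow> real \<Rightarrow> real \<Rightarrow> real \<Rightarrow> sw_run set" where
  "admissible_runs P \<eta> \<zeta> hlo hhi c = {S.
     numerical_solution P \<eta> S \<and> energy_stability_conditions P \<eta> \<zeta> S \<and>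
     height_bounds hlo hhi S \<and> gradient_bounds P c S \<and>
     dt S \<le> c * mesh_size S \<and> mesh_size S \<le> c * dt S}"

(* The limit mesh_size -> 0, uniformly within the family A of runs. *)
definition vanishing_mesh :: "sw_run set \<Rightarrow> sw_run filter" where
  "vanishing_mesh A = inf (filtercomap mesh_size (at_right 0)) (principal A)"

definition spacetime_sum :: "sw_problem \<Rightarrow> sw_run \<Rightarrow> (nat \<Rightarrow> real \<Rightarrow> real \<times> real \<Rightarrow> real) \<Rightarrow> real" where
  "spacetime_sum P S f =
     (\<Sum>n<nt S. LINT t:{time S n..time S (n + 1)}|lborel. LINT z:Omega P|lborel. f n t z)"

end

theory Submission
  imports Defs
begin

text \<open>
  The consistency errors are residuals of the weak form, so the task is to bound them by a constant times
  a power of the step sizes, with a constant that is the same for all admissible runs.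

  The basis is the discrete energy estimate (\<open>energy_estimate\<close>). Under the two stability conditions the sum
  of kinetic, potential and topographic energy decreases, and a fixed fraction \<open>kappa\<close> of the dissipation
  caused by the stabilising terms \<open>q\<close> and \<open>r\<close> is left over. This bounds the velocities in \<open>L\<^sup>2\<close>, uniformly in
  time, and it bounds the sum over all time steps of the squares of \<open>q\<close> and \<open>r\<close> (\<open>stabilisation_sum\<close>). With
  \<open>\<bar>a * b\<bar> \<le> (l * a\<^sup>2 + b\<^sup>2 / l) / 2\<close> and \<open>l = 1 / sqrt dt\<close>, every term in which \<open>q\<close> or \<open>r\<close> meets a velocity or a
  test function is then of order \<open>sqrt dt\<close>.

  For a transported quantity (\<open>transport_consistency\<close>) the time terms telescope exactly. A discrete
  divergence is moved to the test function by a translation of the torus, and there it is a difference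
  quotient that is close to a derivative, up to one step size (\<open>flux_consistency\<close>). The mass equation is the case of
  the transported constant 1. In the momentum equations the pressure gradient is written as the
  divergence of a product of neighbouring heights, which differs from the pressure by squared jumps of the
  height (\<open>pressure_consistency\<close>); here the hypothesis on the discrete gradient of the height is used, and it
  leaves one power of the step size. For the topography one compares central differences of cell averages
  with cell averages of the weak derivative (\<open>weak_pdiff_cell\<close>, \<open>bottom_consistency\<close>). Testing the weak
  derivative with translates of a smooth bump and letting the bump tend to the indicator of a cell shows that
  they agree to first order, because the second weak derivatives are bounded.

  Grid functions are handled as functions on the plane: an index shift is a translation, a function on dual
  cells is a translate by half a step, and the translation invariance of the torus integral
  (\<open>tint_translate\<close>) replaces summation by parts. Estimates are stated for a unit direction \<open>e\<close> and a step \<open>s\<close>, to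
  be used in both coordinates.
\<close>

section \<open>Smooth and tame functions\<close>

lemma pdiff_eqI:
  assumes "(f has_derivative D) (at z)"
  shows "pdiff e f z = D e"
  using frechet_derivative_at[OF assms] by (simp add: pdiff_def)

lemma has_derivative_pdiff:
  assumes "f differentiable (at z)"
  shows "(f has_derivative (\<lambda>e. pdiff e f z)) (at z)"
  using frechet_derivative_works[of f "at z"] assms by (simp add: pdiff_def eta_contract_eq)

lemma linear_pdiff:
  assumes "f differentiable (at z)"
  shows "linear (\<lambda>e. pdiff e f z)"
  using has_derivative_linear[OF has_derivative_pdiff[OF assms]] .

lemma C_k_continuous: "C_k k f \<Longrightarrow> continuous_on UNIV f"
proof (cases k)
  case (Suc m)
  assume "C_k k f"
  then have "\<forall>z. f differentiable (at z)" using Suc by simp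
  then show ?thesis
    by (simp add: continuous_at_imp_continuous_on differentiable_imp_continuous_within)
qed simp

lemma C_k_Suc_D: "C_k (Suc k) f \<Longrightarrow> C_k k f"
proof (induction k arbitrary: f)
  case 0
  then show ?case using C_k_continuous[OF 0] by simp
next
  case (Suc k)
  then show ?case by (metis C_k.simps(2))
qed

lemma C_k_const: "C_k k (\<lambda>z. c)"
proof (induction k arbitrary: c)
  case (Suc k)
  have "pdiff e (\<lambda>z. c) = (\<lambda>z. 0)" for e :: 'a
    by (rule ext, rule pdiff_eqI) (auto intro: derivative_eq_intros)
  with Suc show ?case by simp
qed simp

lemma C_k_bounded_linear:
  assumes "bounded_linear f"
  shows "C_k k f"
proof (cases k)
  case 0
  then show ?thesis using linear_continuous_on[OF assms] by simp
next
  case (Suc m)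
  have d: "(f has_derivative f) (at z)" for z
    by (rule bounded_linear_imp_has_derivative[OF assms])
  have "pdiff e f = (\<lambda>z. f e)" for e
    by (rule ext, rule pdiff_eqI) (rule d)
  then show ?thesis using Suc d C_k_const by (auto simp: differentiable_def)
qed

lemma C_k_add:
  assumes "C_k k f" "C_k k g"
  shows "C_k k (\<lambda>z. f z + g z)"
  using assms
proof (induction k arbitrary: f g)
  case 0
  then show ?case by (auto intro: continuous_intros)
next
  case (Suc k)
  have df: "f differentiable (at z)" and dg: "g differentiable (at z)" for z
    using Suc.prems by auto
  have "pdiff e (\<lambda>z. f z + g z) = (\<lambda>z. pdiff e f z + pdiff e g z)" for e
    by (rule ext, rule pdiff_eqI) (intro has_derivative_add has_derivative_pdiff df dg)
  with Suc df dg show ?case by auto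
qed

lemma C_k_mult:
  assumes "C_k k f" "C_k k g"
  shows "C_k k (\<lambda>z. f z * g z)"
  using assms
proof (induction k arbitrary: f g)
  case 0
  then show ?case by (auto intro: continuous_intros)
next
  case (Suc k)
  have df: "f differentiable (at z)" and dg: "g differentiable (at z)" for z
    using Suc.prems by auto
  have "pdiff e (\<lambda>z. f z * g z) = (\<lambda>z. f z * pdiff e g z + pdiff e f z * g z)" for e
    by (rule ext, rule pdiff_eqI) (intro has_derivative_mult has_derivative_pdiff df dg)
  moreover have "C_k k f" "C_k k g" using Suc.prems C_k_Suc_D by blast+
  ultimately show ?case using Suc df dg by (auto intro!: C_k_add)
qed

text \<open>
  The derivatives of the outer function are given as one family \<open>G\<close> closed under differentiation, so
  that a single induction on the order covers \<open>exp\<close> and \<open>cos\<close>, the only outer functions that occur.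
\<close>
lemma C_k_compose:
  assumes G: "\<And>m x. (G m has_real_derivative G (Suc m) x) (at x)" and f: "C_k k f"
  shows "C_k k (\<lambda>z. G m (f z))"
  using f
proof (induction k arbitrary: m f)
  case 0
  have "continuous_on UNIV (G m)"
    by (meson G DERIV_isCont continuous_at_imp_continuous_on)
  then show ?case using 0 by (auto intro: continuous_on_compose2)
next
  case (Suc k)
  have df: "f differentiable (at z)" for z using Suc.prems by auto
  have d: "((\<lambda>z. G m (f z)) has_derivative (\<lambda>e. G (Suc m) (f z) * pdiff e f z)) (at z)" for z
    using has_derivative_compose[OF has_derivative_pdiff[OF df] G[unfolded has_field_derivative_def]] .
  have "pdiff e (\<lambda>z. G m (f z)) = (\<lambda>z. G (Suc m) (f z) * pdiff e f z)" for e
    by (rule ext, rule pdiff_eqI) (rule d)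
  moreover have "C_k k f" using Suc.prems C_k_Suc_D by blast
  moreover have "(\<lambda>z. G m (f z)) differentiable (at z)" for z using d differentiable_def by blast
  ultimately show ?case using Suc by (auto intro!: C_k_mult)
qed

lemma C_k_exp: "C_k k f \<Longrightarrow> C_k k (\<lambda>z. exp (f z))"
  using C_k_compose[of "\<lambda>m. exp" k f 0] by (auto intro: derivative_eq_intros)

lemma C_k_cos:
  assumes "C_k k f"
  shows "C_k k (\<lambda>z. cos (f z))"
proof -
  have "((\<lambda>x. cos (x + real m * pi / 2)) has_real_derivative cos (x + real (Suc m) * pi / 2)) (at x)"
    for m x
  proof -
    have "cos (x + real (Suc m) * pi / 2) = - sin (x + real m * pi / 2)"
      using sin_cos_eq[of "- (x + real m * pi / 2)"] by (simp add: field_simps)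
    then show ?thesis by (auto intro!: derivative_eq_intros)
  qed
  from C_k_compose[of "\<lambda>m x. cos (x + real m * pi / 2)", OF this assms, of 0]
  show ?thesis by simp
qed

lemma has_derivative_translate:
  assumes "f differentiable (at (z + d))"
  shows "((\<lambda>z. f (z + d)) has_derivative (\<lambda>e. pdiff e f (z + d))) (at z)"
proof -
  have "((\<lambda>z. z + d) has_derivative (\<lambda>e. e)) (at z)"
    by (auto intro!: derivative_eq_intros)
  from has_derivative_compose[OF this has_derivative_pdiff[OF assms]] show ?thesis .
qed

lemma C_k_translate: "C_k k f \<Longrightarrow> C_k k (\<lambda>z. f (z + d))"
proof (induction k arbitrary: f)
  case 0
  have "continuous_on UNIV (\<lambda>z. z + d)" by (intro continuous_intros)
  then show ?case using 0 by (auto intro: continuous_on_compose2)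
next
  case (Suc k)
  have d: "((\<lambda>z. f (z + d)) has_derivative (\<lambda>e. pdiff e f (z + d))) (at z)" for z
    using Suc.prems by (intro has_derivative_translate) auto
  have "pdiff e (\<lambda>z. f (z + d)) = (\<lambda>z. pdiff e f (z + d))" for e
    by (rule ext, rule pdiff_eqI) (rule d)
  then show ?case using Suc d by (auto simp: differentiable_def)
qed

lemma smooth_translate: "smooth f \<Longrightarrow> smooth (\<lambda>z. f (z + d))"
  by (simp add: smooth_def C_k_translate)

lemma smooth_differentiable: "smooth f \<Longrightarrow> f differentiable (at z)"
  unfolding smooth_def by (metis C_k.simps(2))

lemma smooth_pdiff: "smooth f \<Longrightarrow> smooth (pdiff e f)"
  unfolding smooth_def by (metis C_k.simps(2))

lemma smooth_continuous: "smooth f \<Longrightarrow> continuous_on UNIV f"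
  unfolding smooth_def using C_k.simps(1) by blast

lemma pdiff_translate:
  assumes "f differentiable (at (z + d))"
  shows "pdiff e (\<lambda>z. f (z + d)) z = pdiff e f (z + d)"
  by (rule pdiff_eqI) (rule has_derivative_translate[OF assms])

lemma has_real_derivative_along_line:
  assumes "smooth f"
  shows "((\<lambda>s. f (z + s *\<^sub>R e)) has_real_derivative pdiff e f (z + s *\<^sub>R e)) (at s)"
proof -
  have df: "f differentiable (at (z + s *\<^sub>R e))" by (rule smooth_differentiable[OF assms])
  have "((\<lambda>s. z + s *\<^sub>R e) has_derivative (\<lambda>h. h *\<^sub>R e)) (at s)"
    by (auto intro!: derivative_eq_intros)
  from has_derivative_compose[OF this has_derivative_pdiff[OF df]]
  have "((\<lambda>s. f (z + s *\<^sub>R e)) has_derivative (\<lambda>h. pdiff (h *\<^sub>R e) f (z + s *\<^sub>R e))) (at s)" .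
  moreover have "pdiff (h *\<^sub>R e) f (z + s *\<^sub>R e) = pdiff e f (z + s *\<^sub>R e) * h" for h
    using linear_scale[OF linear_pdiff[OF df], of h e] by simp
  ultimately show ?thesis by (simp add: has_field_derivative_def)
qed

text \<open>
  The mean value theorem along a segment replaces Taylor expansions throughout: it turns difference
  quotients of a test function into one value of its derivative at a nearby point.
\<close>
lemma pdiff_mvt:
  assumes "smooth f" "s > 0"
  obtains \<xi> where "0 < \<xi>" "\<xi> < s" "f (z + s *\<^sub>R e) - f z = s * pdiff e f (z + \<xi> *\<^sub>R e)"
proof -
  have "\<exists>\<xi>. \<xi> > 0 \<and> \<xi> < s \<and> f (z + s *\<^sub>R e) - f (z + 0 *\<^sub>R e) = (s - 0) * pdiff e f (z + \<xi> *\<^sub>R e)"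
    by (rule MVT2[OF assms(2)]) (rule has_real_derivative_along_line[OF assms(1)])
  then show ?thesis using that by auto
qed

lemma doubly_periodic_shift:
  assumes "doubly_periodic L M f"
  shows "f (x + of_int k * L, y + of_int l * M) = f (x, y)"
proof -
  have 1: "f (x + of_int k * L, y) = f (x, y)" for x y and k :: int
  proof (induction k rule: int_induct[of _ 0])
    case (step1 i)
    have "f (x + of_int (i + 1) * L, y) = f ((x + of_int i * L) + L, y)" by (simp add: algebra_simps)
    also have "\<dots> = f (x, y)" using assms step1 unfolding doubly_periodic_def by metis
    finally show ?case .
  next
    case (step2 i)
    have "f (x + of_int (i - 1) * L, y) = f ((x + of_int (i - 1) * L) + L, y)"
      using assms unfolding doubly_periodic_def by metis
    also have "\<dots> = f (x + of_int i * L, y)" by (simp add: algebra_simps)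
    also have "\<dots> = f (x, y)" by (rule step2)
    finally show ?case .
  qed simp
  have 2: "f (x, y + of_int l * M) = f (x, y)" for x y and l :: int
  proof (induction l rule: int_induct[of _ 0])
    case (step1 i)
    have "f (x, y + of_int (i + 1) * M) = f (x, (y + of_int i * M) + M)" by (simp add: algebra_simps)
    also have "\<dots> = f (x, y)" using assms step1 unfolding doubly_periodic_def by metis
    finally show ?case .
  next
    case (step2 i)
    have "f (x, y + of_int (i - 1) * M) = f (x, (y + of_int (i - 1) * M) + M)"
      using assms unfolding doubly_periodic_def by metis
    also have "\<dots> = f (x, y + of_int i * M)" by (simp add: algebra_simps)
    also have "\<dots> = f (x, y)" by (rule step2)
    finally show ?case .
  qed simp
  show ?thesis by (simp only: 1 2)
qed

lemma doubly_periodic_translate: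
  assumes "doubly_periodic L M f"
  shows "doubly_periodic L M (\<lambda>z. f (z + d))"
  unfolding doubly_periodic_def
proof (intro allI conjI)
  fix x y
  have "(x + L, y) + d = ((x + fst d) + L, y + snd d)" "(x, y + M) + d = (x + fst d, (y + snd d) + M)"
    "(x, y) + d = (x + fst d, y + snd d)" by (auto simp: prod_eq_iff)
  then show "f ((x + L, y) + d) = f ((x, y) + d)" "f ((x, y + M) + d) = f ((x, y) + d)"
    using assms unfolding doubly_periodic_def by simp_all
qed

lemma doubly_periodic_representative:
  assumes "L > 0" "M > 0" "doubly_periodic L M f"
  obtains z' where "z' \<in> torus L M" "f z' = f z"
proof
  let ?k = "\<lfloor>fst z / L\<rfloor>" and ?l = "\<lfloor>snd z / M\<rfloor>"
  let ?z = "(fst z + of_int (- ?k) * L, snd z + of_int (- ?l) * M)"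
  have "of_int ?k * L \<le> fst z" "fst z \<le> (of_int ?k + 1) * L"
       "of_int ?l * M \<le> snd z" "snd z \<le> (of_int ?l + 1) * M"
    using floor_divide_lower[OF assms(1), of "fst z"] floor_divide_upper[OF assms(1), of "fst z"]
      floor_divide_lower[OF assms(2), of "snd z"] floor_divide_upper[OF assms(2), of "snd z"] by linarith+
  then show "?z \<in> torus L M" by (simp add: torus_def algebra_simps)
  show "f ?z = f z" using doubly_periodic_shift[OF assms(3), of "fst z" "- ?k" "snd z" "- ?l"] by simp
qed

lemma smooth_periodic_bounded:
  assumes "L > 0" "M > 0" "smooth f" "doubly_periodic L M f"
  obtains K where "K \<ge> 0" "\<And>z. \<bar>f z\<bar> \<le> K"
proof -
  have "compact (torus L M)" unfolding torus_def by (intro compact_Times) auto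
  moreover have "continuous_on (torus L M) f"
    using smooth_continuous[OF assms(3)] continuous_on_subset by blast
  ultimately have "bounded (f ` torus L M)" by (meson compact_continuous_image compact_imp_bounded)
  then obtain K where K: "\<And>z. z \<in> torus L M \<Longrightarrow> \<bar>f z\<bar> \<le> K"
    unfolding bounded_iff by (metis imageI real_norm_def)
  have "\<bar>f z\<bar> \<le> K" for z
    using doubly_periodic_representative[OF assms(1,2,4), of z] K by metis
  then have "\<bar>f z\<bar> \<le> \<bar>K\<bar>" for z using abs_ge_self[of K] order_trans by blast
  then show ?thesis using that[of "\<bar>K\<bar>"] by auto
qed

lemma doubly_periodic_pdiff:
  assumes "smooth f" "doubly_periodic L M f"
  shows "doubly_periodic L M (pdiff e f)"
proof -
  have *: "pdiff e f (z + d) = pdiff e f z" if "\<And>z. f (z + d) = f z" for d z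
  proof -
    have "(\<lambda>z. f (z + d)) = f" using that by auto
    then show ?thesis using pdiff_translate[OF smooth_differentiable[OF assms(1)], where z = z and d = d and e = e] by simp
  qed
  have "f (z + (L, 0)) = f z" "f (z + (0, M)) = f z" for z
    using assms(2) unfolding doubly_periodic_def by (cases z; simp)+
  from *[OF this(1)] *[OF this(2)] show ?thesis
    unfolding doubly_periodic_def by (metis add_Pair add.right_neutral)
qed

text \<open>
  The only quantitative information about a test function that enters the error bounds: on the
  space-time slab it is bounded and Lipschitz, with one constant for both. A test function itself is
  unconstrained for \<open>t \<rightarrow> -\<infinity>\<close>, hence the restriction to \<open>{0..T}\<close>.
\<close>
definition tame :: "real \<Rightarrow> real \<Rightarrow> (real \<times> real \<times> real \<Rightarrow> real) \<Rightarrow> bool" where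
  "tame T K D \<longleftrightarrow> (\<forall>t\<in>{0..T}. \<forall>z. \<bar>D (t, z)\<bar> \<le> K \<and>
     (\<forall>t'\<in>{0..T}. \<forall>z'. \<bar>D (t, z) - D (t', z')\<bar> \<le> K * (\<bar>t - t'\<bar> + norm (z - z'))))"

lemma tame_mono: "tame T K D \<Longrightarrow> K \<le> K' \<Longrightarrow> tame T K' D"
  unfolding tame_def by (smt (verit, best) mult_right_mono norm_ge_zero)

lemma smooth_spatially_periodic_bounded:
  fixes D :: "real \<times> real \<times> real \<Rightarrow> real"
  assumes "L > 0" "M > 0" "smooth D" "\<And>t. doubly_periodic L M (\<lambda>z. D (t, z))"
  obtains K where "K \<ge> 0" "\<And>t z. t \<in> {0..T} \<Longrightarrow> \<bar>D (t, z)\<bar> \<le> K"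
proof -
  have "compact ({0..T} \<times> torus L M)" unfolding torus_def by (intro compact_Times) auto
  moreover have "continuous_on ({0..T} \<times> torus L M) D"
    using smooth_continuous[OF assms(3)] continuous_on_subset by blast
  ultimately have "bounded (D ` ({0..T} \<times> torus L M))"
    by (meson compact_continuous_image compact_imp_bounded)
  then obtain K where K: "\<And>z. z \<in> {0..T} \<times> torus L M \<Longrightarrow> \<bar>D z\<bar> \<le> K"
    unfolding bounded_iff by (metis imageI real_norm_def)
  have "\<bar>D (t, z)\<bar> \<le> K" if "t \<in> {0..T}" for t z
    using doubly_periodic_representative[OF assms(1,2) assms(4)[of t], where z = z] K that by (metis SigmaI)
  then have "\<bar>D (t, z)\<bar> \<le> \<bar>K\<bar>" if "t \<in> {0..T}" for t z using abs_ge_self[of K] order_trans that by blast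
  then show ?thesis using that[of "\<bar>K\<bar>"] by auto
qed

lemma spatially_periodic_pdiff:
  assumes "smooth D" "\<And>t. doubly_periodic L M (\<lambda>z. D (t, z))"
  shows "doubly_periodic L M (\<lambda>z. pdiff e D (t, z))"
proof -
  have *: "pdiff e D (t, z + d) = pdiff e D (t, z)" if "\<And>t z. D (t, z + d) = D (t, z)" for d z
  proof -
    have "(\<lambda>p. D (p + (0, d))) = D" using that by (auto simp: fun_eq_iff)
    then show ?thesis
      using pdiff_translate[OF smooth_differentiable[OF assms(1)], where e = e and z = "(t, z)" and d = "(0, d)"] by simp
  qed
  have "D (t, z + (L, 0)) = D (t, z)" "D (t, z + (0, M)) = D (t, z)" for t z
    using assms(2) unfolding doubly_periodic_def by (cases z; simp)+
  from *[OF this(1)] *[OF this(2)] show ?thesis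
    unfolding doubly_periodic_def by (metis add_Pair add.right_neutral)
qed

text \<open>
  Periodicity reduces the slab to a compact set, on which the continuous first derivatives are
  bounded; the mean value theorem on the segment between two points then gives the Lipschitz bound.
\<close>
lemma smooth_spatially_periodic_tame:
  assumes "L > 0" "M > 0" "smooth D" "\<And>t. doubly_periodic L M (\<lambda>z. D (t, z))"
  obtains K where "K \<ge> 0" "tame T K D"
proof -
  have b: "\<exists>K\<ge>0. \<forall>t\<in>{0..T}. \<forall>z. \<bar>pdiff e D (t, z)\<bar> \<le> K" for e
    using smooth_spatially_periodic_bounded[OF assms(1,2) smooth_pdiff[OF assms(3)]
        spatially_periodic_pdiff[OF assms(3,4)], of T e] by metis
  obtain K0 where K0: "K0 \<ge> 0" "\<And>t z. t \<in> {0..T} \<Longrightarrow> \<bar>D (t, z)\<bar> \<le> K0"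
    using smooth_spatially_periodic_bounded[OF assms, of T] by metis
  obtain K1 where K1: "K1 \<ge> 0" "\<And>t z. t \<in> {0..T} \<Longrightarrow> \<bar>pdiff (1,0,0) D (t, z)\<bar> \<le> K1"
    using b by metis
  obtain K2 where K2: "K2 \<ge> 0" "\<And>t z. t \<in> {0..T} \<Longrightarrow> \<bar>pdiff (0,1,0) D (t, z)\<bar> \<le> K2"
    using b by metis
  obtain K3 where K3: "K3 \<ge> 0" "\<And>t z. t \<in> {0..T} \<Longrightarrow> \<bar>pdiff (0,0,1) D (t, z)\<bar> \<le> K3"
    using b by metis
  define K where "K = K0 + K1 + K2 + K3"
  have "\<bar>D (t, z) - D (t', z')\<bar> \<le> K * (\<bar>t - t'\<bar> + norm (z - z'))"
    if t: "t \<in> {0..T}" "t' \<in> {0..T}" for t t' z z'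
  proof -
    define v where "v = (t - t', z - z')"
    obtain \<xi> where \<xi>: "0 < \<xi>" "\<xi> < 1" "D ((t', z') + 1 *\<^sub>R v) - D (t', z') = 1 * pdiff v D ((t', z') + \<xi> *\<^sub>R v)"
      using pdiff_mvt[OF assms(3), of 1 "(t', z')" v] by auto
    define p where "p = (t', z') + \<xi> *\<^sub>R v"
    have fp: "fst p \<in> {0..T}"
    proof -
      have "fst p = (1 - \<xi>) * t' + \<xi> * t" by (simp add: p_def v_def algebra_simps)
      moreover have "0 \<le> (1 - \<xi>) * t' + \<xi> * t" using \<xi> t by auto
      moreover have "(1 - \<xi>) * t' + \<xi> * t \<le> (1 - \<xi>) * T + \<xi> * T"
        using \<xi> t by (intro add_mono mult_left_mono) auto
      ultimately show ?thesis by (simp add: algebra_simps)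
    qed
    have "v = (t - t') *\<^sub>R (1,0,0) + (fst (z - z') *\<^sub>R (0,1,0) + snd (z - z') *\<^sub>R (0,0,1))"
      by (simp add: v_def prod_eq_iff)
    moreover note lin = linear_pdiff[OF smooth_differentiable[OF assms(3)], of p]
    ultimately have "pdiff v D p = (t - t') * pdiff (1,0,0) D p + (fst (z - z') * pdiff (0,1,0) D p + snd (z - z') * pdiff (0,0,1) D p)"
      by (simp only: linear_add[OF lin] linear_scale[OF lin] real_scaleR_def)
    then have "\<bar>pdiff v D p\<bar> \<le> \<bar>t - t'\<bar> * \<bar>pdiff (1,0,0) D p\<bar> + (\<bar>fst (z - z')\<bar> * \<bar>pdiff (0,1,0) D p\<bar> + \<bar>snd (z - z')\<bar> * \<bar>pdiff (0,0,1) D p\<bar>)"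
      by (simp only: abs_mult[symmetric])
    also have "\<dots> \<le> \<bar>t - t'\<bar> * K1 + (norm (z - z') * K2 + norm (z - z') * K3)"
      using K1(2)[OF fp, of "snd p"] K2(2)[OF fp, of "snd p"] K3(2)[OF fp, of "snd p"]
        norm_fst_le[of "fst (z - z')" "snd (z - z')"] norm_snd_le[of "snd (z - z')" "fst (z - z')"]
      by (intro add_mono mult_mono) (auto simp del: fst_diff snd_diff)
    also have "\<dots> \<le> K * (\<bar>t - t'\<bar> + norm (z - z'))"
    proof -
      have "0 \<le> (K0 + K2 + K3) * \<bar>t - t'\<bar>" "0 \<le> (K0 + K1) * norm (z - z')" using K0 K1 K2 K3 by auto
      then show ?thesis unfolding K_def by (simp add: algebra_simps)
    qed
    finally show ?thesis using \<xi>(3) by (simp add: p_def v_def)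
  qed
  moreover have "\<bar>D (t, z)\<bar> \<le> K" if "t \<in> {0..T}" for t z
    using K0(2)[OF that, of z] K1(1) K2(1) K3(1) by (simp add: K_def)
  ultimately show ?thesis using K0 K1 K2 K3 by (intro that[of K]) (auto simp: tame_def K_def)
qed

text \<open>
  The point and the time at which the derivative is taken are left free, since the scheme evaluates
  quotients at the new time level and on the cells while the weak form integrates derivatives over
  the time step and over shifted cells.
\<close>
lemma tame_difference_quotient:
  assumes "smooth \<psi>" "tame T K (pdiff (0, e) \<psi>)" "norm e = 1" "K \<ge> 0"
    and "s > 0" "t \<in> {0..T}" "t' \<in> {0..T}"
  shows "\<bar>(\<psi> (t, z + s *\<^sub>R e) - \<psi> (t, z)) / s - pdiff (0, e) \<psi> (t', z')\<bar> \<le> K * (\<bar>t - t'\<bar> + s + norm (z - z'))"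
proof -
  obtain \<xi> where \<xi>: "0 < \<xi>" "\<xi> < s"
    "\<psi> ((t, z) + s *\<^sub>R (0, e)) - \<psi> (t, z) = s * pdiff (0, e) \<psi> ((t, z) + \<xi> *\<^sub>R (0, e))"
    using pdiff_mvt[OF assms(1,5)] by metis
  have "(\<psi> (t, z + s *\<^sub>R e) - \<psi> (t, z)) / s = pdiff (0, e) \<psi> (t, z + \<xi> *\<^sub>R e)"
    using \<xi> assms(5) by simp
  moreover have "\<bar>pdiff (0, e) \<psi> (t, z + \<xi> *\<^sub>R e) - pdiff (0, e) \<psi> (t', z')\<bar> \<le> K * (\<bar>t - t'\<bar> + norm ((z + \<xi> *\<^sub>R e) - z'))"
    using assms unfolding tame_def by blast
  moreover have "norm ((z + \<xi> *\<^sub>R e) - z') \<le> s + norm (z - z')"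
  proof -
    have "norm ((z + \<xi> *\<^sub>R e) - z') = norm ((z - z') + \<xi> *\<^sub>R e)" by (simp add: algebra_simps)
    also have "\<dots> \<le> norm (z - z') + norm (\<xi> *\<^sub>R e)" by (rule norm_triangle_ineq)
    finally show ?thesis using \<xi> assms(3) by simp
  qed
  ultimately show ?thesis
    using mult_left_mono[of "\<bar>t - t'\<bar> + norm ((z + \<xi> *\<^sub>R e) - z')" "\<bar>t - t'\<bar> + s + norm (z - z')" K] assms(4)
    by linarith
qed

section \<open>Integration over the torus\<close>

abbreviation tint :: "real \<Rightarrow> real \<Rightarrow> (real \<times> real \<Rightarrow> real) \<Rightarrow> real" where
  "tint L M f \<equiv> set_lebesgue_integral lborel (torus L M) f"

abbreviation tintegrable :: "real \<Rightarrow> real \<Rightarrow> (real \<times> real \<Rightarrow> real) \<Rightarrow> bool" where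
  "tintegrable L M f \<equiv> set_integrable lborel (torus L M) f"

lemma torus_sets [measurable]: "torus L M \<in> sets borel"
  unfolding torus_def by (intro borel_closed closed_Times) auto

lemma bounded_torus: "bounded (torus L M)"
  unfolding torus_def by (intro bounded_Times) auto

lemma Linf_set_integrable:
  assumes "Linf_torus L M f" "A \<in> sets borel" "bounded A"
  shows "set_integrable lborel A f"
proof -
  obtain C where "f \<in> borel_measurable borel" "AE z in lborel. \<bar>f z\<bar> \<le> C"
    using assms(1) unfolding Linf_torus_def by auto
  then show ?thesis
    unfolding set_integrable_def using assms emeasure_bounded_finite[OF assms(3)]
    by (intro integrableI_bounded_set_indicator[where B = C]) auto
qed

lemma Linf_tintegrable: "Linf_torus L M f \<Longrightarrow> tintegrable L M f"
  by (intro Linf_set_integrable bounded_torus torus_sets)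

lemma lborel_integral_translate:
  fixes g :: "'a::euclidean_space \<Rightarrow> real"
  assumes "g \<in> borel_measurable borel"
  shows "(LINT z|lborel. g (d + z)) = (LINT z|lborel. g z)"
  using integral_distr[of "\<lambda>z. d + z" lborel borel g] assms lborel_distr_plus[of d] by simp

lemma AE_lborel_translate:
  fixes d :: "'a::euclidean_space"
  assumes "AE z in lborel. Q z" "{z. Q z} \<in> sets borel"
  shows "AE z in lborel. Q (d + z)"
proof -
  have "AE z in distr lborel borel ((+) d). Q z" by (simp only: lborel_distr_plus assms(1))
  then show ?thesis using AE_distr_iff[of "(+) d" lborel borel Q] assms(2) by simp
qed

lemma set_integral_translate:
  fixes f :: "'a::euclidean_space \<Rightarrow> real"
  assumes "f \<in> borel_measurable borel" "A \<in> sets borel"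
  shows "(LINT z:A|lborel. f z) = (LINT z:{z. d + z \<in> A}|lborel. f (d + z))"
proof -
  have "(LINT z:A|lborel. f z) = (LINT z|lborel. indicator A (d + z) *\<^sub>R f (d + z))"
    unfolding set_lebesgue_integral_def using assms
    by (intro lborel_integral_translate[symmetric]) auto
  also have "(\<lambda>z. indicator A (d + z) :: real) = indicator {z. d + z \<in> A}"
    by (auto simp: indicator_def fun_eq_iff)
  finally show ?thesis by (simp add: set_lebesgue_integral_def fun_eq_iff)
qed

text \<open>
  Abstract form of the statement that the integral of a periodic function over a full period does
  not depend on the starting point. It is applied once for each coordinate of the plane.
\<close>
lemma additive_periodic_full_period:
  fixes G :: "real \<Rightarrow> real \<Rightarrow> real"
  assumes "L > 0"
    and add: "\<And>a b c. a \<le> b \<Longrightarrow> b \<le> c \<Longrightarrow> G a b + G b c = G a c"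
    and shift: "\<And>a b. G (a + L) (b + L) = G a b"
  shows "G a (a + L) = G 0 L"
proof -
  have s: "G (a + of_int k * L) (b + of_int k * L) = G a b" for a b k
  proof (induction k rule: int_induct[of _ 0])
    case (step1 i)
    then show ?case using shift[of "a + of_int i * L" "b + of_int i * L"] by (simp add: algebra_simps)
  next
    case (step2 i)
    then show ?case using shift[of "a + of_int (i - 1) * L" "b + of_int (i - 1) * L"] by (simp add: algebra_simps)
  qed simp
  \<comment> \<open>The only multiple of the period in the shifted interval splits it into two pieces that fit into one period.\<close>
  define c where "c = of_int \<lceil>a / L\<rceil> * L"
  have c: "a \<le> c" "c \<le> a + L"
  proof -
    show "a \<le> c" "c \<le> a + L"
      using ceiling_divide_upper[OF assms(1), of a] ceiling_divide_lower[OF assms(1), of a]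
      by (auto simp: c_def algebra_simps)
  qed
  have "G a (a + L) = G a c + G c (a + L)" using add[OF c] by simp
  also have "\<dots> = G c (a + L) + G (a + L) (c + L)" using shift[of a c] by simp
  also have "\<dots> = G c (c + L)" using c by (intro add) auto
  also have "\<dots> = G 0 L" using s[of 0 "\<lceil>a / L\<rceil>" L] by (simp add: c_def add.commute)
  finally show ?thesis .
qed

definition period_box :: "real \<Rightarrow> real \<Rightarrow> real \<Rightarrow> real \<Rightarrow> (real \<times> real) set" where
  "period_box L M a b = {a..<a + L} \<times> {b..<b + M}"

lemma Times_ivl_borel: "{a..<b} \<times> {c..<d} \<in> sets (borel :: (real \<times> real) measure)"
  by (simp add: borel_prod[symmetric])

lemma bounded_Times_ivl: "bounded ({a..<b::real} \<times> {c..<d::real})"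
  by (intro bounded_Times bounded_Ico)

lemma AE_lborel_fst_neq: "AE z in lborel. fst (z :: real \<times> real) \<noteq> c"
  using AE_lborel_inner_neq[of "(1, 0) :: real \<times> real" c] by (simp add: Basis_prod_def inner_prod_def)

lemma AE_lborel_snd_neq: "AE z in lborel. snd (z :: real \<times> real) \<noteq> c"
  using AE_lborel_inner_neq[of "(0, 1) :: real \<times> real" c] by (simp add: Basis_prod_def inner_prod_def)

lemma set_integral_half_open:
  fixes f :: "real \<times> real \<Rightarrow> real"
  assumes "f \<in> borel_measurable borel"
  shows "(LINT z:{a..<b} \<times> {c..<d}|lborel. f z) = (LINT z:{a..b} \<times> {c..d}|lborel. f z)"
proof (rule set_integral_cong_set)
  have [measurable]: "{a..<b} \<times> {c..<d} \<in> sets borel" "{a..b} \<times> {c..d} \<in> sets borel"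
    by (auto simp: Times_ivl_borel intro!: borel_closed closed_Times)
  show "set_borel_measurable lborel ({a..b} \<times> {c..d}) f" "set_borel_measurable lborel ({a..<b} \<times> {c..<d}) f"
    unfolding set_borel_measurable_def using assms by measurable
  show "AE z in lborel. (z \<in> {a..b} \<times> {c..d}) = (z \<in> {a..<b} \<times> {c..<d})"
    using AE_lborel_fst_neq[of b] AE_lborel_snd_neq[of d] by eventually_elim auto
qed

lemma tint_period_box:
  assumes "L > 0" "M > 0" and f: "Linf_torus L M f"
  shows "(LINT z:period_box L M a b|lborel. f z) = tint L M f"
proof -
  have meas: "f \<in> borel_measurable borel" and per: "doubly_periodic L M f"
    using f by (auto simp: Linf_torus_def)
  define G where "G a a' b b' = (LINT z:{a..<a'} \<times> {b..<b'}|lborel. f z)" for a a' b b'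
  note int = Linf_set_integrable[OF f Times_ivl_borel bounded_Times_ivl]
  have "G a (a + L) b (b + M) = G 0 L b (b + M)"
  proof (rule additive_periodic_full_period[where G = "\<lambda>x y. G x y b (b + M)", OF assms(1)])
    fix x y z :: real assume "x \<le> y" "y \<le> z"
    then have "{x..<z} \<times> {b..<b + M} = ({x..<y} \<times> {b..<b + M}) \<union> ({y..<z} \<times> {b..<b + M})" by auto
    then show "G x y b (b + M) + G y z b (b + M) = G x z b (b + M)"
      unfolding G_def by (simp only:) (intro set_integral_Un[symmetric] int, auto)
  next
    fix x y :: real
    have "{z. (L, 0) + z \<in> {x + L..<y + L} \<times> {b..<b + M}} = {x..<y} \<times> {b..<b + M}" by auto
    moreover have "f ((L, 0) + z) = f z" for z
      using per by (cases z) (simp add: doubly_periodic_def add.commute)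
    ultimately show "G (x + L) (y + L) b (b + M) = G x y b (b + M)"
      unfolding G_def by (subst set_integral_translate[OF meas Times_ivl_borel, of _ _ _ _ "(L, 0)"]) simp
  qed
  also have "\<dots> = G 0 L 0 M"
  proof (rule additive_periodic_full_period[where G = "\<lambda>x y. G 0 L x y", OF assms(2)])
    fix x y z :: real assume "x \<le> y" "y \<le> z"
    then have "{0..<L} \<times> {x..<z} = ({0..<L} \<times> {x..<y}) \<union> ({0..<L} \<times> {y..<z})" by auto
    then show "G 0 L x y + G 0 L y z = G 0 L x z"
      unfolding G_def by (simp only:) (intro set_integral_Un[symmetric] int, auto)
  next
    fix x y :: real
    have "{z. (0, M) + z \<in> {0..<L} \<times> {x + M..<y + M}} = {0..<L} \<times> {x..<y}" by auto
    moreover have "f ((0, M) + z) = f z" for z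
      using per by (cases z) (simp add: doubly_periodic_def add.commute)
    ultimately show "G 0 L (x + M) (y + M) = G 0 L x y"
      unfolding G_def by (subst set_integral_translate[OF meas Times_ivl_borel, of _ _ _ _ "(0, M)"]) simp
  qed
  also have "\<dots> = tint L M f"
    unfolding G_def torus_def by (rule set_integral_half_open[OF meas])
  finally show ?thesis by (simp add: G_def period_box_def)
qed

text \<open>
  Translation invariance of the torus integral. Shifts of the index of a grid function become
  translations of the associated piecewise constant function, so that every discrete summation by
  parts below is an instance of this lemma.
\<close>
lemma tint_translate:
  assumes "L > 0" "M > 0" and f: "Linf_torus L M f"
  shows "tint L M (\<lambda>z. f (z + d)) = tint L M f"
proof -
  have meas: "f \<in> borel_measurable borel" using f by (auto simp: Linf_torus_def)
  then have meas': "(\<lambda>z. f (z + d)) \<in> borel_measurable borel" by simp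
  have e: "{z. d + z \<in> period_box L M (fst d) (snd d)} = {0..<L} \<times> {0..<M}"
    by (cases d) (auto simp: period_box_def)
  have "tint L M f = (LINT z:period_box L M (fst d) (snd d)|lborel. f z)"
    using tint_period_box[OF assms] by simp
  also have "\<dots> = (LINT z:{0..<L} \<times> {0..<M}|lborel. f (d + z))"
    unfolding period_box_def
    by (subst set_integral_translate[OF meas Times_ivl_borel, of _ _ _ _ d])
       (simp only: e[unfolded period_box_def])
  also have "\<dots> = (LINT z:{0..L} \<times> {0..M}|lborel. f (z + d))"
    using set_integral_half_open[OF meas'] by (simp add: add.commute)
  finally show ?thesis by (simp add: torus_def)
qed

lemma Linf_const: "Linf_torus L M (\<lambda>z. c)"
  unfolding Linf_torus_def doubly_periodic_def by auto

lemma Linf_add: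
  assumes "Linf_torus L M f" "Linf_torus L M g" shows "Linf_torus L M (\<lambda>z. f z + g z)"
proof -
  obtain C D where "AE z in lborel. \<bar>f z\<bar> \<le> C" "AE z in lborel. \<bar>g z\<bar> \<le> D"
    using assms unfolding Linf_torus_def by auto
  then have "AE z in lborel. \<bar>f z + g z\<bar> \<le> C + D" by eventually_elim auto
  then show ?thesis using assms unfolding Linf_torus_def doubly_periodic_def by auto
qed

lemma Linf_mult:
  assumes "Linf_torus L M f" "Linf_torus L M g" shows "Linf_torus L M (\<lambda>z. f z * g z)"
proof -
  obtain C D where "AE z in lborel. \<bar>f z\<bar> \<le> C" "AE z in lborel. \<bar>g z\<bar> \<le> D"
    using assms unfolding Linf_torus_def by auto
  then have "AE z in lborel. \<bar>f z * g z\<bar> \<le> C * D"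
    by eventually_elim (auto simp: abs_mult intro!: mult_mono)
  then show ?thesis using assms unfolding Linf_torus_def doubly_periodic_def by auto
qed

lemma Linf_cmult: "Linf_torus L M f \<Longrightarrow> Linf_torus L M (\<lambda>z. c * f z)"
  by (intro Linf_mult Linf_const)

lemma Linf_diff:
  assumes "Linf_torus L M f" "Linf_torus L M g" shows "Linf_torus L M (\<lambda>z. f z - g z)"
  using Linf_add[OF assms(1) Linf_cmult[OF assms(2), of "-1"]] by simp

lemma Linf_uminus: "Linf_torus L M f \<Longrightarrow> Linf_torus L M (\<lambda>z. - f z)"
  using Linf_cmult[of L M f "-1"] by simp

lemma Linf_divide: "Linf_torus L M f \<Longrightarrow> Linf_torus L M (\<lambda>z. f z / c)"
  using Linf_cmult[of L M f "1 / c"] by simp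

lemma Linf_abs: "Linf_torus L M f \<Longrightarrow> Linf_torus L M (\<lambda>z. \<bar>f z\<bar>)"
  unfolding Linf_torus_def doubly_periodic_def by auto

lemma Linf_power2: "Linf_torus L M f \<Longrightarrow> Linf_torus L M (\<lambda>z. (f z)\<^sup>2)"
  by (simp add: power2_eq_square Linf_mult)

lemma Linf_translate:
  assumes "Linf_torus L M f" shows "Linf_torus L M (\<lambda>z. f (z + d))"
proof -
  obtain C where C: "f \<in> borel_measurable borel" "AE z in lborel. \<bar>f z\<bar> \<le> C"
    using assms unfolding Linf_torus_def by auto
  have "AE z in lborel. \<bar>f (d + z)\<bar> \<le> C"
    using C by (intro AE_lborel_translate[where Q = "\<lambda>z. \<bar>f z\<bar> \<le> C"]) auto
  then have "AE z in lborel. \<bar>f (z + d)\<bar> \<le> C" by (simp add: add.commute)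
  moreover have "doubly_periodic L M (\<lambda>z. f (z + d))"
    using assms by (intro doubly_periodic_translate) (simp add: Linf_torus_def)
  moreover have "(\<lambda>z. f (z + d)) \<in> borel_measurable borel" using C(1) by simp
  ultimately show ?thesis unfolding Linf_torus_def by blast
qed

lemma Linf_translate_minus:
  "Linf_torus L M f \<Longrightarrow> Linf_torus L M (\<lambda>z. f (z - d))"
  using Linf_translate[of L M f "- d"] by simp

lemma Linf_continuous_bounded:
  assumes "continuous_on UNIV f" "doubly_periodic L M f" "\<And>z. \<bar>f z\<bar> \<le> K"
  shows "Linf_torus L M f"
  using assms borel_measurable_continuous_onI unfolding Linf_torus_def by (auto intro!: exI[of _ K])

lemma Linf_smooth:
  assumes "L > 0" "M > 0" "smooth f" "doubly_periodic L M f"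
  shows "Linf_torus L M f"
  using smooth_periodic_bounded[OF assms] Linf_continuous_bounded smooth_continuous assms by metis

lemmas Linf_intros = Linf_const Linf_add Linf_mult Linf_diff Linf_uminus Linf_divide Linf_abs
  Linf_power2 Linf_translate Linf_translate_minus

lemma tintegrable_mult_bounded:
  assumes "tintegrable L M a" "f \<in> borel_measurable borel" "\<And>z. \<bar>f z\<bar> \<le> K"
  shows "tintegrable L M (\<lambda>z. a z * f z)"
  unfolding set_integrable_def
proof (rule Bochner_Integration.integrable_bound)
  have a: "integrable lborel (\<lambda>z. indicator (torus L M) z *\<^sub>R a z)"
    using assms(1) by (simp add: set_integrable_def)
  then show "integrable lborel (\<lambda>z. K * (indicator (torus L M) z *\<^sub>R a z))" by simp
  have "(\<lambda>z. (indicator (torus L M) z *\<^sub>R a z) * f z) \<in> borel_measurable lborel"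
    using a assms(2) by (intro borel_measurable_times) auto
  then show "(\<lambda>z. indicator (torus L M) z *\<^sub>R (a z * f z)) \<in> borel_measurable lborel"
    by (simp add: mult.assoc)
  have "\<bar>a z\<bar> * \<bar>f z\<bar> \<le> \<bar>K\<bar> * \<bar>a z\<bar>" for z
    using assms(3)[of z] abs_ge_self[of K]
    by (metis abs_ge_zero mult.commute mult_left_mono order_trans)
  then show "AE z in lborel. norm (indicator (torus L M) z *\<^sub>R (a z * f z))
    \<le> norm (K * (indicator (torus L M) z *\<^sub>R a z))"
    by (auto simp: abs_mult indicator_def)
qed

lemma tint_mono_abs:
  assumes "tintegrable L M a" "tintegrable L M b" "\<And>z. \<bar>a z\<bar> \<le> b z"
  shows "\<bar>tint L M a\<bar> \<le> tint L M b"
proof -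
  have "tint L M a \<le> tint L M b"
    using assms(3) abs_le_D1 by (intro set_integral_mono assms) blast
  moreover have "- tint L M a = tint L M (\<lambda>z. - a z)" using set_integral_uminus[OF assms(1)] by simp
  moreover have "tint L M (\<lambda>z. - a z) \<le> tint L M b"
    using set_integrable_mult_right[of "-1" lborel "torus L M" a] assms abs_le_D2
    by (intro set_integral_mono assms) (auto intro: abs_le_D2)
  ultimately show ?thesis by linarith
qed

lemma tint_mult_bound:
  assumes "tintegrable L M a" "f \<in> borel_measurable borel" "\<And>z. \<bar>f z\<bar> \<le> K"
  shows "\<bar>tint L M (\<lambda>z. a z * f z)\<bar> \<le> K * tint L M (\<lambda>z. \<bar>a z\<bar>)"
proof -
  have "\<bar>tint L M (\<lambda>z. a z * f z)\<bar> \<le> tint L M (\<lambda>z. K * \<bar>a z\<bar>)"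
  proof (rule tint_mono_abs[OF tintegrable_mult_bounded[OF assms]])
    show "tintegrable L M (\<lambda>z. K * \<bar>a z\<bar>)"
      using set_integrable_abs[OF assms(1)] by auto
    show "\<bar>a z * f z\<bar> \<le> K * \<bar>a z\<bar>" for z
      using assms(3)[of z] by (metis abs_ge_zero abs_mult mult.commute mult_right_mono)
  qed
  then show ?thesis by simp
qed

text \<open>
  Functions in \<open>L\<^sup>\<infinity>\<close> are only bounded almost everywhere, so pointwise monotonicity of the integral
  is not enough.
\<close>
lemma tint_AE_bound:
  assumes f: "Linf_torus L M f" "AE z in lborel. \<bar>f z\<bar> \<le> C" and a: "Linf_torus L M a" "\<And>z. 0 \<le> a z"
  shows "\<bar>tint L M (\<lambda>z. f z * a z)\<bar> \<le> C * tint L M a"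
proof -
  have i: "tintegrable L M (\<lambda>z. f z * a z)" "tintegrable L M (\<lambda>z. C * a z)" "tintegrable L M (\<lambda>z. - (f z * a z))"
    by (intro Linf_tintegrable Linf_intros f a)+
  have b: "f z * a z \<le> C * a z" "- (f z * a z) \<le> C * a z" if "\<bar>f z\<bar> \<le> C" for z
  proof -
    have "f z \<le> C" "- f z \<le> C" using that by auto
    then show "f z * a z \<le> C * a z" "- (f z * a z) \<le> C * a z"
      using mult_right_mono[OF _ a(2)[of z], of "f z" C] mult_right_mono[OF _ a(2)[of z], of "- f z" C]
      by auto
  qed
  have "tint L M (\<lambda>z. f z * a z) \<le> tint L M (\<lambda>z. C * a z)" "tint L M (\<lambda>z. - (f z * a z)) \<le> tint L M (\<lambda>z. C * a z)"
    by (intro set_integral_mono_AE i; rule eventually_mono[OF f(2)]; use b in auto)+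
  then show ?thesis using set_integral_uminus[OF i(1)] by (simp add: abs_le_iff)
qed

lemma tint_nonneg: "(\<And>z. 0 \<le> f z) \<Longrightarrow> 0 \<le> tint L M f"
  unfolding set_lebesgue_integral_def by (intro Bochner_Integration.integral_nonneg) auto

section \<open>Piecewise constant functions on the mesh\<close>

locale sw_mesh =
  fixes P :: sw_problem and M :: "'m mesh_scheme"
  assumes Lx_pos: "Lx P > 0" and Ly_pos: "Ly P > 0" and mesh: "mesh_of P M"
begin

abbreviation TI :: "(real \<times> real \<Rightarrow> real) \<Rightarrow> real" where "TI \<equiv> tint (Lx P) (Ly P)"
abbreviation TIable :: "(real \<times> real \<Rightarrow> real) \<Rightarrow> bool" where "TIable \<equiv> tintegrable (Lx P) (Ly P)"
abbreviation Linf :: "(real \<times> real \<Rightarrow> real) \<Rightarrow> bool" where "Linf \<equiv> Linf_torus (Lx P) (Ly P)"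

lemma dx_pos: "dx M > 0" and dy_pos: "dy M > 0" and dt_pos: "dt M > 0"
  and nx_dx: "real (nx M) * dx M = Lx P" and ny_dy: "real (ny M) * dy M = Ly P"
  and nt_dt: "real (nt M) * dt M = Tend P"
  using mesh by (auto simp: mesh_of_def)

lemma nx_pos: "nx M > 0" and ny_pos: "ny M > 0"
  using nx_dx ny_dy Lx_pos Ly_pos by (auto intro: Nat.gr0I)

text \<open>
  The indicator function of a cell together with all its translates by the periods. Writing it as a
  piecewise constant function makes it periodic, with cells half open.
\<close>
definition cell_ind :: "int \<Rightarrow> int \<Rightarrow> real \<times> real \<Rightarrow> real" where
  "cell_ind i j = pc M (\<lambda>k l. of_bool (k mod int (nx M) = i mod int (nx M) \<and> l mod int (ny M) = j mod int (ny M)))"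

lemma grid_periodic_mod:
  assumes "grid_periodic M z"
  shows "z (i mod int (nx M)) (j mod int (ny M)) = z i j"
proof -
  have shift: "f (i + k * n) = f i" if "\<And>i. f (i + n) = f i" for f :: "int \<Rightarrow> real" and i k n
  proof (induction k rule: int_induct[of _ 0])
    case (step1 k)
    then show ?case using that[of "i + k * n"] by (simp add: algebra_simps)
  next
    case (step2 k)
    then show ?case using that[of "i + (k - 1) * n"] by (simp add: algebra_simps)
  qed simp
  have "z (i mod int (nx M)) b = z i b" for b
    using shift[of "\<lambda>i. z i b" "int (nx M)" "i mod int (nx M)" "i div int (nx M)"] assms
    by (simp add: grid_periodic_def)
  moreover have "z a (j mod int (ny M)) = z a j" for a
    using shift[of "z a" "int (ny M)" "j mod int (ny M)" "j div int (ny M)"] assms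
    by (simp add: grid_periodic_def)
  ultimately show ?thesis by simp
qed

lemma pc_eq_sum_cell_ind:
  assumes "grid_periodic M z"
  shows "pc M z p = (\<Sum>i\<in>{0..<int (nx M)}. \<Sum>j\<in>{0..<int (ny M)}. z i j * cell_ind i j p)"
proof -
  define k where "k = \<lfloor>(fst p - x0 M) / dx M + 1/2\<rfloor>"
  define l where "l = \<lfloor>(snd p - y0 M) / dy M + 1/2\<rfloor>"
  have "(\<Sum>i\<in>{0..<int (nx M)}. \<Sum>j\<in>{0..<int (ny M)}. z i j * cell_ind i j p)
      = (\<Sum>i\<in>{0..<int (nx M)}. \<Sum>j\<in>{0..<int (ny M)}.
          if l mod int (ny M) = j then (if k mod int (nx M) = i then z i j else 0) else 0)"
    by (intro sum.cong refl) (auto simp: cell_ind_def pc_def k_def l_def)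
  also have "\<dots> = z (k mod int (nx M)) (l mod int (ny M))"
    using nx_pos ny_pos by (simp add: sum.delta)
  also have "\<dots> = pc M z p"
    using grid_periodic_mod[OF assms] by (simp add: pc_def k_def l_def)
  finally show ?thesis by simp
qed

lemma pc_bound: "(\<And>i j. \<bar>z i j\<bar> \<le> K) \<Longrightarrow> \<bar>pc M z p\<bar> \<le> K"
  by (simp add: pc_def)

lemma pc_measurable: "pc M z \<in> borel_measurable borel"
proof -
  have c: "continuous_on UNIV (\<lambda>p :: real \<times> real. (fst p - x0 M) / dx M + 1/2)"
          "continuous_on UNIV (\<lambda>p :: real \<times> real. (snd p - y0 M) / dy M + 1/2)"
    using dx_pos dy_pos by (auto intro!: continuous_intros)
  note 1 = measurable_compose[OF borel_measurable_continuous_onI[OF c(1)] measurable_real_floor]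
    measurable_compose[OF borel_measurable_continuous_onI[OF c(2)] measurable_real_floor]
  have "(\<lambda>p :: real \<times> real. z k \<lfloor>(snd p - y0 M) / dy M + 1/2\<rfloor>) \<in> borel_measurable borel" for k
    using measurable_compose[OF 1(2), of "z k" borel] by simp
  then have "(\<lambda>p. z \<lfloor>(fst p - x0 M) / dx M + 1/2\<rfloor> \<lfloor>(snd p - y0 M) / dy M + 1/2\<rfloor>) \<in> borel_measurable borel"
    by (rule measurable_compose_countable[where f = "\<lambda>k p. z k \<lfloor>(snd p - y0 M) / dy M + 1/2\<rfloor>", OF _ 1(1)])
  then show ?thesis by (simp add: pc_def[abs_def])
qed

lemma pc_doubly_periodic:
  assumes "grid_periodic M z"
  shows "doubly_periodic (Lx P) (Ly P) (pc M z)"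
proof -
  have fx: "\<lfloor>(x + Lx P - x0 M) / dx M + 1/2\<rfloor> = \<lfloor>(x - x0 M) / dx M + 1/2\<rfloor> + int (nx M)" for x
  proof -
    have e: "(x + Lx P - x0 M) / dx M + 1/2 = ((x - x0 M) / dx M + 1/2) + of_int (int (nx M))"
      using nx_dx dx_pos by (simp add: field_simps)
    show ?thesis unfolding e floor_add_int[symmetric] ..
  qed
  have fy: "\<lfloor>(x + Ly P - y0 M) / dy M + 1/2\<rfloor> = \<lfloor>(x - y0 M) / dy M + 1/2\<rfloor> + int (ny M)" for x
  proof -
    have e: "(x + Ly P - y0 M) / dy M + 1/2 = ((x - y0 M) / dy M + 1/2) + of_int (int (ny M))"
      using ny_dy dy_pos by (simp add: field_simps)
    show ?thesis unfolding e floor_add_int[symmetric] ..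
  qed
  show ?thesis
    using assms by (simp add: doubly_periodic_def pc_def grid_periodic_def fx fy)
qed

lemma Linf_pc:
  assumes "grid_periodic M z"
  shows "Linf (pc M z)"
proof -
  define C where "C = (\<Sum>i\<in>{0..<int (nx M)}. \<Sum>j\<in>{0..<int (ny M)}. \<bar>z i j\<bar>)"
  have "\<bar>z i j\<bar> \<le> C" for i j
  proof -
    let ?i = "i mod int (nx M)" and ?j = "j mod int (ny M)"
    have "\<bar>z ?i ?j\<bar> \<le> (\<Sum>j\<in>{0..<int (ny M)}. \<bar>z ?i j\<bar>)"
      using ny_pos by (intro member_le_sum[where f = "\<lambda>j. \<bar>z ?i j\<bar>"]) auto
    also have "\<dots> \<le> C" unfolding C_def
      using nx_pos by (intro member_le_sum[where f = "\<lambda>i. \<Sum>j\<in>{0..<int (ny M)}. \<bar>z i j\<bar>"]) (auto intro: sum_nonneg)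
    finally show ?thesis using grid_periodic_mod[OF assms] by simp
  qed
  then have "\<bar>pc M z p\<bar> \<le> C" for p by (rule pc_bound)
  then show ?thesis
    unfolding Linf_torus_def using pc_measurable pc_doubly_periodic[OF assms] by (intro conjI exI[of _ C]) auto
qed

lemma Linf_cell_ind: "Linf (cell_ind i j)"
  unfolding cell_ind_def by (rule Linf_pc) (simp add: grid_periodic_def)

lemma cell_ind_nonneg: "0 \<le> cell_ind i j p" and cell_ind_le_1: "cell_ind i j p \<le> 1"
  by (auto simp: cell_ind_def pc_def)

lemma pc_shift_x: "pc M (\<lambda>i j. z (i + k) j) p = pc M z (p + (of_int k * dx M, 0))"
proof -
  have "(fst p + of_int k * dx M - x0 M) / dx M + 1/2 = ((fst p - x0 M) / dx M + 1/2) + of_int k"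
    using dx_pos by (simp add: field_simps)
  then have "\<lfloor>(fst p + of_int k * dx M - x0 M) / dx M + 1/2\<rfloor> = \<lfloor>(fst p - x0 M) / dx M + 1/2\<rfloor> + k"
    by (simp only: floor_add_int)
  then show ?thesis by (simp add: pc_def)
qed

lemma pc_shift_y: "pc M (\<lambda>i j. z i (j + k)) p = pc M z (p + (0, of_int k * dy M))"
proof -
  have "(snd p + of_int k * dy M - y0 M) / dy M + 1/2 = ((snd p - y0 M) / dy M + 1/2) + of_int k"
    using dy_pos by (simp add: field_simps)
  then have "\<lfloor>(snd p + of_int k * dy M - y0 M) / dy M + 1/2\<rfloor> = \<lfloor>(snd p - y0 M) / dy M + 1/2\<rfloor> + k"
    by (simp only: floor_add_int)
  then show ?thesis by (simp add: pc_def)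
qed

text \<open>
  Functions on the dual cells are translates by half a step of functions on the primal cells.
\<close>
lemma pc_Dx_eq: "pc_Dx M z p = pc M z (p - (1/2) *\<^sub>R (dx M, 0))"
proof -
  have "(fst p - dx M / 2 - x0 M) / dx M + 1/2 = (fst p - x0 M) / dx M"
    using dx_pos by (simp add: field_simps)
  then show ?thesis by (simp add: pc_def pc_Dx_def)
qed

lemma pc_Dy_eq: "pc_Dy M z p = pc M z (p - (1/2) *\<^sub>R (0, dy M))"
proof -
  have "(snd p - dy M / 2 - y0 M) / dy M + 1/2 = (snd p - y0 M) / dy M"
    using dy_pos by (simp add: field_simps)
  then show ?thesis by (simp add: pc_def pc_Dy_def)
qed

lemma cell_ind_shift_x: "cell_ind (i + k) j p = cell_ind i j (p - (of_int k * dx M, 0))"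
proof -
  have *: "(a - k) mod n = i mod n \<longleftrightarrow> a mod n = (i + k) mod n" for a n :: int
    by (metis (no_types, opaque_lifting) add_diff_cancel_right' diff_add_cancel mod_add_left_eq mod_diff_left_eq)
  have "cell_ind (i + k) j p = pc M (\<lambda>a b. (\<lambda>a b. of_bool (a mod int (nx M) = i mod int (nx M) \<and> b mod int (ny M) = j mod int (ny M))) (a + (- k)) b) p"
    unfolding cell_ind_def by (simp add: *)
  also have "\<dots> = cell_ind i j (p + (of_int (- k) * dx M, 0))"
    unfolding cell_ind_def by (rule pc_shift_x)
  also have "p + (of_int (- k) * dx M, 0) = p - (of_int k * dx M, 0)" by (simp add: prod_eq_iff)
  finally show ?thesis .
qed

lemma cell_ind_shift_y: "cell_ind i (j + k) p = cell_ind i j (p - (0, of_int k * dy M))"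
proof -
  have *: "(a - k) mod n = j mod n \<longleftrightarrow> a mod n = (j + k) mod n" for a n :: int
    by (metis (no_types, opaque_lifting) add_diff_cancel_right' diff_add_cancel mod_add_left_eq mod_diff_left_eq)
  have "cell_ind i (j + k) p = pc M (\<lambda>a b. (\<lambda>a b. of_bool (a mod int (nx M) = i mod int (nx M) \<and> b mod int (ny M) = j mod int (ny M))) a (b + (- k))) p"
    unfolding cell_ind_def by (simp add: *)
  also have "\<dots> = cell_ind i j (p + (0, of_int (- k) * dy M))"
    unfolding cell_ind_def by (rule pc_shift_y)
  also have "p + (0, of_int (- k) * dy M) = p - (0, of_int k * dy M)" by (simp add: prod_eq_iff)
  finally show ?thesis .
qed

lemma floor_mod_eq_iff_first_cell:
  fixes x o' d :: real and n :: nat and i :: int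
  assumes "d > 0" "x \<in> {o' + of_int i * d - d / 2..<o' + of_int i * d - d / 2 + real n * d}"
  shows "\<lfloor>(x - o') / d + 1/2\<rfloor> mod int n = i mod int n
    \<longleftrightarrow> x < o' + of_int i * d + d / 2"
proof -
  define a where "a = o' + of_int i * d - d / 2"
  define m where "m = \<lfloor>(x - a) / d\<rfloor>"
  have "(x - o') / d + 1/2 = (x - a) / d + of_int i" using assms(1) by (simp add: a_def field_simps)
  then have fl: "\<lfloor>(x - o') / d + 1/2\<rfloor> = m + i" by (simp add: m_def)
  have ax: "a \<le> x" "x < a + real n * d" using assms(2) by (auto simp: a_def)
  then have "0 \<le> (x - a) / d" "(x - a) / d < real n" using assms(1) by (auto simp: pos_divide_less_eq)
  then have m: "0 \<le> m" "m < int n" unfolding m_def by (auto simp: floor_less_iff)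
  have "(m + i) mod int n = i mod int n \<longleftrightarrow> int n dvd m" by (simp add: mod_eq_dvd_iff)
  also have "\<dots> \<longleftrightarrow> m = 0" using m by (auto dest: zdvd_imp_le)
  also have "\<dots> \<longleftrightarrow> (x - a) / d < 1" using m(1) unfolding m_def by linarith
  also have "\<dots> \<longleftrightarrow> x < a + d" using assms(1) by (auto simp: pos_divide_less_eq)
  also have "a + d = o' + of_int i * d + d / 2" by (simp add: a_def)
  finally show ?thesis using fl by simp
qed

text \<open>
  By translation invariance the torus may be replaced by the period rectangle whose lower left corner
  is that of the cell; this rectangle meets only one of the periodic translates of the cell.
\<close>
lemma tint_cell_ind:
  assumes f: "Linf f"
  shows "TI (\<lambda>p. cell_ind i j p * f p) = (LINT z:cell M i j|lborel. f z)"
proof -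
  have meas: "f \<in> borel_measurable borel" using f by (auto simp: Linf_torus_def)
  define a where "a = xc M i - dx M / 2"
  define b where "b = yc M j - dy M / 2"
  have sub: "x < a + Lx P" if "x < a + dx M" for x
    using that nx_dx nx_pos dx_pos
    by (smt (verit, best) mult_less_cancel_right2 nat_less_real_le of_nat_0 of_nat_1)
  have sub': "y < b + Ly P" if "y < b + dy M" for y
    using that ny_dy ny_pos dy_pos
    by (smt (verit, best) mult_less_cancel_right2 nat_less_real_le of_nat_0 of_nat_1)
  have ind: "cell_ind i j p = indicator ({a..<a + dx M} \<times> {b..<b + dy M}) p"
    if "p \<in> period_box (Lx P) (Ly P) a b" for p
  proof -
    have p: "fst p \<in> {x0 M + of_int i * dx M - dx M / 2..<x0 M + of_int i * dx M - dx M / 2 + real (nx M) * dx M}"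
      "snd p \<in> {y0 M + of_int j * dy M - dy M / 2..<y0 M + of_int j * dy M - dy M / 2 + real (ny M) * dy M}"
      using that unfolding nx_dx ny_dy period_box_def by (auto simp: a_def b_def xc_def yc_def)
    have "a + dx M = x0 M + of_int i * dx M + dx M / 2" "b + dy M = y0 M + of_int j * dy M + dy M / 2"
      by (simp_all add: a_def b_def xc_def yc_def)
    moreover have "a \<le> fst p" "b \<le> snd p" using that by (auto simp: period_box_def)
    ultimately show ?thesis
      using floor_mod_eq_iff_first_cell[OF dx_pos p(1)] floor_mod_eq_iff_first_cell[OF dy_pos p(2)]
      by (simp add: cell_ind_def pc_def indicator_def mem_Times_iff)
  qed
  have "TI (\<lambda>p. cell_ind i j p * f p) = (LINT p:period_box (Lx P) (Ly P) a b|lborel. cell_ind i j p * f p)"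
    by (intro tint_period_box[symmetric] Lx_pos Ly_pos Linf_mult Linf_cell_ind f)
  also have "\<dots> = (LINT p:{a..<a + dx M} \<times> {b..<b + dy M}|lborel. f p)"
    unfolding set_lebesgue_integral_def
  proof (intro Bochner_Integration.integral_cong refl)
    fix p
    show "indicator (period_box (Lx P) (Ly P) a b) p *\<^sub>R (cell_ind i j p * f p)
        = indicator ({a..<a + dx M} \<times> {b..<b + dy M}) p *\<^sub>R f p"
    proof (cases "p \<in> period_box (Lx P) (Ly P) a b")
      case True
      then show ?thesis using ind by simp
    next
      case False
      then have "p \<notin> {a..<a + dx M} \<times> {b..<b + dy M}"
        using sub sub' by (auto simp: period_box_def)
      then show ?thesis using False by simp
    qed
  qed
  also have "\<dots> = (LINT p:{a..a + dx M} \<times> {b..b + dy M}|lborel. f p)"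
    by (rule set_integral_half_open[OF meas])
  also have "{a..a + dx M} \<times> {b..b + dy M} = cell M i j"
    by (simp add: a_def b_def cell_def add.commute)
  finally show ?thesis .
qed

lemma measure_cell: "(LINT z:cell M i j|lborel. 1) = dx M * dy M"
proof -
  have "cell M i j = cbox (xc M i - dx M / 2, yc M j - dy M / 2) (xc M i + dx M / 2, yc M j + dy M / 2)"
    by (auto simp: cell_def cbox_Pair_eq)
  then show ?thesis
    using dx_pos dy_pos
    by (simp add: set_lebesgue_integral_def content_cbox_pair_eq0_D measure_lborel_cbox_eq Basis_prod_def)
qed

lemma TI_cell_ind: "TI (cell_ind i j) = dx M * dy M"
  using tint_cell_ind[OF Linf_const[of _ _ 1], of i j] measure_cell by simp

lemma cell_average_eq: "Linf f \<Longrightarrow> cell_average M f i j = TI (\<lambda>p. cell_ind i j p * f p) / (dx M * dy M)"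
  by (simp add: cell_average_def tint_cell_ind)

lemma grid_periodic_cell_average:
  assumes "Linf f" shows "grid_periodic M (cell_average M f)"
  unfolding grid_periodic_def cell_average_eq[OF assms] cell_ind_def by simp

lemma TI_AE_bound:
  assumes "Linf f" "AE z in lborel. \<bar>f z\<bar> \<le> C" "Linf a" "\<And>z. 0 \<le> a z"
  shows "\<bar>TI (\<lambda>z. a z * f z)\<bar> \<le> C * TI a"
  using tint_AE_bound[OF assms] by (simp add: mult.commute)

lemma cell_average_bound:
  assumes "Linf f" "AE z in lborel. \<bar>f z\<bar> \<le> C"
  shows "\<bar>cell_average M f i j\<bar> \<le> C"
proof -
  have "\<bar>TI (\<lambda>p. cell_ind i j p * f p)\<bar> \<le> C * (dx M * dy M)"
    using TI_AE_bound[OF assms Linf_cell_ind[of i j] cell_ind_nonneg] TI_cell_ind by simp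
  then show ?thesis
    using dx_pos dy_pos unfolding cell_average_eq[OF assms(1)]
    by (simp add: abs_divide abs_mult pos_divide_le_eq)
qed

text \<open>
  The sum over all cells weighted with the cell area. As a finite sum it is linear and monotone without
  any side condition; as the integral of a piecewise constant function it is invariant under shifts.
\<close>
definition GS :: "grid \<Rightarrow> real" where
  "GS z = (\<Sum>i\<in>{0..<int (nx M)}. \<Sum>j\<in>{0..<int (ny M)}. z i j * (dx M * dy M))"

lemma TI_sum_cell_ind:
  assumes "grid_periodic M z" "TIable f"
  shows "TI (\<lambda>p. pc M z p * f p)
    = (\<Sum>i\<in>{0..<int (nx M)}. \<Sum>j\<in>{0..<int (ny M)}. z i j * TI (\<lambda>p. cell_ind i j p * f p))"
proof -
  have int: "integrable lborel (\<lambda>p. indicator (torus (Lx P) (Ly P)) p *\<^sub>R (cell_ind i j p * f p))" for i j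
  proof -
    have "cell_ind i j \<in> borel_measurable borel" using Linf_cell_ind by (auto simp: Linf_torus_def)
    moreover have "\<bar>cell_ind i j p\<bar> \<le> 1" for p using cell_ind_nonneg[of i j p] cell_ind_le_1[of i j p] by simp
    ultimately have "TIable (\<lambda>p. f p * cell_ind i j p)" by (intro tintegrable_mult_bounded assms) auto
    then show ?thesis by (simp add: set_integrable_def mult.commute)
  qed
  have "TI (\<lambda>p. pc M z p * f p) = (LINT p|lborel. (\<Sum>i\<in>{0..<int (nx M)}. \<Sum>j\<in>{0..<int (ny M)}.
        z i j * (indicator (torus (Lx P) (Ly P)) p *\<^sub>R (cell_ind i j p * f p))))"
    unfolding set_lebesgue_integral_def
    by (intro Bochner_Integration.integral_cong refl)
       (simp add: pc_eq_sum_cell_ind[OF assms(1)] sum_distrib_left sum_distrib_right mult.assoc mult.left_commute)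
  also have "\<dots> = (\<Sum>i\<in>{0..<int (nx M)}. \<Sum>j\<in>{0..<int (ny M)}. z i j * TI (\<lambda>p. cell_ind i j p * f p))"
    unfolding set_lebesgue_integral_def using int
    by (subst Bochner_Integration.integral_sum; (intro Bochner_Integration.integrable_sum integrable_mult_right)?)
       (auto simp: Bochner_Integration.integral_sum)
  finally show ?thesis .
qed

lemma TI_pc: "grid_periodic M z \<Longrightarrow> TI (pc M z) = GS z"
  using TI_sum_cell_ind[of z "\<lambda>p. 1"] Linf_tintegrable[OF Linf_const[of _ _ 1]] TI_cell_ind
  by (simp add: GS_def)

lemma GS_add: "GS (\<lambda>i j. f i j + g i j) = GS f + GS g"
  by (simp add: GS_def sum.distrib distrib_right)

lemma GS_diff: "GS (\<lambda>i j. f i j - g i j) = GS f - GS g"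
  by (simp add: GS_def sum_subtractf left_diff_distrib)

lemma GS_cmult: "GS (\<lambda>i j. c * f i j) = c * GS f"
  by (simp add: GS_def sum_distrib_left mult.assoc)

lemma GS_divide: "GS (\<lambda>i j. f i j / c) = GS f / c"
  using GS_cmult[of "1 / c" f] by simp

lemma GS_uminus: "GS (\<lambda>i j. - f i j) = - GS f"
  using GS_cmult[of "-1" f] by simp

lemma GS_mono: "(\<And>i j. f i j \<le> g i j) \<Longrightarrow> GS f \<le> GS g"
  unfolding GS_def using dx_pos dy_pos by (intro sum_mono mult_right_mono) auto

lemma GS_nonneg: "(\<And>i j. 0 \<le> f i j) \<Longrightarrow> 0 \<le> GS f"
  using GS_mono[of "\<lambda>i j. 0" f] by (simp add: GS_def)

lemma GS_const: "GS (\<lambda>i j. c) = c * (Lx P * Ly P)"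
  by (simp add: GS_def nx_dx[symmetric] ny_dy[symmetric])

lemmas GS_linear = GS_add GS_diff GS_cmult GS_divide GS_uminus

lemma grid_periodic_shift_x: "grid_periodic M z \<Longrightarrow> grid_periodic M (\<lambda>i j. z (i + k) j)"
proof -
  have e: "(i + int (nx M)) + k = (i + k) + int (nx M)" for i by simp
  show "grid_periodic M z \<Longrightarrow> ?thesis" unfolding grid_periodic_def by (simp add: e)
qed

lemma grid_periodic_shift_y: "grid_periodic M z \<Longrightarrow> grid_periodic M (\<lambda>i j. z i (j + k))"
proof -
  have e: "(i + int (ny M)) + k = (i + k) + int (ny M)" for i by simp
  show "grid_periodic M z \<Longrightarrow> ?thesis" unfolding grid_periodic_def by (simp add: e)
qed

lemma GS_shift_x: "grid_periodic M z \<Longrightarrow> GS (\<lambda>i j. z (i + k) j) = GS z"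
  using tint_translate[OF Lx_pos Ly_pos Linf_pc, of z] TI_pc[of z] TI_pc[OF grid_periodic_shift_x, of z k]
  by (simp add: pc_shift_x[abs_def])

lemma GS_shift_y: "grid_periodic M z \<Longrightarrow> GS (\<lambda>i j. z i (j + k)) = GS z"
  using tint_translate[OF Lx_pos Ly_pos Linf_pc, of z] TI_pc[of z] TI_pc[OF grid_periodic_shift_y, of z k]
  by (simp add: pc_shift_y[abs_def])

end

section \<open>Weak derivatives tested on mesh cells\<close>

text \<open>
  First-order Taylor expansion for a function whose derivative is Lipschitz, on a convex set of times.
\<close>
lemma quadratic_remainder:
  fixes \<phi> \<phi>' :: "real \<Rightarrow> real"
  assumes S: "convex S" "t \<in> S" "s \<in> S"
    and d: "\<And>r. r \<in> S \<Longrightarrow> (\<phi> has_real_derivative \<phi>' r) (at r within S)"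
    and l: "\<And>r. r \<in> S \<Longrightarrow> \<bar>\<phi>' r - \<phi>' t\<bar> \<le> K * \<bar>r - t\<bar>" and K: "K \<ge> 0"
  shows "\<bar>\<phi> s - \<phi> t - (s - t) * \<phi>' t\<bar> \<le> K * (s - t)\<^sup>2"
proof -
  let ?C = "closed_segment t s"
  have sub: "?C \<subseteq> S" by (rule closed_segment_subset[OF S(2,3,1)])
  have "norm ((\<phi> s - s * \<phi>' t) - (\<phi> t - t * \<phi>' t)) \<le> (K * \<bar>s - t\<bar>) * norm (s - t)"
  proof (rule field_differentiable_bound[where S = ?C and f' = "\<lambda>r. \<phi>' r - \<phi>' t"])
    fix r assume r: "r \<in> ?C"
    then have rS: "r \<in> S" using sub by auto
    have "(\<phi> has_real_derivative \<phi>' r) (at r within ?C)" by (rule DERIV_subset[OF d[OF rS] sub])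
    then show "((\<lambda>r. \<phi> r - r * \<phi>' t) has_field_derivative \<phi>' r - \<phi>' t) (at r within ?C)"
      by (auto intro!: derivative_eq_intros)
    have "\<bar>r - t\<bar> \<le> \<bar>s - t\<bar>" using r by (auto simp: closed_segment_eq_real_ivl split: if_splits)
    then have "K * \<bar>r - t\<bar> \<le> K * \<bar>s - t\<bar>" using K by (rule mult_left_mono)
    then show "norm (\<phi>' r - \<phi>' t) \<le> K * \<bar>s - t\<bar>" using l[OF rS] by simp
  qed (auto simp: S)
  moreover have "(K * \<bar>s - t\<bar>) * norm (s - t) = K * (s - t)\<^sup>2"
    by (simp add: power2_eq_square mult.assoc)
  moreover have "(\<phi> s - s * \<phi>' t) - (\<phi> t - t * \<phi>' t) = \<phi> s - \<phi> t - (s - t) * \<phi>' t"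
    by (simp add: algebra_simps)
  ultimately show ?thesis by (simp only: real_norm_def)
qed

lemma has_real_derivative_from_quadratic:
  fixes G :: "real \<Rightarrow> real"
  assumes "\<And>s. s \<in> S \<Longrightarrow> \<bar>G s - G t - (s - t) * D\<bar> \<le> C * (s - t)\<^sup>2"
  shows "(G has_real_derivative D) (at t within S)"
  unfolding has_field_derivative_iff
proof (rule Lim_null[THEN iffD2], rule Lim_null_comparison)
  show "\<forall>\<^sub>F s in at t within S. norm ((G s - G t) / (s - t) - D) \<le> C * \<bar>s - t\<bar>"
    unfolding eventually_at_filter
  proof (rule always_eventually, intro allI impI)
    fix s assume s: "s \<noteq> t" "s \<in> S"
    have "(G s - G t) / (s - t) - D = (G s - G t - (s - t) * D) / (s - t)"
      using s by (simp add: diff_divide_distrib)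
    then have "norm ((G s - G t) / (s - t) - D) = \<bar>G s - G t - (s - t) * D\<bar> / \<bar>s - t\<bar>"
      by (simp only: real_norm_def abs_divide)
    also have "\<dots> \<le> C * (s - t)\<^sup>2 / \<bar>s - t\<bar>" using assms[OF s(2)] by (intro divide_right_mono) auto
    also have "\<dots> = C * \<bar>s - t\<bar>" using s by (subst power2_abs[symmetric]) (simp add: power2_eq_square del: abs_mult_self_eq)
    finally show "norm ((G s - G t) / (s - t) - D) \<le> C * \<bar>s - t\<bar>" .
  qed
  have "((\<lambda>s. C * \<bar>s - t\<bar>) \<longlongrightarrow> C * \<bar>t - t\<bar>) (at t within S)" by (intro tendsto_intros)
  then show "((\<lambda>s. C * \<bar>s - t\<bar>) \<longlongrightarrow> 0) (at t within S)" by simp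
qed

text \<open>
  Differentiation under the integral sign. The expansion of \<open>\<theta>\<close> is uniform in space, so the
  integrable factor \<open>a\<close> can be arbitrary.
\<close>
lemma tint_has_derivative:
  assumes a: "tintegrable L M a" and "t \<in> S"
    and \<theta>: "\<And>s. s \<in> S \<Longrightarrow> \<theta> s \<in> borel_measurable borel" "\<And>s z. s \<in> S \<Longrightarrow> \<bar>\<theta> s z\<bar> \<le> B"
    and \<theta>': "\<theta>' \<in> borel_measurable borel" "\<And>z. \<bar>\<theta>' z\<bar> \<le> B'"
    and q: "\<And>s z. s \<in> S \<Longrightarrow> \<bar>\<theta> s z - \<theta> t z - (s - t) * \<theta>' z\<bar> \<le> K * (s - t)\<^sup>2"
  shows "((\<lambda>s. tint L M (\<lambda>z. a z * \<theta> s z)) has_real_derivative tint L M (\<lambda>z. a z * \<theta>' z)) (at t within S)"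
proof (rule has_real_derivative_from_quadratic)
  fix s assume s: "s \<in> S"
  have i: "tintegrable L M (\<lambda>z. a z * \<theta> s z)" "tintegrable L M (\<lambda>z. a z * \<theta> t z)"
    "tintegrable L M (\<lambda>z. (s - t) * (a z * \<theta>' z))"
    using tintegrable_mult_bounded[OF a \<theta>(1)[OF s] \<theta>(2)[OF s]]
      tintegrable_mult_bounded[OF a \<theta>(1)[OF \<open>t \<in> S\<close>] \<theta>(2)[OF \<open>t \<in> S\<close>]]
      tintegrable_mult_bounded[OF a \<theta>'] by auto
  have "tint L M (\<lambda>z. a z * \<theta> s z) - tint L M (\<lambda>z. a z * \<theta> t z) - (s - t) * tint L M (\<lambda>z. a z * \<theta>' z)
      = tint L M (\<lambda>z. a z * \<theta> s z - a z * \<theta> t z - (s - t) * (a z * \<theta>' z))"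
    using i by (simp add: set_integral_diff)
  also have "(\<lambda>z. a z * \<theta> s z - a z * \<theta> t z - (s - t) * (a z * \<theta>' z))
      = (\<lambda>z. a z * (\<theta> s z - \<theta> t z - (s - t) * \<theta>' z))" by (simp add: algebra_simps)
  also have "\<bar>tint L M \<dots>\<bar> \<le> (K * (s - t)\<^sup>2) * tint L M (\<lambda>z. \<bar>a z\<bar>)"
    using \<theta>(1)[OF s] \<theta>(1)[OF \<open>t \<in> S\<close>] \<theta>'(1) q[OF s]
    by (intro tint_mult_bound[OF a]) auto
  finally show "\<bar>tint L M (\<lambda>z. a z * \<theta> s z) - tint L M (\<lambda>z. a z * \<theta> t z) - (s - t) * tint L M (\<lambda>z. a z * \<theta>' z)\<bar>
      \<le> (K * tint L M (\<lambda>z. \<bar>a z\<bar>)) * (s - t)\<^sup>2" by (simp add: algebra_simps)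
qed

text \<open>
  Moving the test function instead of \<open>f\<close> turns a weak derivative into a classical one: the pairing of
  \<open>f\<close> with the translates of \<open>\<theta>\<close> is a differentiable function of the translation parameter.
\<close>
lemma weak_pdiff_translate_derivative:
  assumes LM: "L > 0" "M > 0" and w: "weak_pdiff L M e f f'" and f: "tintegrable L M f"
    and \<theta>: "smooth \<theta>" "doubly_periodic L M \<theta>"
  shows "((\<lambda>t. tint L M (\<lambda>z. f z * \<theta> (z - t *\<^sub>R e))) has_real_derivative
    tint L M (\<lambda>z. f' z * \<theta> (z - t *\<^sub>R e))) (at t)"
proof -
  let ?d\<theta> = "pdiff e \<theta>"
  obtain B where B: "\<And>z. \<bar>\<theta> z\<bar> \<le> B" using smooth_periodic_bounded[OF LM \<theta>] by metis
  obtain B' where B': "\<And>z. \<bar>?d\<theta> z\<bar> \<le> B'"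
    using smooth_periodic_bounded[OF LM smooth_pdiff[OF \<theta>(1)] doubly_periodic_pdiff[OF \<theta>]] by metis
  obtain K where K: "K \<ge> 0" "\<And>z. \<bar>pdiff e ?d\<theta> z\<bar> \<le> K"
    using smooth_periodic_bounded[OF LM smooth_pdiff[OF smooth_pdiff[OF \<theta>(1)]]
        doubly_periodic_pdiff[OF smooth_pdiff[OF \<theta>(1)] doubly_periodic_pdiff[OF \<theta>]]] by metis
  have m: "\<theta> \<in> borel_measurable borel" "?d\<theta> \<in> borel_measurable borel"
    by (rule borel_measurable_continuous_onI, rule smooth_continuous, intro smooth_pdiff \<theta>)+
  have q: "\<bar>\<theta> (z - s *\<^sub>R e) - \<theta> (z - t *\<^sub>R e) - (s - t) * (- ?d\<theta> (z - t *\<^sub>R e))\<bar> \<le> K * (s - t)\<^sup>2" for s z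
  proof (rule quadratic_remainder[where S = UNIV and \<phi> = "\<lambda>s. \<theta> (z - s *\<^sub>R e)" and \<phi>' = "\<lambda>s. - ?d\<theta> (z - s *\<^sub>R e)"])
    have line: "((\<lambda>s. g (z - s *\<^sub>R e)) has_real_derivative - pdiff e g (z - s *\<^sub>R e)) (at s)"
      if "smooth g" for g s
      using has_real_derivative_along_line[OF that, of z "- e" s]
        linear_neg[OF linear_pdiff[OF smooth_differentiable[OF that]], where x = e] by simp
    show "((\<lambda>s. \<theta> (z - s *\<^sub>R e)) has_real_derivative - ?d\<theta> (z - r *\<^sub>R e)) (at r within UNIV)" for r
      using line[OF \<theta>(1)] by simp
    have "norm (?d\<theta> (z - r *\<^sub>R e) - ?d\<theta> (z - t *\<^sub>R e)) \<le> K * norm (r - t)" for r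
      by (rule field_differentiable_bound[where S = UNIV and f = "\<lambda>s. ?d\<theta> (z - s *\<^sub>R e)"
            and f' = "\<lambda>s. - pdiff e ?d\<theta> (z - s *\<^sub>R e)"])
         (simp_all add: K line[OF smooth_pdiff[OF \<theta>(1)]])
    then show "\<bar>- ?d\<theta> (z - r *\<^sub>R e) - - ?d\<theta> (z - t *\<^sub>R e)\<bar> \<le> K * \<bar>r - t\<bar>" for r
      by (simp add: abs_minus_commute)
  qed (auto simp: K)
  have "((\<lambda>t. tint L M (\<lambda>z. f z * \<theta> (z - t *\<^sub>R e))) has_real_derivative
    tint L M (\<lambda>z. f z * (- ?d\<theta> (z - t *\<^sub>R e)))) (at t)"
    by (rule tint_has_derivative[OF f _ _ _ _ _ q, where B = B and B' = B']) (use m B B' in auto)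
  also have "tint L M (\<lambda>z. f z * (- ?d\<theta> (z - t *\<^sub>R e))) = - tint L M (\<lambda>z. f z * ?d\<theta> (z - t *\<^sub>R e))"
    by (simp add: set_lebesgue_integral_def)
  also have "\<dots> = tint L M (\<lambda>z. f' z * \<theta> (z - t *\<^sub>R e))"
  proof -
    have eq: "pdiff e (\<lambda>z. \<theta> (z - t *\<^sub>R e)) z = ?d\<theta> (z - t *\<^sub>R e)" for z
      using pdiff_translate[OF smooth_differentiable[OF \<theta>(1)], where d = "- (t *\<^sub>R e)"] by simp
    have "smooth (\<lambda>z. \<theta> (z - t *\<^sub>R e))" "doubly_periodic L M (\<lambda>z. \<theta> (z - t *\<^sub>R e))"
      using smooth_translate[OF \<theta>(1), of "- (t *\<^sub>R e)"] doubly_periodic_translate[OF \<theta>(2), of "- (t *\<^sub>R e)"]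
      by simp_all
    then have "tint L M (\<lambda>z. f z * pdiff e (\<lambda>z. \<theta> (z - t *\<^sub>R e)) z) = - tint L M (\<lambda>z. f' z * \<theta> (z - t *\<^sub>R e))"
      using w unfolding weak_pdiff_def by blast
    then show ?thesis by (simp add: eq)
  qed
  finally show ?thesis .
qed

text \<open>
  Let \<open>G t\<close> be the pairing of \<open>f\<close> with \<open>\<theta>\<close> translated by \<open>t\<close>. Its derivative \<open>g\<close> is the pairing of \<open>f1\<close>
  with the translates, and \<open>g\<close> is Lipschitz because \<open>f1\<close> has the bounded weak derivative \<open>f2\<close>. Hence
  \<open>G s - G (- s) - 2 * s * g 0\<close> is of order \<open>s\<^sup>2\<close>. The function \<open>f'\<close> is another weak derivative of \<open>f\<close>; it
  agrees with \<open>f1\<close> when tested against \<open>\<theta>\<close>.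
\<close>
lemma weak_pdiff_central_difference_smooth:
  assumes LM: "L > 0" "M > 0" and f: "Linf_torus L M f"
    and w: "weak_pdiff L M e f f'" "weak_pdiff L M e f f1" "weak_pdiff L M e f1 f2"
    and f1: "Linf_torus L M f1" and f2: "Linf_torus L M f2" "AE z in lborel. \<bar>f2 z\<bar> \<le> C"
    and \<theta>: "smooth \<theta>" "doubly_periodic L M \<theta>" "\<And>z. 0 \<le> \<theta> z" and s: "s > 0"
  shows "\<bar>tint L M (\<lambda>z. f z * \<theta> (z - s *\<^sub>R e)) - tint L M (\<lambda>z. f z * \<theta> (z + s *\<^sub>R e)) - 2 * s * tint L M (\<lambda>z. f' z * \<theta> z)\<bar>
    \<le> 2 * C * s\<^sup>2 * tint L M \<theta>"
proof -
  define G where "G t = tint L M (\<lambda>z. f z * \<theta> (z - t *\<^sub>R e))" for t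
  define g where "g t = tint L M (\<lambda>z. f1 z * \<theta> (z - t *\<^sub>R e))" for t
  have G: "(G has_real_derivative g t) (at t)" for t
    unfolding G_def[abs_def] g_def by (rule weak_pdiff_translate_derivative[OF LM w(2) Linf_tintegrable[OF f] \<theta>(1,2)])
  have g: "(g has_real_derivative tint L M (\<lambda>z. f2 z * \<theta> (z - t *\<^sub>R e))) (at t)" for t
    unfolding g_def[abs_def] by (rule weak_pdiff_translate_derivative[OF LM w(3) Linf_tintegrable[OF f1] \<theta>(1,2)])
  note L\<theta> = Linf_smooth[OF LM \<theta>(1,2)]
  have "norm (tint L M (\<lambda>z. f2 z * \<theta> (z - t *\<^sub>R e))) \<le> C * tint L M \<theta>" for t
    using tint_AE_bound[OF f2 Linf_translate_minus[OF L\<theta>], of "t *\<^sub>R e"] \<theta>(3)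
      tint_translate[OF LM L\<theta>, of "- (t *\<^sub>R e)"] by simp
  then have gl: "\<bar>g t - g t'\<bar> \<le> C * tint L M \<theta> * \<bar>t - t'\<bar>" for t t'
    using field_differentiable_bound[where S = UNIV and f = g, OF _ g] by simp
  have g0: "g 0 = tint L M (\<lambda>z. f' z * \<theta> z)"
    using w(1,2) \<theta>(1,2) unfolding weak_pdiff_def g_def by fastforce
  \<comment> \<open>The odd part of \<open>G\<close> minus its linear part; its derivative is small near 0.\<close>
  define H where "H t = G t - G (- t) - 2 * t * g 0" for t
  have H: "(H has_real_derivative g t + g (- t) - 2 * g 0) (at t)" for t
  proof -
    have "((\<lambda>t. G (- t)) has_real_derivative g (- t) * (- 1)) (at t)"
      by (rule DERIV_chain2[OF G]) (auto intro!: derivative_eq_intros)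
    then show ?thesis unfolding H_def[abs_def] by (auto intro!: derivative_eq_intros G)
  qed
  have "\<exists>\<xi>. \<xi> > 0 \<and> \<xi> < s \<and> H s - H 0 = (s - 0) * (g \<xi> + g (- \<xi>) - 2 * g 0)"
    by (rule MVT2[OF s]) (rule H)
  then obtain \<xi> where \<xi>: "\<xi> > 0" "\<xi> < s" "H s - H 0 = s * (g \<xi> + g (- \<xi>) - 2 * g 0)" by auto
  have C0: "0 \<le> C * tint L M \<theta>" using gl[of 1 0] by (smt (verit) abs_ge_zero mult_cancel_left2)
  have "\<bar>g \<xi> + g (- \<xi>) - 2 * g 0\<bar> \<le> C * tint L M \<theta> * \<xi> + C * tint L M \<theta> * \<xi>"
  proof -
    have "\<bar>g \<xi> - g 0\<bar> \<le> C * tint L M \<theta> * \<xi>" "\<bar>g (- \<xi>) - g 0\<bar> \<le> C * tint L M \<theta> * \<xi>"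
      using gl[of \<xi> 0] gl[of "- \<xi>" 0] \<xi>(1) by auto
    then show ?thesis by linarith
  qed
  also have "\<dots> \<le> 2 * (C * tint L M \<theta>) * s" using C0 \<xi>(2) mult_left_mono[of \<xi> s "C * tint L M \<theta>"] by linarith
  finally have "\<bar>H s - H 0\<bar> \<le> s * (2 * (C * tint L M \<theta>) * s)"
    unfolding \<xi>(3) abs_mult using s by (simp add: mult_left_mono)
  moreover have "H 0 = 0" by (simp add: H_def)
  ultimately show ?thesis by (simp add: H_def G_def g0 power2_eq_square algebra_simps)
qed

text \<open>
  A smooth periodic approximation of the indicator function of the interval of width \<open>r\<close> around \<open>c\<close> and of
  its translates by multiples of \<open>L\<close>: the difference of cosines is positive inside and negative outside,
  and \<open>exp (- exp (- k * y))\<close> tends to 1 for \<open>y > 0\<close> and to 0 for \<open>y < 0\<close>. This form is a composition of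
  exponentials and cosines, so its smoothness is immediate.
\<close>
definition bump :: "real \<Rightarrow> real \<Rightarrow> real \<Rightarrow> nat \<Rightarrow> real \<Rightarrow> real" where
  "bump L c r k x = exp (- exp (- (real k * (cos (2 * pi * (x - c) / L) - cos (pi * r / L)))))"

lemma bump_nonneg: "0 \<le> bump L c r k x" and bump_le_1: "bump L c r k x \<le> 1"
  by (auto simp: bump_def)

lemma C_k_bump:
  assumes "C_k m p"
  shows "C_k m (\<lambda>z. bump L c r k (p z))"
proof -
  have eq: "bump L c r k (p z) = exp ((- 1) * exp ((- real k) * (cos ((2 * pi / L) * p z + - (2 * pi * c / L)) + - cos (pi * r / L))))" for z
    by (simp add: bump_def diff_divide_distrib right_diff_distrib)
  show ?thesis unfolding eq
    by (intro C_k_exp C_k_cos C_k_mult C_k_add C_k_const assms)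
qed

lemma bump_periodic:
  assumes "L > 0"
  shows "bump L c r k (x + L) = bump L c r k x"
proof -
  have "2 * pi * (x + L - c) / L = 2 * pi * (x - c) / L + 2 * pi" using assms by (simp add: field_simps)
  then show ?thesis by (simp add: bump_def)
qed

lemma bump_tendsto:
  shows "cos (pi * r / L) < cos (2 * pi * (x - c) / L) \<Longrightarrow> (\<lambda>k. bump L c r k x) \<longlonglongrightarrow> 1"
    and "cos (2 * pi * (x - c) / L) < cos (pi * r / L) \<Longrightarrow> (\<lambda>k. bump L c r k x) \<longlonglongrightarrow> 0"
proof -
  define s where "s = cos (2 * pi * (x - c) / L) - cos (pi * r / L)"
  have b: "bump L c r k x = exp (- (exp (- s) ^ k))" for k
    unfolding bump_def s_def[symmetric] exp_of_nat_mult[symmetric] by simp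
  show "(\<lambda>k. bump L c r k x) \<longlonglongrightarrow> 1" if "cos (pi * r / L) < cos (2 * pi * (x - c) / L)"
  proof -
    have "s > 0" using that by (simp add: s_def)
    then have "(\<lambda>k. exp (- s) ^ k) \<longlonglongrightarrow> 0" by (intro LIMSEQ_realpow_zero) auto
    from tendsto_exp[OF tendsto_minus[OF this]] show ?thesis unfolding b by (simp only: minus_zero exp_zero)
  qed
  show "(\<lambda>k. bump L c r k x) \<longlonglongrightarrow> 0" if "cos (2 * pi * (x - c) / L) < cos (pi * r / L)"
  proof -
    have "s < 0" using that by (simp add: s_def)
    then have lim: "(\<lambda>k. exp s ^ k) \<longlonglongrightarrow> 0" by (intro LIMSEQ_realpow_zero) auto
    have le: "bump L c r k x \<le> exp s ^ k" for k
    proof -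
      have "exp (- s) ^ k \<le> exp (exp (- s) ^ k)" using exp_ge_add_one_self[of "exp (- s) ^ k"] by linarith
      have "bump L c r k x = inverse (exp (exp (- s) ^ k))" unfolding b by (rule exp_minus)
      also have "\<dots> \<le> inverse (exp (- s) ^ k)"
        using \<open>exp (- s) ^ k \<le> exp (exp (- s) ^ k)\<close> by (intro le_imp_inverse_le) auto
      also have "\<dots> = exp s ^ k" by (simp add: exp_minus power_inverse)
      finally show ?thesis .
    qed
    show ?thesis
    proof (rule tendsto_sandwich)
      show "\<forall>\<^sub>F k in sequentially. 0 \<le> bump L c r k x" by (intro always_eventually allI bump_nonneg)
      show "\<forall>\<^sub>F k in sequentially. bump L c r k x \<le> exp s ^ k" by (intro always_eventually allI le)
    qed (rule tendsto_const, rule lim)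
  qed
qed

text \<open>
  Away from the cell boundaries, membership in the periodic cell with index \<open>i\<close> is decided by the sign of
  the difference of cosines in the definition of the bump function: subtract the nearest multiple of
  the period \<open>L\<close> and use that cosine decreases on \<open>{0..pi}\<close>.
\<close>
lemma floor_mod_eq_iff_cos:
  fixes x o' d L :: real and n :: nat and i :: int
  assumes "d > 0" "n > 0" "real n * d = L" and ni: "(x - o') / d + 1/2 \<notin> \<int>"
  defines "c \<equiv> o' + of_int i * d"
  shows "\<lfloor>(x - o') / d + 1/2\<rfloor> mod int n = i mod int n \<Longrightarrow> cos (pi * d / L) < cos (2 * pi * (x - c) / L)"
    and "\<lfloor>(x - o') / d + 1/2\<rfloor> mod int n \<noteq> i mod int n \<Longrightarrow> cos (2 * pi * (x - c) / L) < cos (pi * d / L)"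
proof -
  have L: "L > 0" using assms(1,2) by (simp add: assms(3)[symmetric])
  have dL: "d \<le> L" using assms(1,2) mult_right_mono[of 1 "real n" d] by (simp add: assms(3)[symmetric])
  define m where "m = \<lfloor>(x - c) / L + 1/2\<rfloor>"
  define x' where "x' = x - c - of_int m * L"
  have x': "- L / 2 \<le> x'" "x' < L / 2"
  proof -
    have "of_int m \<le> (x - c) / L + 1/2" "(x - c) / L + 1/2 < of_int m + 1"
      unfolding m_def by linarith+
    then have "of_int m * L \<le> ((x - c) / L + 1/2) * L" "((x - c) / L + 1/2) * L < (of_int m + 1) * L"
      using L by (auto intro: mult_right_mono)
    moreover have eq: "((x - c) / L + 1/2) * L = x - c + L / 2" using L by (simp add: distrib_right)
    moreover have "(of_int m + 1) * L = of_int m * L + L" by (simp add: distrib_right)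
    ultimately have "of_int m * L \<le> x - c + L / 2" "x - c + L / 2 < of_int m * L + L" by (simp_all only:)
    then show "- L / 2 \<le> x'" "x' < L / 2" by (simp_all add: x'_def)
  qed
  have "2 * pi * (x - c) / L = 2 * pi * x' / L + of_int m * (2 * pi)"
    using L by (simp add: x'_def right_diff_distrib diff_divide_distrib)
  then have "cos (2 * pi * (x - c) / L) = cos (2 * pi * x' / L + of_int m * (2 * pi))" by simp
  also have "\<dots> = cos (2 * pi * x' / L)"
    using cos_int_2pin[of m] sin_int_2pin[of m] by (simp add: cos_add mult.commute mult.left_commute)
  also have "\<dots> = cos \<bar>2 * pi * x' / L\<bar>" by (simp add: abs_if)
  finally have cx: "cos (2 * pi * (x - c) / L) = cos (2 * pi * \<bar>x'\<bar> / L)" using L by (simp add: abs_mult)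
  have ax: "\<bar>x'\<bar> \<le> L / 2" using x' by (simp add: abs_le_iff)
  have r: "0 \<le> 2 * pi * \<bar>x'\<bar> / L" "2 * pi * \<bar>x'\<bar> / L \<le> pi" "0 \<le> pi * d / L" "pi * d / L \<le> pi"
    using L dL assms(1) mult_left_mono[OF ax, of "2 * pi"] by (auto simp: pos_divide_le_eq)
  define f0 where "f0 = \<lfloor>x' / d + 1/2\<rfloor>"
  have e: "(x - o') / d + 1/2 = (x' / d + 1/2) + of_int (i + m * int n)"
  proof -
    have "x - o' = x' + (of_int i + of_int m * real n) * d"
      by (simp add: x'_def c_def assms(3)[symmetric] algebra_simps)
    then show ?thesis using assms(1) by (simp add: add_divide_distrib)
  qed
  have fl: "\<lfloor>(x - o') / d + 1/2\<rfloor> = f0 + (i + m * int n)" unfolding e f0_def floor_add_int[symmetric] ..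
  have f0: "- int n < f0" "f0 < int n"
  proof -
    have "- real n / 2 \<le> x' / d" "x' / d < real n / 2"
      using x' assms(1) by (auto simp: pos_le_divide_eq pos_divide_less_eq assms(3)[symmetric])
    moreover have "real n \<ge> 1" using assms(2) by simp
    ultimately have "- real n + 1 \<le> x' / d + 1/2" "x' / d + 1/2 < real n" by linarith+
    then show "- int n < f0" "f0 < int n" unfolding f0_def by linarith+
  qed
  have "(f0 + (i + m * int n)) mod int n = (f0 + i) mod int n"
    by (metis add.assoc mod_mult_self1)
  then have "\<lfloor>(x - o') / d + 1/2\<rfloor> mod int n = i mod int n \<longleftrightarrow> int n dvd f0"
    unfolding fl by (simp add: mod_eq_dvd_iff)
  also have "\<dots> \<longleftrightarrow> f0 = 0" using f0 dvd_imp_le_int[of f0 "int n"] by force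
  also have "\<dots> \<longleftrightarrow> \<bar>x'\<bar> < d / 2"
  proof -
    have "x' / d + 1/2 \<noteq> 0" using ni e by (metis Ints_of_int add_0)
    then have "f0 = 0 \<longleftrightarrow> 0 < x' / d + 1/2 \<and> x' / d + 1/2 < 1" unfolding f0_def by linarith
    also have "\<dots> \<longleftrightarrow> - (1/2) < x' / d \<and> x' / d < 1/2" by (intro conj_cong) linarith+
    also have "\<dots> \<longleftrightarrow> \<bar>x'\<bar> < d / 2" using assms(1) by (auto simp: pos_less_divide_eq pos_divide_less_eq abs_less_iff)
    finally show ?thesis .
  qed
  finally have iff: "\<lfloor>(x - o') / d + 1/2\<rfloor> mod int n = i mod int n \<longleftrightarrow> \<bar>x'\<bar> < d / 2" .
  have ne: "\<bar>x'\<bar> \<noteq> d / 2"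
  proof
    assume "\<bar>x'\<bar> = d / 2"
    then have "x' = d / 2 \<or> x' = - (d / 2)" by (auto simp: abs_if split: if_splits)
    then have "x' / d + 1/2 = 1 \<or> x' / d + 1/2 = 0" using assms(1) by auto
    then have "x' / d + 1/2 \<in> \<int>" by auto
    then show False using ni e by (metis Ints_add Ints_of_int)
  qed
  show "cos (pi * d / L) < cos (2 * pi * (x - c) / L)" if "\<lfloor>(x - o') / d + 1/2\<rfloor> mod int n = i mod int n"
  proof -
    have "2 * pi * \<bar>x'\<bar> < pi * d" using iff that by simp
    then have "2 * pi * \<bar>x'\<bar> / L < pi * d / L" using L by (intro divide_strict_right_mono)
    then show ?thesis unfolding cx using r by (simp add: cos_mono_less_eq)
  qed
  show "cos (2 * pi * (x - c) / L) < cos (pi * d / L)" if "\<lfloor>(x - o') / d + 1/2\<rfloor> mod int n \<noteq> i mod int n"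
  proof -
    have "pi * d < 2 * pi * \<bar>x'\<bar>" using iff that ne by simp
    then have "pi * d / L < 2 * pi * \<bar>x'\<bar> / L" using L by (intro divide_strict_right_mono)
    then show ?thesis unfolding cx using r by (simp add: cos_mono_less_eq)
  qed
qed

lemma AE_not_Ints:
  assumes "d > 0"
  shows "AE z in lborel. (fst (z :: real \<times> real) - o') / d + 1/2 \<notin> \<int>"
    and "AE z in lborel. (snd (z :: real \<times> real) - o') / d + 1/2 \<notin> \<int>"
proof -
  have ex: "(t - o') / d + 1/2 \<notin> \<int>" if "\<forall>k::int. t \<noteq> o' + (of_int k - 1/2) * d" for t
  proof
    assume "(t - o') / d + 1/2 \<in> \<int>"
    then obtain k :: int where "(t - o') / d + 1/2 = of_int k" by (auto elim: Ints_cases)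
    then have "(t - o') / d = of_int k - 1/2" by linarith
    then have "t = o' + (of_int k - 1/2) * d" using assms by (simp add: nonzero_divide_eq_eq)
    then show False using that by blast
  qed
  have "AE z in lborel. \<forall>k::int. fst (z :: real \<times> real) \<noteq> o' + (of_int k - 1/2) * d"
    by (subst AE_all_countable) (intro allI AE_lborel_fst_neq)
  then show "AE z in lborel. (fst (z :: real \<times> real) - o') / d + 1/2 \<notin> \<int>"
    by (rule eventually_mono) (rule ex)
  have "AE z in lborel. \<forall>k::int. snd (z :: real \<times> real) \<noteq> o' + (of_int k - 1/2) * d"
    by (subst AE_all_countable) (intro allI AE_lborel_snd_neq)
  then show "AE z in lborel. (snd (z :: real \<times> real) - o') / d + 1/2 \<notin> \<int>"
    by (rule eventually_mono) (rule ex)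
qed

lemma tint_dominated_limit:
  assumes f: "tintegrable L M f"
    and m: "\<And>k. \<theta> k \<in> borel_measurable borel" "\<theta>' \<in> borel_measurable borel"
    and b: "\<And>k z. \<bar>\<theta> k z\<bar> \<le> 1" and lim: "AE z in lborel. (\<lambda>k. \<theta> k z) \<longlonglongrightarrow> \<theta>' z"
  shows "(\<lambda>k. tint L M (\<lambda>z. f z * \<theta> k z)) \<longlonglongrightarrow> tint L M (\<lambda>z. f z * \<theta>' z)"
  unfolding set_lebesgue_integral_def
proof (rule integral_dominated_convergence)
  let ?f = "\<lambda>z. indicator (torus L M) z *\<^sub>R f z"
  have i: "integrable lborel ?f" using f by (simp add: set_integrable_def)
  then show "integrable lborel (\<lambda>z. \<bar>?f z\<bar>)" by (rule integrable_abs)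
  have mf: "?f \<in> borel_measurable borel" using i by auto
  have "(\<lambda>z. ?f z * \<theta>' z) \<in> borel_measurable borel" "(\<lambda>z. ?f z * \<theta> k z) \<in> borel_measurable borel" for k
    using mf m by (auto intro: borel_measurable_times)
  then show "(\<lambda>z. indicator (torus L M) z *\<^sub>R (f z * \<theta>' z)) \<in> borel_measurable lborel"
    "(\<lambda>z. indicator (torus L M) z *\<^sub>R (f z * \<theta> k z)) \<in> borel_measurable lborel" for k
    by (simp_all add: mult.assoc)
  show "AE z in lborel. (\<lambda>k. indicator (torus L M) z *\<^sub>R (f z * \<theta> k z)) \<longlonglongrightarrow> indicator (torus L M) z *\<^sub>R (f z * \<theta>' z)"
    by (rule eventually_mono[OF lim]) (intro tendsto_intros)
  have "\<bar>f z\<bar> * \<bar>\<theta> k z\<bar> \<le> \<bar>f z\<bar>" for k z using b[of k z] mult_left_mono[of "\<bar>\<theta> k z\<bar>" 1 "\<bar>f z\<bar>"] by simp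
  then show "AE z in lborel. norm (indicator (torus L M) z *\<^sub>R (f z * \<theta> k z)) \<le> \<bar>?f z\<bar>" for k
    by (auto simp: indicator_def abs_mult)
qed

context sw_mesh
begin

definition cell_bump :: "int \<Rightarrow> int \<Rightarrow> nat \<Rightarrow> real \<times> real \<Rightarrow> real" where
  "cell_bump i j k z = bump (Lx P) (xc M i) (dx M) k (fst z) * bump (Ly P) (yc M j) (dy M) k (snd z)"

lemma cell_bump_smooth: "smooth (cell_bump i j k)"
  unfolding smooth_def cell_bump_def[abs_def]
  by (intro allI C_k_mult C_k_bump C_k_bounded_linear bounded_linear_fst bounded_linear_snd)

lemma cell_bump_periodic: "doubly_periodic (Lx P) (Ly P) (cell_bump i j k)"
  by (simp add: doubly_periodic_def cell_bump_def bump_periodic Lx_pos Ly_pos)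

lemma cell_bump_nonneg: "0 \<le> cell_bump i j k z" and cell_bump_abs_le: "\<bar>cell_bump i j k z\<bar> \<le> 1"
proof -
  show 0: "0 \<le> cell_bump i j k z" by (simp add: cell_bump_def bump_nonneg)
  have "cell_bump i j k z \<le> 1 * 1" unfolding cell_bump_def by (intro mult_mono bump_nonneg bump_le_1) auto
  then show "\<bar>cell_bump i j k z\<bar> \<le> 1" using 0 by simp
qed

lemma cell_bump_tendsto: "AE z in lborel. (\<lambda>k. cell_bump i j k z) \<longlonglongrightarrow> cell_ind i j z"
  using AE_not_Ints(1)[OF dx_pos, of "x0 M"] AE_not_Ints(2)[OF dy_pos, of "y0 M"]
proof eventually_elim
  case (elim z)
  note X = floor_mod_eq_iff_cos[OF dx_pos nx_pos nx_dx elim(1), of i, folded xc_def]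
  note Y = floor_mod_eq_iff_cos[OF dy_pos ny_pos ny_dy elim(2), of j, folded yc_def]
  have x: "(\<lambda>k. bump (Lx P) (xc M i) (dx M) k (fst z)) \<longlonglongrightarrow> of_bool (\<lfloor>(fst z - x0 M) / dx M + 1/2\<rfloor> mod int (nx M) = i mod int (nx M))"
    using X bump_tendsto[where r = "dx M" and L = "Lx P" and x = "fst z" and c = "xc M i"]
    by (cases "\<lfloor>(fst z - x0 M) / dx M + 1/2\<rfloor> mod int (nx M) = i mod int (nx M)") simp_all
  have y: "(\<lambda>k. bump (Ly P) (yc M j) (dy M) k (snd z)) \<longlonglongrightarrow> of_bool (\<lfloor>(snd z - y0 M) / dy M + 1/2\<rfloor> mod int (ny M) = j mod int (ny M))"
    using Y bump_tendsto[where r = "dy M" and L = "Ly P" and x = "snd z" and c = "yc M j"]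
    by (cases "\<lfloor>(snd z - y0 M) / dy M + 1/2\<rfloor> mod int (ny M) = j mod int (ny M)") simp_all
  show ?case using tendsto_mult[OF x y] by (simp add: cell_bump_def cell_ind_def pc_def of_bool_conj)
qed

text \<open>
  A weak derivative is defined by smooth test functions only. Smooth bumps converge boundedly and almost
  everywhere to the indicator of a cell, and all terms of the estimate for smooth \<open>\<theta>\<close> pass to the limit.
  So cell averages of a function in \<open>W\<^sup>2\<^sup>,\<^sup>\<infinity>\<close> have central differences that approximate the cell averages
  of its derivative to first order.
\<close>
lemma weak_pdiff_cell:
  assumes f: "Linf f"
    and w: "weak_pdiff (Lx P) (Ly P) e f f'" "weak_pdiff (Lx P) (Ly P) e f f1" "weak_pdiff (Lx P) (Ly P) e f1 f2"
    and f1: "Linf f1" and f2: "Linf f2" "AE z in lborel. \<bar>f2 z\<bar> \<le> C" and s: "s > 0"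
  shows "\<bar>TI (\<lambda>z. f z * cell_ind i j (z - s *\<^sub>R e)) - TI (\<lambda>z. f z * cell_ind i j (z + s *\<^sub>R e))
      - 2 * s * TI (\<lambda>z. f' z * cell_ind i j z)\<bar> \<le> 2 * C * s\<^sup>2 * TI (cell_ind i j)"
proof (rule LIMSEQ_le)
  let ?\<theta> = "cell_bump i j"
  have f': "TIable f'" using w(1) by (simp add: weak_pdiff_def L1_torus_def)
  have mb: "?\<theta> k \<in> borel_measurable borel" "cell_ind i j \<in> borel_measurable borel" for k
  proof -
    show "?\<theta> k \<in> borel_measurable borel"
      by (rule borel_measurable_continuous_onI[OF smooth_continuous[OF cell_bump_smooth]])
    show "cell_ind i j \<in> borel_measurable borel" using Linf_cell_ind by (simp add: Linf_torus_def)
  qed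
  have lim: "(\<lambda>k. TI (\<lambda>z. g z * ?\<theta> k z)) \<longlonglongrightarrow> TI (\<lambda>z. g z * cell_ind i j z)" if "TIable g" for g
    by (rule tint_dominated_limit[OF that mb cell_bump_abs_le cell_bump_tendsto])
  have shift: "TI (\<lambda>z. f z * \<rho> (z + d)) = TI (\<lambda>z. f (z - d) * \<rho> z)" if "Linf \<rho>" for \<rho> d
    using tint_translate[OF Lx_pos Ly_pos, of "\<lambda>z. f (z - d) * \<rho> z" d]
    by (simp add: Linf_mult that Linf_translate_minus f)
  have L\<theta>: "Linf (?\<theta> k)" for k by (rule Linf_smooth[OF Lx_pos Ly_pos cell_bump_smooth cell_bump_periodic])
  have lim_shift: "(\<lambda>k. TI (\<lambda>z. f z * ?\<theta> k (z + d))) \<longlonglongrightarrow> TI (\<lambda>z. f z * cell_ind i j (z + d))" for d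
    unfolding shift[OF L\<theta>] shift[OF Linf_cell_ind]
    by (rule lim[OF Linf_tintegrable[OF Linf_translate_minus[OF f]]])
  show "(\<lambda>k. \<bar>TI (\<lambda>z. f z * ?\<theta> k (z - s *\<^sub>R e)) - TI (\<lambda>z. f z * ?\<theta> k (z + s *\<^sub>R e))
      - 2 * s * TI (\<lambda>z. f' z * ?\<theta> k z)\<bar>) \<longlonglongrightarrow>
    \<bar>TI (\<lambda>z. f z * cell_ind i j (z - s *\<^sub>R e)) - TI (\<lambda>z. f z * cell_ind i j (z + s *\<^sub>R e))
      - 2 * s * TI (\<lambda>z. f' z * cell_ind i j z)\<bar>"
    using lim_shift[of "- (s *\<^sub>R e)"] lim_shift[of "s *\<^sub>R e"] lim[OF f']
    by (intro tendsto_intros) simp_all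
  have "(\<lambda>k. TI (\<lambda>z. 1 * ?\<theta> k z)) \<longlonglongrightarrow> TI (\<lambda>z. 1 * cell_ind i j z)"
    by (rule lim[OF Linf_tintegrable[OF Linf_const]])
  then show "(\<lambda>k. 2 * C * s\<^sup>2 * TI (?\<theta> k)) \<longlonglongrightarrow> 2 * C * s\<^sup>2 * TI (cell_ind i j)"
    by (intro tendsto_intros) simp
  show "\<exists>N. \<forall>k\<ge>N. \<bar>TI (\<lambda>z. f z * ?\<theta> k (z - s *\<^sub>R e)) - TI (\<lambda>z. f z * ?\<theta> k (z + s *\<^sub>R e))
      - 2 * s * TI (\<lambda>z. f' z * ?\<theta> k z)\<bar> \<le> 2 * C * s\<^sup>2 * TI (?\<theta> k)"
    using weak_pdiff_central_difference_smooth[OF Lx_pos Ly_pos f w f1 f2 cell_bump_smooth cell_bump_periodic cell_bump_nonneg s]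
    by blast
qed

end

section \<open>The discrete energy estimate\<close>

lemma square_sum3_le: "(a + b + c)\<^sup>2 \<le> 3 * (a\<^sup>2 + b\<^sup>2 + c\<^sup>2)" for a b c :: real
proof -
  have "0 \<le> (a - b)\<^sup>2 + (b - c)\<^sup>2 + (a - c)\<^sup>2" by simp
  then show ?thesis by (simp add: power2_eq_square algebra_simps)
qed

lemma weighted_square_sum4_le:
  fixes a1 a2 a3 a4 d1 d2 d3 d4 :: real
  assumes "0 \<le> a1" "0 \<le> a2" "0 \<le> a3" "0 \<le> a4"
  shows "(a1 * d1 + a2 * d2 + a3 * d3 + a4 * d4)\<^sup>2
    \<le> (a1 + a2 + a3 + a4) * (a1 * d1\<^sup>2 + a2 * d2\<^sup>2 + a3 * d3\<^sup>2 + a4 * d4\<^sup>2)"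
proof -
  have "0 \<le> a1 * a2 * (d1 - d2)\<^sup>2 + a1 * a3 * (d1 - d3)\<^sup>2 + a1 * a4 * (d1 - d4)\<^sup>2
    + a2 * a3 * (d2 - d3)\<^sup>2 + a2 * a4 * (d2 - d4)\<^sup>2 + a3 * a4 * (d3 - d4)\<^sup>2"
    using assms by simp
  then show ?thesis by (simp add: power2_eq_square algebra_simps)
qed

text \<open>
  With the upwind value, the flux through a face equals the flux of the value in the cell itself plus a
  correction which involves only the incoming part of the flux; the same holds for the square.
\<close>
lemma upwind_outflow:
  fixes F u w d :: real
  assumes "d > 0"
  shows "F * (if F \<ge> 0 then u else w) / d = F * u / d - (- neg_part F / d) * (w - u)"
    and "F * (if F \<ge> 0 then u else w)\<^sup>2 / d = F * u\<^sup>2 / d - (- neg_part F / d) * (w\<^sup>2 - u\<^sup>2)"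
  using assms by (auto simp: neg_part_def field_simps)

lemma upwind_inflow:
  fixes F u w d :: real
  assumes "d > 0"
  shows "F * (if F \<ge> 0 then w else u) / d = F * u / d + (pos_part F / d) * (w - u)"
    and "F * (if F \<ge> 0 then w else u)\<^sup>2 / d = F * u\<^sup>2 / d + (pos_part F / d) * (w\<^sup>2 - u\<^sup>2)"
  using assms by (auto simp: pos_part_def field_simps)

text \<open>
  Subtracting \<open>u\<close> times the mass equation from the momentum equation leaves
  \<open>h' * (u' - u) = t * (S1 - h' * X - c)\<close>, where \<open>S1\<close> collects the jumps \<open>uE - u\<close> etc. with nonnegative
  weights. Multiplication by \<open>u\<close> produces a conservative flux of \<open>u\<^sup>2 / 2\<close> and the upwind dissipation
  \<open>S3 / 2\<close>. The explicit time step costs \<open>t\<^sup>2 * (S1 - h' * X - c)\<^sup>2 / (2 * h')\<close>; the square is split into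
  three squares, and the CFL condition with its factor 3 lets \<open>S3 / 2\<close> absorb the part with \<open>S1\<close>.
\<close>
lemma kinetic_energy_cell:
  fixes h h' u u' uE uW uN uS FE FW GN GS X c t dx dy :: real
  defines "upE \<equiv> (if FE \<ge> 0 then u else uE)" and "upW \<equiv> (if FW \<ge> 0 then uW else u)"
    and "upN \<equiv> (if GN \<ge> 0 then u else uN)" and "upS \<equiv> (if GS \<ge> 0 then uS else u)"
  assumes pos: "h' > 0" "t > 0" "dx > 0" "dy > 0"
    and mass: "(h' - h) / t + (FE - FW) / dx + (GN - GS) / dy = 0"
    and mom: "(h' * u' - h * u) / t + (FE * upE - FW * upW) / dx + (GN * upN - GS * upS) / dy = - h' * X - c"
    and cfl: "1 + 3 * t / h' * ((neg_part FE - pos_part FW) / dx + (neg_part GN - pos_part GS) / dy) \<ge> 0"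
  shows "h' * u'\<^sup>2 / 2 - h * u\<^sup>2 / 2
    \<le> - t * ((FE * upE\<^sup>2 - FW * upW\<^sup>2) / (2 * dx) + (GN * upN\<^sup>2 - GS * upS\<^sup>2) / (2 * dy))
      - t * h' * u * X - t * u * c + 3 * t\<^sup>2 * h' * X\<^sup>2 / 2 + 3 * t\<^sup>2 * c\<^sup>2 / (2 * h')"
proof -
  define aE where "aE = - neg_part FE / dx"
  define aW where "aW = pos_part FW / dx"
  define aN where "aN = - neg_part GN / dy"
  define aS where "aS = pos_part GS / dy"
  have a0: "0 \<le> aE" "0 \<le> aW" "0 \<le> aN" "0 \<le> aS"
    unfolding aE_def aW_def aN_def aS_def using pos
    by (auto intro!: divide_nonneg_pos simp: neg_part_def pos_part_def simp del: divide_minus_left minus_divide_left)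
  define D where "D = (FE - FW) / dx + (GN - GS) / dy"
  define S1 where "S1 = aE * (uE - u) + aW * (uW - u) + aN * (uN - u) + aS * (uS - u)"
  define S2 where "S2 = aE * (uE\<^sup>2 - u\<^sup>2) + aW * (uW\<^sup>2 - u\<^sup>2) + aN * (uN\<^sup>2 - u\<^sup>2) + aS * (uS\<^sup>2 - u\<^sup>2)"
  define S3 where "S3 = aE * (uE - u)\<^sup>2 + aW * (uW - u)\<^sup>2 + aN * (uN - u)\<^sup>2 + aS * (uS - u)\<^sup>2"
  define Sa where "Sa = aE + aW + aN + aS"
  have h: "h = h' + t * D" using mass pos by (simp add: D_def field_simps)
  have conv: "(FE * upE - FW * upW) / dx + (GN * upN - GS * upS) / dy = u * D - S1"
    using upwind_outflow(1)[OF pos(3), of FE u uE] upwind_inflow(1)[OF pos(3), of FW uW u]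
      upwind_outflow(1)[OF pos(4), of GN u uN] upwind_inflow(1)[OF pos(4), of GS uS u]
    by (simp add: upE_def upW_def upN_def upS_def S1_def D_def aE_def aW_def aN_def aS_def
        diff_divide_distrib algebra_simps)
  have conv2: "(FE * upE\<^sup>2 - FW * upW\<^sup>2) / dx + (GN * upN\<^sup>2 - GS * upS\<^sup>2) / dy = u\<^sup>2 * D - S2"
    using upwind_outflow(2)[OF pos(3), of FE u uE] upwind_inflow(2)[OF pos(3), of FW uW u]
      upwind_outflow(2)[OF pos(4), of GN u uN] upwind_inflow(2)[OF pos(4), of GS uS u]
    by (simp add: upE_def upW_def upN_def upS_def S2_def D_def aE_def aW_def aN_def aS_def
        diff_divide_distrib algebra_simps)
  define R where "R = S1 - h' * X - c"
  have "(h' * u' - h * u) / t = R - u * D" using mom conv by (simp add: R_def)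
  then have u': "h' * u' = h' * u + t * R" using pos by (simp add: h field_simps)
  then have u'2: "u' = u + t * R / h'" using pos by (simp add: field_simps)
  \<comment> \<open>The mass equation removes \<open>h\<close> in favour of the divergence \<open>D\<close>.\<close>
  have kin: "h' * u'\<^sup>2 / 2 - h * u\<^sup>2 / 2 = t * u * R + t\<^sup>2 * R\<^sup>2 / (2 * h') - t * D * u\<^sup>2 / 2"
    unfolding u'2 h using pos by (simp add: power2_eq_square field_simps)
  have S12: "u * S1 - S2 / 2 = - S3 / 2"
    by (simp add: S1_def S2_def S3_def power2_eq_square field_simps)
  \<comment> \<open>The CFL condition in terms of the weights.\<close>
  have "3 * t / h' * Sa \<le> 1"
    using cfl by (simp add: Sa_def aE_def aW_def aN_def aS_def algebra_simps diff_divide_distrib)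
  then have Sa: "3 * t * Sa \<le> h'" using pos by (simp add: pos_divide_le_eq)
  have S30: "0 \<le> S3" using a0 by (simp add: S3_def)
  have "3 * t * S1\<^sup>2 \<le> 3 * t * (Sa * S3)"
    using weighted_square_sum4_le[OF a0, of "uE - u" "uW - u" "uN - u" "uS - u"] pos
    by (simp add: S1_def S3_def Sa_def)
  also have "\<dots> \<le> h' * S3" using mult_right_mono[OF Sa S30] by (simp add: mult.assoc)
  finally have S1: "3 * t * S1\<^sup>2 \<le> h' * S3" .
  have "R\<^sup>2 \<le> 3 * (S1\<^sup>2 + (h' * X)\<^sup>2 + c\<^sup>2)"
    using square_sum3_le[of S1 "- (h' * X)" "- c"] by (simp add: R_def)
  then have "t\<^sup>2 * R\<^sup>2 \<le> t\<^sup>2 * (3 * (S1\<^sup>2 + (h' * X)\<^sup>2 + c\<^sup>2))" by (intro mult_left_mono) auto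
  also have "\<dots> = t * (3 * t * S1\<^sup>2) + 3 * t\<^sup>2 * (h'\<^sup>2 * X\<^sup>2 + c\<^sup>2)"
    by (simp add: power2_eq_square algebra_simps)
  also have "\<dots> \<le> t * (h' * S3) + 3 * t\<^sup>2 * (h'\<^sup>2 * X\<^sup>2 + c\<^sup>2)"
    using S1 pos by simp
  finally have "t\<^sup>2 * R\<^sup>2 / (2 * h') \<le> (t * (h' * S3) + 3 * t\<^sup>2 * (h'\<^sup>2 * X\<^sup>2 + c\<^sup>2)) / (2 * h')"
    using pos by (intro divide_right_mono) auto
  also have "\<dots> = t * S3 / 2 + 3 * t\<^sup>2 * h' * X\<^sup>2 / 2 + 3 * t\<^sup>2 * c\<^sup>2 / (2 * h')"
    using pos by (simp add: power2_eq_square field_simps)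
  finally have R2: "t\<^sup>2 * R\<^sup>2 / (2 * h') \<le> t * S3 / 2 + 3 * t\<^sup>2 * h' * X\<^sup>2 / 2 + 3 * t\<^sup>2 * c\<^sup>2 / (2 * h')" .
  have "(FE * upE\<^sup>2 - FW * upW\<^sup>2) / (2 * dx) + (GN * upN\<^sup>2 - GS * upS\<^sup>2) / (2 * dy) = (u\<^sup>2 * D - S2) / 2"
    unfolding conv2[symmetric] by (simp add: add_divide_distrib mult.commute)
  moreover have "t * u * R = t * (u * S1) - t * h' * u * X - t * u * c" by (simp add: R_def algebra_simps)
  moreover have "t * (u * S1) = t * (S2 / 2) - t * S3 / 2" using arg_cong[OF S12, of "\<lambda>x. t * x"] by (simp add: algebra_simps)
  moreover have "- t * ((u\<^sup>2 * D - S2) / 2) = t * (S2 / 2) - t * D * u\<^sup>2 / 2" by (simp add: field_simps)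
  ultimately show ?thesis using kin R2 by (simp only:)
qed

context sw_mesh
begin

lemma gp_const: "grid_periodic M (\<lambda>i j. c)"
  by (simp add: grid_periodic_def)

lemma gp_add: "grid_periodic M f \<Longrightarrow> grid_periodic M g \<Longrightarrow> grid_periodic M (\<lambda>i j. f i j + g i j)"
  and gp_diff: "grid_periodic M f \<Longrightarrow> grid_periodic M g \<Longrightarrow> grid_periodic M (\<lambda>i j. f i j - g i j)"
  and gp_mult: "grid_periodic M f \<Longrightarrow> grid_periodic M g \<Longrightarrow> grid_periodic M (\<lambda>i j. f i j * g i j)"
  and gp_divide: "grid_periodic M f \<Longrightarrow> grid_periodic M g \<Longrightarrow> grid_periodic M (\<lambda>i j. f i j / g i j)"
  and gp_minus: "grid_periodic M f \<Longrightarrow> grid_periodic M (\<lambda>i j. - f i j)"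
  and gp_abs: "grid_periodic M f \<Longrightarrow> grid_periodic M (\<lambda>i j. \<bar>f i j\<bar>)"
  and gp_power: "grid_periodic M f \<Longrightarrow> grid_periodic M (\<lambda>i j. f i j ^ k)"
  and gp_if: "grid_periodic M f \<Longrightarrow> grid_periodic M g \<Longrightarrow> grid_periodic M h
    \<Longrightarrow> grid_periodic M (\<lambda>i j. if 0 \<le> f i j then g i j else h i j)"
  by (simp_all add: grid_periodic_def)

lemma grid_periodic_shift_x': "grid_periodic M z \<Longrightarrow> grid_periodic M (\<lambda>i j. z (i - 1) j)"
  using grid_periodic_shift_x[of z "-1"] by simp

lemma grid_periodic_shift_y': "grid_periodic M z \<Longrightarrow> grid_periodic M (\<lambda>i j. z i (j - 1))"
  using grid_periodic_shift_y[of z "-1"] by simp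

lemma gp_mean_x: "grid_periodic M z \<Longrightarrow> grid_periodic M (mean_x z)"
  and gp_mean_y: "grid_periodic M z \<Longrightarrow> grid_periodic M (mean_y z)"
  unfolding mean_x_def[abs_def] mean_y_def[abs_def]
  by (intro gp_add gp_divide gp_const grid_periodic_shift_x grid_periodic_shift_y; assumption)+

lemma gp_eth_x: "grid_periodic M z \<Longrightarrow> grid_periodic M (eth_x M z)"
  and gp_eth_y: "grid_periodic M z \<Longrightarrow> grid_periodic M (eth_y M z)"
  unfolding eth_x_def[abs_def] eth_y_def[abs_def]
  by (intro gp_diff gp_divide gp_const grid_periodic_shift_x' grid_periodic_shift_y' gp_mean_x gp_mean_y; assumption)+

lemmas gp_intros = gp_const gp_add gp_diff gp_mult gp_divide gp_minus gp_abs gp_power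
  grid_periodic_shift_x grid_periodic_shift_x' grid_periodic_shift_y grid_periodic_shift_y'
  gp_mean_x gp_mean_y gp_eth_x gp_eth_y

lemma GS_shift_x': "grid_periodic M z \<Longrightarrow> GS (\<lambda>i j. z (i - 1) j) = GS z"
  using GS_shift_x[of z "-1"] by simp

lemma GS_shift_y': "grid_periodic M z \<Longrightarrow> GS (\<lambda>i j. z i (j - 1)) = GS z"
  using GS_shift_y[of z "-1"] by simp

lemma GS_summation_by_parts_x:
  assumes a: "grid_periodic M a" and f: "grid_periodic M f"
  shows "GS (\<lambda>i j. f i j * ((mean_x a i j - mean_x a (i - 1) j) / dx M)) = - GS (\<lambda>i j. a i j * eth_x M f i j)"
proof -
  have "GS (\<lambda>i j. f i j * a (i + 1) j) = GS (\<lambda>i j. f (i - 1) j * a i j)"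
    using GS_shift_x'[of "\<lambda>i j. f i j * a (i + 1) j"] a f by (simp add: gp_intros)
  moreover have "GS (\<lambda>i j. f i j * a (i - 1) j) = GS (\<lambda>i j. f (i + 1) j * a i j)"
    using GS_shift_x[of "\<lambda>i j. f i j * a (i - 1) j" 1] a f by (simp add: gp_intros)
  moreover have "(\<lambda>i j. f i j * ((mean_x a i j - mean_x a (i - 1) j) / dx M))
      = (\<lambda>i j. (f i j * a (i + 1) j - f i j * a (i - 1) j) / (2 * dx M))"
    using dx_pos by (simp add: fun_eq_iff mean_x_def field_simps)
  moreover have "(\<lambda>i j. a i j * eth_x M f i j) = (\<lambda>i j. (f (i + 1) j * a i j - f (i - 1) j * a i j) / (2 * dx M))"
    using dx_pos by (simp add: fun_eq_iff eth_x_def mean_x_def field_simps)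
  ultimately show ?thesis by (simp add: GS_divide GS_diff diff_divide_distrib)
qed

lemma GS_summation_by_parts_y:
  assumes a: "grid_periodic M a" and f: "grid_periodic M f"
  shows "GS (\<lambda>i j. f i j * ((mean_y a i j - mean_y a i (j - 1)) / dy M)) = - GS (\<lambda>i j. a i j * eth_y M f i j)"
proof -
  have "GS (\<lambda>i j. f i j * a i (j + 1)) = GS (\<lambda>i j. f i (j - 1) * a i j)"
    using GS_shift_y'[of "\<lambda>i j. f i j * a i (j + 1)"] a f by (simp add: gp_intros)
  moreover have "GS (\<lambda>i j. f i j * a i (j - 1)) = GS (\<lambda>i j. f i (j + 1) * a i j)"
    using GS_shift_y[of "\<lambda>i j. f i j * a i (j - 1)" 1] a f by (simp add: gp_intros)
  moreover have "(\<lambda>i j. f i j * ((mean_y a i j - mean_y a i (j - 1)) / dy M))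
      = (\<lambda>i j. (f i j * a i (j + 1) - f i j * a i (j - 1)) / (2 * dy M))"
    using dy_pos by (simp add: fun_eq_iff mean_y_def field_simps)
  moreover have "(\<lambda>i j. a i j * eth_y M f i j) = (\<lambda>i j. (f i (j + 1) * a i j - f i (j - 1) * a i j) / (2 * dy M))"
    using dy_pos by (simp add: fun_eq_iff eth_y_def mean_y_def field_simps)
  ultimately show ?thesis by (simp add: GS_divide GS_diff diff_divide_distrib)
qed

end

text \<open>
  Bounds on the data are parameters of the locale, so that all constants built from them are visibly
  independent of the run \<open>S\<close>.
\<close>
locale sw_scheme = sw_mesh P S for P :: sw_problem and S :: sw_run +
  fixes \<eta> \<zeta> hlo hhi Bb Bu Bv :: real
  assumes valid: "valid_problem P" and sol: "numerical_solution P \<eta> S"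
    and stab: "energy_stability_conditions P \<eta> \<zeta> S" and hb: "height_bounds hlo hhi S"
    and hlo_pos: "0 < hlo" and eta: "\<eta> > 3/2 * hhi" and zeta: "0 < \<zeta>" "\<zeta> < 1"
    and Bb: "AE z in lborel. \<bar>bot P z\<bar> \<le> Bb" and Bu: "AE z in lborel. \<bar>u_init P z\<bar> \<le> Bu"
    and Bv: "AE z in lborel. \<bar>v_init P z\<bar> \<le> Bv"
begin

abbreviation "h n \<equiv> hh S n"
abbreviation "u n \<equiv> uu S n"
abbreviation "v n \<equiv> vv S n"
abbreviation "b \<equiv> cell_average S (bot P)"

text \<open>
  The geostrophic residuals: the stabilising terms are \<open>q = \<eta> * dt * Xg\<close> and \<open>r = \<eta> * dt * Yg\<close>.
\<close>
definition Xg :: "nat \<Rightarrow> grid" where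
  "Xg n i j = eth_x S (phi P S (n + 1)) i j - cor P * v n i j"
definition Yg :: "nat \<Rightarrow> grid" where
  "Yg n i j = eth_y S (phi P S (n + 1)) i j + cor P * u n i j"

lemma grav_pos: "grav P > 0" using valid by (simp add: valid_problem_def)

lemma Linf_bot: "Linf (bot P)" and Linf_u_init: "Linf (u_init P)" and Linf_v_init: "Linf (v_init P)"
  using valid by (auto simp: valid_problem_def numeral_2_eq_2)

lemma h_bounds: "n \<le> nt S \<Longrightarrow> hlo \<le> h n i j" "n \<le> nt S \<Longrightarrow> h n i j \<le> hhi"
  using hb by (auto simp: height_bounds_def)

lemma hhi_pos: "0 < hhi" using h_bounds[of 0 0 0] hlo_pos by auto

lemma h_pos: "n \<le> nt S \<Longrightarrow> 0 < h n i j" using h_bounds(1)[of n i j] hlo_pos by linarith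

lemma gp_huv: "n \<le> nt S \<Longrightarrow> grid_periodic S (h n)" "n \<le> nt S \<Longrightarrow> grid_periodic S (u n)"
  "n \<le> nt S \<Longrightarrow> grid_periodic S (v n)"
  using sol by (auto simp: numerical_solution_def)

lemma gp_b: "grid_periodic S b"
  by (rule grid_periodic_cell_average[OF Linf_bot])

lemma gp_phi: "n \<le> nt S \<Longrightarrow> grid_periodic S (phi P S n)"
  unfolding phi_def[abs_def] by (intro gp_intros gp_huv gp_b)

lemma gp_Xg: "n < nt S \<Longrightarrow> grid_periodic S (Xg n)" and gp_Yg: "n < nt S \<Longrightarrow> grid_periodic S (Yg n)"
  unfolding Xg_def[abs_def] Yg_def[abs_def] by (intro gp_intros gp_huv gp_phi; simp)+

lemma qq_eq: "qq P \<eta> S n i j = \<eta> * dt S * Xg n i j" and rr_eq: "rr P \<eta> S n i j = \<eta> * dt S * Yg n i j"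
  by (simp_all add: qq_def rr_def Xg_def Yg_def)

lemma gp_qq: "n < nt S \<Longrightarrow> grid_periodic S (qq P \<eta> S n)" and gp_rr: "n < nt S \<Longrightarrow> grid_periodic S (rr P \<eta> S n)"
  unfolding qq_eq[abs_def] rr_eq[abs_def] by (intro gp_intros gp_Xg gp_Yg; simp)+

lemma FF_eq: "FF P \<eta> S n = mean_x (\<lambda>i j. h (n + 1) i j * u n i j - qq P \<eta> S n i j)"
  and GG_eq: "GG P \<eta> S n = mean_y (\<lambda>i j. h (n + 1) i j * v n i j - rr P \<eta> S n i j)"
  by (simp_all add: fun_eq_iff FF_def GG_def m_x_def m_y_def mean_x_def mean_y_def field_simps)

lemma gp_FF: "n < nt S \<Longrightarrow> grid_periodic S (FF P \<eta> S n)" and gp_GG: "n < nt S \<Longrightarrow> grid_periodic S (GG P \<eta> S n)"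
  unfolding FF_eq GG_eq by (intro gp_intros gp_huv gp_qq gp_rr; simp)+

lemma gp_upw_x: "n < nt S \<Longrightarrow> grid_periodic S (w n) \<Longrightarrow> grid_periodic S (upw_x P \<eta> S w n)"
  and gp_upw_y: "n < nt S \<Longrightarrow> grid_periodic S (w n) \<Longrightarrow> grid_periodic S (upw_y P \<eta> S w n)"
  unfolding upw_x_def[abs_def] upw_y_def[abs_def]
  by (intro gp_if gp_FF gp_GG gp_intros; simp)+

text \<open>
  The part of the dissipation that survives the worst case allowed by the stability conditions.
\<close>
definition kappa :: real where "kappa = (1 - \<zeta>) * (\<eta> - 3/2 * hhi)"

lemma kappa_pos: "kappa > 0" using zeta eta by (simp add: kappa_def)

definition energy :: "nat \<Rightarrow> grid" where
  "energy n i j = h n i j * ((u n i j)\<^sup>2 + (v n i j)\<^sup>2) / 2 + grav P * (h n i j)\<^sup>2 / 2 + grav P * h n i j * b i j"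

text \<open>
  This is where the second stability condition enters: the two explicit errors of the kinetic energy
  balance are dominated by a fraction of the dissipation \<open>\<eta>\<close> that the stabilising terms produce.
\<close>
lemma stability_coefficient:
  assumes n: "n < nt S"
  shows "3 * h (n + 1) i j / 2 + 3 * (cor P)\<^sup>2 * \<eta>\<^sup>2 * (dt S)\<^sup>2 / (2 * h (n + 1) i j) \<le> \<eta> - kappa"
proof -
  define h' where "h' = h (n + 1) i j"
  have h': "h' > 0" "h' \<le> hhi" using h_pos[of "n + 1"] h_bounds(2)[of "n + 1"] n by (auto simp: h'_def)
  have eta0: "\<eta> > 0" using eta hhi_pos by linarith
  have "3 * (cor P)\<^sup>2 * \<eta>\<^sup>2 * (dt S)\<^sup>2 / (2 * h') \<le> \<zeta> * (\<eta> - 3/2 * h')"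
  proof (cases "cor P = 0")
    case True
    have "0 \<le> \<zeta> * (\<eta> - 3/2 * h')" using zeta eta h' by (intro mult_nonneg_nonneg) auto
    then show ?thesis using True by simp
  next
    case False
    then have "(dt S)\<^sup>2 \<le> \<zeta> * (2 * h' / (3 * (cor P)\<^sup>2 * \<eta>\<^sup>2)) * (\<eta> - 3/2 * h')"
      using stab n unfolding energy_stability_conditions_def h'_def by auto
    also have "\<dots> = (2 * h' * (\<zeta> * (\<eta> - 3/2 * h'))) / (3 * (cor P)\<^sup>2 * \<eta>\<^sup>2)" by simp
    finally have "(dt S)\<^sup>2 * (3 * (cor P)\<^sup>2 * \<eta>\<^sup>2) \<le> 2 * h' * (\<zeta> * (\<eta> - 3/2 * h'))"
      using False eta0 by (subst (asm) pos_le_divide_eq) auto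
    then show ?thesis using h' by (subst pos_divide_le_eq) (auto simp: mult_ac)
  qed
  moreover have "(1 - \<zeta>) * (\<eta> - 3/2 * hhi) \<le> (1 - \<zeta>) * (\<eta> - 3/2 * h')"
    using zeta h' by (intro mult_left_mono) auto
  moreover have "(1 - \<zeta>) * (\<eta> - 3/2 * h') = \<eta> - 3/2 * h' - \<zeta> * (\<eta> - 3/2 * h')" by (simp only: left_diff_distrib mult_1)
  ultimately show ?thesis unfolding h'_def[symmetric] kappa_def by linarith
qed

lemma kinetic_energy_step:
  assumes n: "n < nt S"
  defines "TX \<equiv> (\<lambda>i j. FF P \<eta> S n i j * ((upw_x P \<eta> S (uu S) n i j)\<^sup>2 + (upw_x P \<eta> S (vv S) n i j)\<^sup>2))"
    and "TY \<equiv> (\<lambda>i j. GG P \<eta> S n i j * ((upw_y P \<eta> S (uu S) n i j)\<^sup>2 + (upw_y P \<eta> S (vv S) n i j)\<^sup>2))"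
  shows "h (n + 1) i j * ((u (n + 1) i j)\<^sup>2 + (v (n + 1) i j)\<^sup>2) / 2 - h n i j * ((u n i j)\<^sup>2 + (v n i j)\<^sup>2) / 2
    \<le> - dt S * ((TX i j - TX (i - 1) j) / (2 * dx S) + (TY i j - TY i (j - 1)) / (2 * dy S))
      - dt S * h (n + 1) i j * (u n i j * Xg n i j + v n i j * Yg n i j)
      - dt S * cor P * (u n i j * rr P \<eta> S n i j - v n i j * qq P \<eta> S n i j)
      + (dt S)\<^sup>2 * (\<eta> - kappa) * ((Xg n i j)\<^sup>2 + (Yg n i j)\<^sup>2)"
proof -
  define h' where "h' = h (n + 1) i j"
  have h': "h' > 0" using h_pos[of "n + 1"] n by (auto simp: h'_def)
  have mass: "(h' - h n i j) / dt S + (FF P \<eta> S n i j - FF P \<eta> S n (i - 1) j) / dx S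
     + (GG P \<eta> S n i j - GG P \<eta> S n i (j - 1)) / dy S = 0"
    using sol n by (auto simp: numerical_solution_def mass_equation_def h'_def)
  have cfl: "1 + 3 * dt S / h' *
       ((neg_part (FF P \<eta> S n i j) - pos_part (FF P \<eta> S n (i - 1) j)) / dx S
        + (neg_part (GG P \<eta> S n i j) - pos_part (GG P \<eta> S n i (j - 1))) / dy S) \<ge> 0"
    using stab n by (auto simp: energy_stability_conditions_def h'_def)
  have mu: "transport P \<eta> S (uu S) n i j = - h' * Xg n i j - cor P * rr P \<eta> S n i j"
    using sol n unfolding numerical_solution_def x_momentum_equation_def Xg_def h'_def by (simp add: algebra_simps)
  have mv: "transport P \<eta> S (vv S) n i j = - h' * Yg n i j - (- (cor P * qq P \<eta> S n i j))"
    using sol n unfolding numerical_solution_def y_momentum_equation_def Yg_def h'_def by (simp add: algebra_simps)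
  have ax: "i - 1 + 1 = i" "j - 1 + 1 = j" by auto
  note U = kinetic_energy_cell[OF h' dt_pos dx_pos dy_pos mass mu[unfolded transport_def upw_x_def upw_y_def ax, folded h'_def] cfl]
  note V = kinetic_energy_cell[OF h' dt_pos dx_pos dy_pos mass mv[unfolded transport_def upw_x_def upw_y_def ax, folded h'_def] cfl]
  have sq: "3 * (dt S)\<^sup>2 * h' * (Xg n i j)\<^sup>2 / 2 + 3 * (dt S)\<^sup>2 * (cor P * rr P \<eta> S n i j)\<^sup>2 / (2 * h')
      + (3 * (dt S)\<^sup>2 * h' * (Yg n i j)\<^sup>2 / 2 + 3 * (dt S)\<^sup>2 * (- (cor P * qq P \<eta> S n i j))\<^sup>2 / (2 * h'))
      \<le> (dt S)\<^sup>2 * (\<eta> - kappa) * ((Xg n i j)\<^sup>2 + (Yg n i j)\<^sup>2)"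
  proof -
    have "3 * (dt S)\<^sup>2 * h' * (Xg n i j)\<^sup>2 / 2 + 3 * (dt S)\<^sup>2 * (cor P * rr P \<eta> S n i j)\<^sup>2 / (2 * h')
      + (3 * (dt S)\<^sup>2 * h' * (Yg n i j)\<^sup>2 / 2 + 3 * (dt S)\<^sup>2 * (- (cor P * qq P \<eta> S n i j))\<^sup>2 / (2 * h'))
      = (3 * h' / 2 + 3 * (cor P)\<^sup>2 * \<eta>\<^sup>2 * (dt S)\<^sup>2 / (2 * h')) * ((dt S)\<^sup>2 * ((Xg n i j)\<^sup>2 + (Yg n i j)\<^sup>2))"
      unfolding qq_eq rr_eq using h' by (simp add: power2_eq_square field_simps)
    also have "\<dots> \<le> (\<eta> - kappa) * ((dt S)\<^sup>2 * ((Xg n i j)\<^sup>2 + (Yg n i j)\<^sup>2))"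
      using stability_coefficient[OF n] by (intro mult_right_mono) (auto simp: h'_def)
    finally show ?thesis by (simp add: mult_ac)
  qed
  have "- dt S * ((TX i j - TX (i - 1) j) / (2 * dx S) + (TY i j - TY i (j - 1)) / (2 * dy S))
    = - dt S * ((FF P \<eta> S n i j * (upw_x P \<eta> S (uu S) n i j)\<^sup>2 - FF P \<eta> S n (i - 1) j * (upw_x P \<eta> S (uu S) n (i - 1) j)\<^sup>2) / (2 * dx S)
        + (GG P \<eta> S n i j * (upw_y P \<eta> S (uu S) n i j)\<^sup>2 - GG P \<eta> S n i (j - 1) * (upw_y P \<eta> S (uu S) n i (j - 1))\<^sup>2) / (2 * dy S))
    + - dt S * ((FF P \<eta> S n i j * (upw_x P \<eta> S (vv S) n i j)\<^sup>2 - FF P \<eta> S n (i - 1) j * (upw_x P \<eta> S (vv S) n (i - 1) j)\<^sup>2) / (2 * dx S)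
        + (GG P \<eta> S n i j * (upw_y P \<eta> S (vv S) n i j)\<^sup>2 - GG P \<eta> S n i (j - 1) * (upw_y P \<eta> S (vv S) n i (j - 1))\<^sup>2) / (2 * dy S))"
    by (simp add: TX_def TY_def distrib_left diff_divide_distrib add_divide_distrib algebra_simps)
  moreover note U[folded upw_x_def upw_y_def] V[folded upw_x_def upw_y_def] sq
  ultimately show ?thesis
    unfolding upw_x_def upw_y_def ax h'_def[symmetric]
    by (simp add: algebra_simps add_divide_distrib)
qed

lemma GS_telescope_x: "grid_periodic S z \<Longrightarrow> GS (\<lambda>i j. (z i j - z (i - 1) j) / c) = 0"
  by (simp add: GS_linear GS_shift_x')

lemma GS_telescope_y: "grid_periodic S z \<Longrightarrow> GS (\<lambda>i j. (z i j - z i (j - 1)) / c) = 0"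
  by (simp add: GS_linear GS_shift_y')

text \<open>
  The change of potential energy is at most \<open>\<phi>\<close> at the new time level times the change of \<open>h\<close>, because
  the energy is convex in \<open>h\<close>. Inserting the mass equation and summing by parts gives the fluxes times
  the gradient of \<open>\<phi>\<close>. Together with the kinetic part, the advective contributions and the work of the
  Coriolis force cancel, and what remains of the stabilising terms is \<open>- \<eta> * dt * (Xg\<^sup>2 + Yg\<^sup>2)\<close>.
\<close>
lemma energy_step:
  assumes n: "n < nt S"
  shows "GS (energy (n + 1)) + kappa * ((dt S)\<^sup>2 * GS (\<lambda>i j. (Xg n i j)\<^sup>2 + (Yg n i j)\<^sup>2)) \<le> GS (energy n)"
proof -
  define TX where "TX = (\<lambda>i j. FF P \<eta> S n i j * ((upw_x P \<eta> S (uu S) n i j)\<^sup>2 + (upw_x P \<eta> S (vv S) n i j)\<^sup>2))"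
  define TY where "TY = (\<lambda>i j. GG P \<eta> S n i j * ((upw_y P \<eta> S (uu S) n i j)\<^sup>2 + (upw_y P \<eta> S (vv S) n i j)\<^sup>2))"
  define f where "f = phi P S (n + 1)"
  define ax where "ax = (\<lambda>i j. h (n + 1) i j * u n i j - qq P \<eta> S n i j)"
  define ay where "ay = (\<lambda>i j. h (n + 1) i j * v n i j - rr P \<eta> S n i j)"
  define W where "W = (\<lambda>i j. (Xg n i j)\<^sup>2 + (Yg n i j)\<^sup>2)"
  have gp: "grid_periodic S f" "grid_periodic S ax" "grid_periodic S ay" "grid_periodic S TX" "grid_periodic S TY"
    unfolding f_def ax_def ay_def TX_def TY_def using n
    by (intro gp_phi gp_intros gp_huv gp_qq gp_rr gp_FF gp_GG gp_upw_x gp_upw_y; simp)+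
  define DX where "DX = (\<lambda>i j. (mean_x ax i j - mean_x ax (i - 1) j) / dx S)"
  define DY where "DY = (\<lambda>i j. (mean_y ay i j - mean_y ay i (j - 1)) / dy S)"
  have pw: "energy (n + 1) i j - energy n i j \<le>
      - dt S * ((TX i j - TX (i - 1) j) / (2 * dx S) + (TY i j - TY i (j - 1)) / (2 * dy S))
      + (- dt S * (f i j * DX i j + f i j * DY i j)
      + (- dt S * (ax i j * eth_x S f i j + ay i j * eth_y S f i j)
      - kappa * ((dt S)\<^sup>2 * W i j)))" for i j
  proof -
    have "(h (n + 1) i j - h n i j) / dt S + DX i j + DY i j = 0"
      using sol n unfolding numerical_solution_def mass_equation_def FF_eq GG_eq DX_def DY_def ax_def ay_def by auto
    then have dh: "h (n + 1) i j - h n i j = - dt S * (DX i j + DY i j)"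
      using dt_pos by (simp add: field_simps)
    have "grav P * (h (n + 1) i j)\<^sup>2 / 2 + grav P * h (n + 1) i j * b i j - (grav P * (h n i j)\<^sup>2 / 2 + grav P * h n i j * b i j)
        = f i j * (h (n + 1) i j - h n i j) - grav P * (h (n + 1) i j - h n i j)\<^sup>2 / 2"
      by (simp add: f_def phi_def power2_eq_square field_simps)
    moreover have "0 \<le> grav P * (h (n + 1) i j - h n i j)\<^sup>2 / 2" using grav_pos by simp
    ultimately have pot: "grav P * (h (n + 1) i j)\<^sup>2 / 2 + grav P * h (n + 1) i j * b i j - (grav P * (h n i j)\<^sup>2 / 2 + grav P * h n i j * b i j)
        \<le> - dt S * (f i j * DX i j + f i j * DY i j)" unfolding dh by (simp add: algebra_simps)
    have e: "eth_x S f i j = Xg n i j + cor P * v n i j" "eth_y S f i j = Yg n i j - cor P * u n i j"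
      by (simp_all add: Xg_def Yg_def f_def)
    \<comment> \<open>The Coriolis terms cancel here: they do no work, including their stabilising parts.\<close>
    have alg: "- dt S * h (n + 1) i j * (u n i j * Xg n i j + v n i j * Yg n i j)
      - dt S * cor P * (u n i j * rr P \<eta> S n i j - v n i j * qq P \<eta> S n i j)
      + (dt S)\<^sup>2 * (\<eta> - kappa) * W i j
      = - dt S * (ax i j * eth_x S f i j + ay i j * eth_y S f i j) - kappa * ((dt S)\<^sup>2 * W i j)"
      unfolding e ax_def ay_def qq_eq rr_eq W_def by (simp add: power2_eq_square algebra_simps)
    show ?thesis
      using kinetic_energy_step[OF n, of i j] pot alg
      unfolding energy_def W_def TX_def TY_def by linarith
  qed
  have "GS (\<lambda>i j. energy (n + 1) i j - energy n i j) \<le>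
     GS (\<lambda>i j. - dt S * ((TX i j - TX (i - 1) j) / (2 * dx S) + (TY i j - TY i (j - 1)) / (2 * dy S))
      + (- dt S * (f i j * DX i j + f i j * DY i j)
      + (- dt S * (ax i j * eth_x S f i j + ay i j * eth_y S f i j)
      - kappa * ((dt S)\<^sup>2 * W i j))))"
    by (intro GS_mono pw)
  also have "\<dots> = - dt S * (GS (\<lambda>i j. (TX i j - TX (i - 1) j) / (2 * dx S)) + GS (\<lambda>i j. (TY i j - TY i (j - 1)) / (2 * dy S)))
     + (- dt S * (GS (\<lambda>i j. f i j * DX i j) + GS (\<lambda>i j. f i j * DY i j))
     + (- dt S * (GS (\<lambda>i j. ax i j * eth_x S f i j) + GS (\<lambda>i j. ay i j * eth_y S f i j))
     - kappa * ((dt S)\<^sup>2 * GS W)))"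
    by (simp only: GS_add GS_diff GS_cmult)
  also have "\<dots> = - kappa * ((dt S)\<^sup>2 * GS W)"
    unfolding GS_telescope_x[OF gp(4)] GS_telescope_y[OF gp(5)] DX_def DY_def
      GS_summation_by_parts_x[OF gp(2,1)] GS_summation_by_parts_y[OF gp(3,1)]
    by (simp add: algebra_simps)
  finally show ?thesis by (simp add: GS_diff W_def)
qed

text \<open>
  A bound for the initial energy plus the amount by which the topography can make the energy negative.
\<close>
definition E0 :: real where
  "E0 = (hhi * (Bu\<^sup>2 + Bv\<^sup>2) / 2 + grav P * hhi\<^sup>2 / 2 + 2 * (grav P * hhi * Bb)) * (Lx P * Ly P)"

lemma b_bound: "\<bar>b i j\<bar> \<le> Bb"
  by (rule cell_average_bound[OF Linf_bot Bb])

lemma energy_lower: "n \<le> nt S \<Longrightarrow> hlo / 2 * ((u n i j)\<^sup>2 + (v n i j)\<^sup>2) - grav P * hhi * Bb \<le> energy n i j"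
proof -
  assume n: "n \<le> nt S"
  have "hlo * ((u n i j)\<^sup>2 + (v n i j)\<^sup>2) \<le> h n i j * ((u n i j)\<^sup>2 + (v n i j)\<^sup>2)"
    using h_bounds(1)[OF n] by (intro mult_right_mono) auto
  moreover have "\<bar>grav P * h n i j * b i j\<bar> \<le> grav P * hhi * Bb"
    unfolding abs_mult using h_bounds(2)[OF n, of i j] h_pos[OF n, of i j] b_bound[of i j] grav_pos
    by (intro mult_mono) auto
  moreover have "0 \<le> grav P * (h n i j)\<^sup>2 / 2" using grav_pos by simp
  ultimately show ?thesis unfolding energy_def by (simp add: abs_le_iff)
qed

lemma energy_initial: "energy 0 i j \<le> hhi * (Bu\<^sup>2 + Bv\<^sup>2) / 2 + grav P * hhi\<^sup>2 / 2 + grav P * hhi * Bb"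
proof -
  have "u 0 i j = cell_average S (u_init P) i j" "v 0 i j = cell_average S (v_init P) i j"
    using sol by (auto simp: numerical_solution_def)
  then have "\<bar>u 0 i j\<bar> \<le> Bu" "\<bar>v 0 i j\<bar> \<le> Bv"
    using cell_average_bound[OF Linf_u_init Bu] cell_average_bound[OF Linf_v_init Bv] by auto
  then have "(u 0 i j)\<^sup>2 \<le> Bu\<^sup>2" "(v 0 i j)\<^sup>2 \<le> Bv\<^sup>2"
    by (metis abs_ge_zero power2_abs power_mono)+
  then have "h 0 i j * ((u 0 i j)\<^sup>2 + (v 0 i j)\<^sup>2) \<le> hhi * (Bu\<^sup>2 + Bv\<^sup>2)"
    using h_bounds(2)[of 0 i j] h_pos[of 0 i j] by (intro mult_mono add_mono) auto
  moreover have "\<bar>grav P * h 0 i j * b i j\<bar> \<le> grav P * hhi * Bb"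
    unfolding abs_mult using h_bounds(2)[of 0 i j] h_pos[of 0 i j] b_bound[of i j] grav_pos
    by (intro mult_mono) auto
  moreover have "grav P * (h 0 i j)\<^sup>2 \<le> grav P * hhi\<^sup>2"
    using h_bounds(2)[of 0 i j] h_pos[of 0 i j] grav_pos by (intro mult_left_mono power_mono) auto
  ultimately show ?thesis unfolding energy_def by (simp add: abs_le_iff)
qed

lemma energy_estimate:
  assumes "n \<le> nt S"
  shows "hlo / 2 * GS (\<lambda>i j. (u n i j)\<^sup>2 + (v n i j)\<^sup>2)
    + kappa * (\<Sum>k<n. (dt S)\<^sup>2 * GS (\<lambda>i j. (Xg k i j)\<^sup>2 + (Yg k i j)\<^sup>2)) \<le> E0"
proof -
  have "GS (energy n) + kappa * (\<Sum>k<n. (dt S)\<^sup>2 * GS (\<lambda>i j. (Xg k i j)\<^sup>2 + (Yg k i j)\<^sup>2)) \<le> GS (energy 0)"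
    using assms
  proof (induction n)
    case (Suc n)
    then show ?case using energy_step[of n] by (simp add: distrib_left)
  qed simp
  also have "\<dots> \<le> GS (\<lambda>i j. hhi * (Bu\<^sup>2 + Bv\<^sup>2) / 2 + grav P * hhi\<^sup>2 / 2 + grav P * hhi * Bb)"
    by (intro GS_mono energy_initial)
  also have "\<dots> = E0 - grav P * hhi * Bb * (Lx P * Ly P)"
    unfolding GS_const E0_def by (simp add: algebra_simps)
  finally have "GS (energy n) + kappa * (\<Sum>k<n. (dt S)\<^sup>2 * GS (\<lambda>i j. (Xg k i j)\<^sup>2 + (Yg k i j)\<^sup>2))
    \<le> E0 - grav P * hhi * Bb * (Lx P * Ly P)" .
  moreover have "GS (\<lambda>i j. hlo / 2 * ((u n i j)\<^sup>2 + (v n i j)\<^sup>2) - grav P * hhi * Bb) \<le> GS (energy n)"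
    by (intro GS_mono energy_lower assms)
  ultimately show ?thesis by (simp only: GS_diff GS_cmult GS_const)
qed

end

section \<open>Space-time sums against a fixed test function\<close>

lemma abs_midpoint_diff_le:
  fixes a b c k :: real
  assumes "\<bar>a - c\<bar> \<le> k" "\<bar>b - c\<bar> \<le> k"
  shows "\<bar>(a + b) / 2 - c\<bar> \<le> k"
  using assms unfolding abs_le_iff by (intro conjI) (simp_all add: field_simps)

context sw_scheme
begin

text \<open>
  The two a priori bounds that come out of the energy estimate: \<open>CU\<close> for the velocities, uniformly in
  time, and \<open>CD\<close> for the accumulated geostrophic residuals.
\<close>
definition CU :: real where "CU = 2 * E0 / hlo"
definition CD :: real where "CD = E0 / kappa"

abbreviation area :: real where "area \<equiv> Lx P * Ly P"

lemma dissipation_sum_nonneg: "0 \<le> (\<Sum>k<n. (dt S)\<^sup>2 * GS (\<lambda>i j. (Xg k i j)\<^sup>2 + (Yg k i j)\<^sup>2))"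
  by (intro sum_nonneg mult_nonneg_nonneg GS_nonneg) auto

lemma velocity_bound: "n \<le> nt S \<Longrightarrow> GS (\<lambda>i j. (u n i j)\<^sup>2 + (v n i j)\<^sup>2) \<le> CU"
proof -
  assume "n \<le> nt S"
  then have "hlo / 2 * GS (\<lambda>i j. (u n i j)\<^sup>2 + (v n i j)\<^sup>2) \<le> E0"
    using energy_estimate[of n] mult_nonneg_nonneg[OF less_imp_le[OF kappa_pos] dissipation_sum_nonneg[of n]] by linarith
  then show ?thesis using hlo_pos by (simp add: CU_def field_simps)
qed

lemma u_bound: "n \<le> nt S \<Longrightarrow> GS (\<lambda>i j. (u n i j)\<^sup>2) \<le> CU" and v_bound: "n \<le> nt S \<Longrightarrow> GS (\<lambda>i j. (v n i j)\<^sup>2) \<le> CU"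
  using velocity_bound[of n] GS_mono[of "\<lambda>i j. (u n i j)\<^sup>2" "\<lambda>i j. (u n i j)\<^sup>2 + (v n i j)\<^sup>2"]
    GS_mono[of "\<lambda>i j. (v n i j)\<^sup>2" "\<lambda>i j. (u n i j)\<^sup>2 + (v n i j)\<^sup>2"] by auto

lemma CU_nonneg: "0 \<le> CU" using u_bound[of 0] GS_nonneg[of "\<lambda>i j. (u 0 i j)\<^sup>2"] by simp

lemma dissipation_bound: "(\<Sum>k<nt S. (dt S)\<^sup>2 * GS (\<lambda>i j. (Xg k i j)\<^sup>2 + (Yg k i j)\<^sup>2)) \<le> CD"
proof -
  have "0 \<le> hlo / 2 * GS (\<lambda>i j. (u (nt S) i j)\<^sup>2 + (v (nt S) i j)\<^sup>2)"
    using hlo_pos by (intro mult_nonneg_nonneg GS_nonneg) auto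
  then have "kappa * (\<Sum>k<nt S. (dt S)\<^sup>2 * GS (\<lambda>i j. (Xg k i j)\<^sup>2 + (Yg k i j)\<^sup>2)) \<le> E0"
    using energy_estimate[of "nt S"] by linarith
  then show ?thesis using kappa_pos by (simp add: CD_def field_simps)
qed

lemma stabilisation_sum:
  shows "(\<Sum>k<nt S. GS (\<lambda>i j. (qq P \<eta> S k i j)\<^sup>2)) \<le> \<eta>\<^sup>2 * CD"
    and "(\<Sum>k<nt S. GS (\<lambda>i j. (rr P \<eta> S k i j)\<^sup>2)) \<le> \<eta>\<^sup>2 * CD"
proof -
  have *: "(\<Sum>k<nt S. GS (Z k)) \<le> \<eta>\<^sup>2 * CD"
    if "\<And>k i j. Z k i j \<le> \<eta>\<^sup>2 * ((dt S)\<^sup>2 * ((Xg k i j)\<^sup>2 + (Yg k i j)\<^sup>2))" for Z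
  proof -
    have "(\<Sum>k<nt S. GS (Z k)) \<le> (\<Sum>k<nt S. GS (\<lambda>i j. \<eta>\<^sup>2 * ((dt S)\<^sup>2 * ((Xg k i j)\<^sup>2 + (Yg k i j)\<^sup>2))))"
      by (intro sum_mono GS_mono that)
    also have "\<dots> = \<eta>\<^sup>2 * (\<Sum>k<nt S. (dt S)\<^sup>2 * GS (\<lambda>i j. (Xg k i j)\<^sup>2 + (Yg k i j)\<^sup>2))"
      by (simp only: GS_cmult sum_distrib_left)
    also have "\<dots> \<le> \<eta>\<^sup>2 * CD" by (intro mult_left_mono dissipation_bound) simp
    finally show ?thesis .
  qed
  show "(\<Sum>k<nt S. GS (\<lambda>i j. (qq P \<eta> S k i j)\<^sup>2)) \<le> \<eta>\<^sup>2 * CD"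
    by (rule *) (simp add: qq_eq power_mult_distrib algebra_simps)
  show "(\<Sum>k<nt S. GS (\<lambda>i j. (rr P \<eta> S k i j)\<^sup>2)) \<le> \<eta>\<^sup>2 * CD"
    by (rule *) (simp add: rr_eq power_mult_distrib algebra_simps)
qed

lemma CD_nonneg: "0 \<le> CD"
  using dissipation_bound dissipation_sum_nonneg[of "nt S"] by linarith

lemma time_Suc: "time S (Suc n) = time S n + dt S"
  by (simp add: time_def algebra_simps)

lemma time_range: "n \<le> nt S \<Longrightarrow> time S n \<in> {0..Tend P}"
proof -
  assume "n \<le> nt S"
  then have "real n * dt S \<le> real (nt S) * dt S" using dt_pos by (intro mult_right_mono) auto
  then show ?thesis using nt_dt dt_pos by (simp add: time_def)
qed

lemma step_subset: "n < nt S \<Longrightarrow> {time S n..time S (n + 1)} \<subseteq> {0..Tend P}"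
  using time_range[of n] time_range[of "n + 1"] by auto

text \<open>
  Integrability of a summand of a space-time sum, in the form which makes the sum additive.
\<close>
definition st_ok :: "(nat \<Rightarrow> real \<Rightarrow> real \<times> real \<Rightarrow> real) \<Rightarrow> bool" where
  "st_ok f \<longleftrightarrow> (\<forall>n<nt S. (\<forall>t\<in>{time S n..time S (n + 1)}. TIable (f n t)) \<and>
     set_integrable lborel {time S n..time S (n + 1)} (\<lambda>t. TI (f n t)))"

lemma st_add:
  assumes "st_ok f" "st_ok g"
  shows "st_ok (\<lambda>n t z. f n t z + g n t z)"
    and "spacetime_sum P S (\<lambda>n t z. f n t z + g n t z) = spacetime_sum P S f + spacetime_sum P S g"
proof -
  have *: "TI (\<lambda>z. f n t z + g n t z) = TI (f n t) + TI (g n t)"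
    if "n < nt S" "t \<in> {time S n..time S (n + 1)}" for n t
    using that assms unfolding st_ok_def by (intro set_integral_add) auto
  have i: "set_integrable lborel {time S n..time S (n + 1)} (\<lambda>t. TI (f n t) + TI (g n t))" if "n < nt S" for n
    using that assms unfolding st_ok_def by (intro set_integral_add) auto
  have "set_integrable lborel {time S n..time S (n + 1)} (\<lambda>t. TI (\<lambda>z. f n t z + g n t z))" if "n < nt S" for n
    using i[OF that] * that by (subst set_integrable_cong[OF refl refl, where f' = "\<lambda>t. TI (f n t) + TI (g n t)"]) auto
  then show "st_ok (\<lambda>n t z. f n t z + g n t z)"
    using assms unfolding st_ok_def by (auto intro: set_integral_add)
  have "(LINT t:{time S n..time S (n + 1)}|lborel. TI (\<lambda>z. f n t z + g n t z))
     = (LINT t:{time S n..time S (n + 1)}|lborel. TI (f n t)) + (LINT t:{time S n..time S (n + 1)}|lborel. TI (g n t))"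
    if "n < nt S" for n
  proof -
    have "(LINT t:{time S n..time S (n + 1)}|lborel. TI (\<lambda>z. f n t z + g n t z))
      = (LINT t:{time S n..time S (n + 1)}|lborel. TI (f n t) + TI (g n t))"
      using * that by (intro set_lebesgue_integral_cong) auto
    also have "\<dots> = (LINT t:{time S n..time S (n + 1)}|lborel. TI (f n t)) + (LINT t:{time S n..time S (n + 1)}|lborel. TI (g n t))"
      using that assms unfolding st_ok_def by (intro set_integral_add) auto
    finally show ?thesis .
  qed
  then show "spacetime_sum P S (\<lambda>n t z. f n t z + g n t z) = spacetime_sum P S f + spacetime_sum P S g"
    unfolding spacetime_sum_def by (simp add: sum.distrib)
qed

lemma st_cmult:
  assumes "st_ok f"
  shows "st_ok (\<lambda>n t z. c * f n t z)"
    and "spacetime_sum P S (\<lambda>n t z. c * f n t z) = c * spacetime_sum P S f"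
proof -
  show "st_ok (\<lambda>n t z. c * f n t z)"
    using assms unfolding st_ok_def by (simp add: set_integrable_mult_right)
  show "spacetime_sum P S (\<lambda>n t z. c * f n t z) = c * spacetime_sum P S f"
    unfolding spacetime_sum_def by (simp add: sum_distrib_left)
qed

lemma st_diff:
  assumes "st_ok f" "st_ok g"
  shows "st_ok (\<lambda>n t z. f n t z - g n t z)"
    and "spacetime_sum P S (\<lambda>n t z. f n t z - g n t z) = spacetime_sum P S f - spacetime_sum P S g"
  using st_add[OF assms(1) st_cmult(1)[OF assms(2), of "-1"]] st_cmult(2)[OF assms(2), of "-1"] by simp_all

text \<open>
  A space-time sum is compared with a Riemann sum over the time levels; the reference value \<open>R\<close> is constant
  on each step because the scheme uses the test function at the new time level only.
\<close>
lemma st_bound: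
  assumes f: "st_ok f"
    and b: "\<And>n t. n < nt S \<Longrightarrow> t \<in> {time S n..time S (n + 1)} \<Longrightarrow> \<bar>TI (f n t) - R n\<bar> \<le> e n"
  shows "\<bar>spacetime_sum P S f - (\<Sum>n<nt S. dt S * R n)\<bar> \<le> (\<Sum>n<nt S. dt S * e n)"
proof -
  have "\<bar>(LINT t:{time S n..time S (n + 1)}|lborel. TI (f n t)) - dt S * R n\<bar> \<le> dt S * e n" if n: "n < nt S" for n
  proof -
    let ?I = "{time S n..time S (n + 1)}"
    have c: "(LINT t:?I|lborel. k) = dt S * k" "set_integrable lborel ?I (\<lambda>t. k)" for k :: real
      using dt_pos by (auto simp: set_lebesgue_integral_def set_integrable_def time_Suc)
    have i: "set_integrable lborel ?I (\<lambda>t. TI (f n t))" using f n by (auto simp: st_ok_def)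
    have "(LINT t:?I|lborel. TI (f n t)) \<le> (LINT t:?I|lborel. R n + e n)"
      "(LINT t:?I|lborel. R n - e n) \<le> (LINT t:?I|lborel. TI (f n t))"
      using b[OF n] by (intro set_integral_mono i c; force simp: abs_le_iff)+
    then show ?thesis unfolding c by (simp add: abs_le_iff algebra_simps)
  qed
  then have "(\<Sum>n<nt S. \<bar>(LINT t:{time S n..time S (n + 1)}|lborel. TI (f n t)) - dt S * R n\<bar>) \<le> (\<Sum>n<nt S. dt S * e n)"
    by (intro sum_mono) auto
  moreover have "\<bar>spacetime_sum P S f - (\<Sum>n<nt S. dt S * R n)\<bar>
      \<le> (\<Sum>n<nt S. \<bar>(LINT t:{time S n..time S (n + 1)}|lborel. TI (f n t)) - dt S * R n\<bar>)"
    unfolding spacetime_sum_def sum_subtractf[symmetric] by (rule sum_abs)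
  ultimately show ?thesis by linarith
qed

end

locale sw_test = sw_scheme +
  fixes \<psi> :: "real \<times> real \<times> real \<Rightarrow> real" and K :: real
  assumes test: "test_function P \<psi>" and K_nonneg: "0 \<le> K"
    and tame_psi: "tame (Tend P) K \<psi>" and tame_t: "tame (Tend P) K (dt_test \<psi>)"
    and tame_x: "tame (Tend P) K (dx_test \<psi>)" and tame_y: "tame (Tend P) K (dy_test \<psi>)"
begin

text \<open>
  The properties shared by the test function and its first derivatives.
\<close>
definition good :: "(real \<times> real \<times> real \<Rightarrow> real) \<Rightarrow> bool" where
  "good D \<longleftrightarrow> smooth D \<and> (\<forall>t. doubly_periodic (Lx P) (Ly P) (\<lambda>z. D (t, z))) \<and> tame (Tend P) K D"

lemma smooth_psi: "smooth \<psi>" and periodic_psi: "doubly_periodic (Lx P) (Ly P) (\<lambda>z. \<psi> (t, z))"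
  using test by (auto simp: test_function_def)

lemma psi_end: "\<psi> (Tend P, z) = 0"
  using test unfolding test_function_def by (meson less_imp_le)

lemma good_psi: "good \<psi>" and good_t: "good (dt_test \<psi>)" and good_x: "good (dx_test \<psi>)" and good_y: "good (dy_test \<psi>)"
  unfolding good_def
  by (intro conjI allI smooth_psi smooth_pdiff spatially_periodic_pdiff periodic_psi tame_psi tame_t tame_x tame_y)+

lemma good_measurable:
  assumes "good D" shows "(\<lambda>z. D (t, z)) \<in> borel_measurable borel"
proof (rule borel_measurable_continuous_onI)
  have "continuous_on UNIV (\<lambda>z :: real \<times> real. (t, z))" by (intro continuous_intros)
  then show "continuous_on UNIV (\<lambda>z. D (t, z))"
    using assms smooth_continuous[of D] unfolding good_def by (auto intro: continuous_on_compose2)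
qed

lemma good_bound: "good D \<Longrightarrow> t \<in> {0..Tend P} \<Longrightarrow> \<bar>D (t, z)\<bar> \<le> K"
  unfolding good_def tame_def by blast

lemma good_lipschitz:
  "good D \<Longrightarrow> t \<in> {0..Tend P} \<Longrightarrow> t' \<in> {0..Tend P} \<Longrightarrow> \<bar>D (t, z) - D (t', z')\<bar> \<le> K * (\<bar>t - t'\<bar> + norm (z - z'))"
  unfolding good_def tame_def by blast

lemma good_Linf:
  assumes "good D" "t \<in> {0..Tend P}" shows "Linf (\<lambda>z. D (t, z))"
  unfolding Linf_torus_def using good_measurable[OF assms(1)] good_bound[OF assms] assms(1)
  by (auto simp: good_def intro!: exI[of _ K])

lemma good_TIable: "TIable a \<Longrightarrow> good D \<Longrightarrow> t \<in> {0..Tend P} \<Longrightarrow> TIable (\<lambda>z. a z * D (t, z))"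
  by (rule tintegrable_mult_bounded[OF _ good_measurable good_bound])

lemma good_TI_diff:
  assumes "TIable a" "good D" "t \<in> {0..Tend P}" "t' \<in> {0..Tend P}"
  shows "\<bar>TI (\<lambda>z. a z * D (t, z)) - TI (\<lambda>z. a z * D (t', z))\<bar> \<le> K * \<bar>t - t'\<bar> * TI (\<lambda>z. \<bar>a z\<bar>)"
proof -
  have "TI (\<lambda>z. a z * D (t, z)) - TI (\<lambda>z. a z * D (t', z)) = TI (\<lambda>z. a z * (D (t, z) - D (t', z)))"
    unfolding right_diff_distrib by (intro set_integral_diff(2)[symmetric] good_TIable assms)
  also have "\<bar>\<dots>\<bar> \<le> (K * \<bar>t - t'\<bar>) * TI (\<lambda>z. \<bar>a z\<bar>)"
  proof (rule tint_mult_bound[OF assms(1)])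
    show "(\<lambda>z. D (t, z) - D (t', z)) \<in> borel_measurable borel" using good_measurable[OF assms(2)] by auto
    show "\<bar>D (t, z) - D (t', z)\<bar> \<le> K * \<bar>t - t'\<bar>" for z
      using good_lipschitz[OF assms(2-4), of z z] by simp
  qed
  finally show ?thesis .
qed

lemma good_TI_continuous:
  assumes "TIable a" "good D"
  shows "continuous_on {0..Tend P} (\<lambda>t. TI (\<lambda>z. a z * D (t, z)))"
proof (rule lipschitz_on_continuous_on, rule lipschitz_onI)
  show "0 \<le> K * TI (\<lambda>z. \<bar>a z\<bar>)" using K_nonneg by (intro mult_nonneg_nonneg tint_nonneg) auto
  show "dist (TI (\<lambda>z. a z * D (t, z))) (TI (\<lambda>z. a z * D (t', z))) \<le> K * TI (\<lambda>z. \<bar>a z\<bar>) * dist t t'"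
    if "t \<in> {0..Tend P}" "t' \<in> {0..Tend P}" for t t'
    using good_TI_diff[OF assms that] by (simp add: dist_real_def mult_ac)
qed

lemma st_basic:
  assumes "\<And>n. n < nt S \<Longrightarrow> TIable (a n)" "good D"
  shows "st_ok (\<lambda>n t z. a n z * D (t, z))"
  unfolding st_ok_def
proof (intro allI impI conjI ballI)
  fix n assume n: "n < nt S"
  show "TIable (\<lambda>z. a n z * D (t, z))" if "t \<in> {time S n..time S (n + 1)}" for t
    using good_TIable[OF assms(1)[OF n] assms(2)] step_subset[OF n] that by blast
  show "set_integrable lborel {time S n..time S (n + 1)} (\<lambda>t. TI (\<lambda>z. a n z * D (t, z)))"
    by (rule borel_integrable_atLeastAtMost')
       (rule continuous_on_subset[OF good_TI_continuous[OF assms(1)[OF n] assms(2)] step_subset[OF n]])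
qed

lemma TI_time_derivative:
  assumes "TIable a" "t \<in> {0..Tend P}"
  shows "((\<lambda>t. TI (\<lambda>z. a z * \<psi> (t, z))) has_real_derivative TI (\<lambda>z. a z * dt_test \<psi> (t, z))) (at t within {0..Tend P})"
proof (rule tint_has_derivative[OF assms])
  show "\<bar>\<psi> (s, z) - \<psi> (t, z) - (s - t) * dt_test \<psi> (t, z)\<bar> \<le> K * (s - t)\<^sup>2" if "s \<in> {0..Tend P}" for s z
  proof (rule quadratic_remainder[where S = "{0..Tend P}" and \<phi> = "\<lambda>s. \<psi> (s, z)" and \<phi>' = "\<lambda>s. dt_test \<psi> (s, z)", OF _ assms(2) that])
    fix r assume r: "r \<in> {0..Tend P}"
    have "((\<lambda>s. \<psi> ((0, z) + s *\<^sub>R (1, 0, 0))) has_real_derivative dt_test \<psi> ((0, z) + r *\<^sub>R (1, 0, 0))) (at r)"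
      by (rule has_real_derivative_along_line[OF smooth_psi])
    then show "((\<lambda>s. \<psi> (s, z)) has_real_derivative dt_test \<psi> (r, z)) (at r within {0..Tend P})"
      by (cases z) (auto simp: zero_prod_def intro: has_field_derivative_at_within)
    show "\<bar>dt_test \<psi> (r, z) - dt_test \<psi> (t, z)\<bar> \<le> K * \<bar>r - t\<bar>"
      using good_lipschitz[OF good_t r assms(2), of z z] by simp
  qed (auto simp: K_nonneg)
qed (use good_measurable[OF good_psi] good_measurable[OF good_t] good_bound[OF good_psi] good_bound[OF good_t] assms in \<open>assumption | blast\<close>)+

text \<open>
  The terms with the time derivative are exact: the piecewise constant factor does not depend on time
  within a step, so the fundamental theorem of calculus applies.
\<close>
lemma st_time:
  assumes "\<And>n. n < nt S \<Longrightarrow> TIable (a n)"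
  shows "spacetime_sum P S (\<lambda>n t z. a n z * dt_test \<psi> (t, z))
    = (\<Sum>n<nt S. TI (\<lambda>z. a n z * \<psi> (time S (n + 1), z)) - TI (\<lambda>z. a n z * \<psi> (time S n, z)))"
  unfolding spacetime_sum_def
proof (intro sum.cong refl)
  fix n assume "n \<in> {..<nt S}"
  then have n: "n < nt S" by simp
  have "(LINT t|lborel. indicator {time S n..time S (n + 1)} t *\<^sub>R TI (\<lambda>z. a n z * dt_test \<psi> (t, z)))
    = TI (\<lambda>z. a n z * \<psi> (time S (n + 1), z)) - TI (\<lambda>z. a n z * \<psi> (time S n, z))"
  proof (rule integral_FTC_Icc)
    show "time S n \<le> time S (n + 1)" using dt_pos by (simp add: time_Suc)
    show "((\<lambda>t. TI (\<lambda>z. a n z * \<psi> (t, z))) has_vector_derivative TI (\<lambda>z. a n z * dt_test \<psi> (t, z))) (at t within {time S n..time S (n + 1)})"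
      if "time S n \<le> t" "t \<le> time S (n + 1)" for t
      using DERIV_subset[OF TI_time_derivative[OF assms[OF n]] step_subset[OF n]] that step_subset[OF n]
      by (auto simp: has_real_derivative_iff_has_vector_derivative)
    show "continuous_on {time S n..time S (n + 1)} (\<lambda>t. TI (\<lambda>z. a n z * dt_test \<psi> (t, z)))"
      by (rule continuous_on_subset[OF good_TI_continuous[OF assms[OF n] good_t] step_subset[OF n]])
  qed
  then show "(LINT t:{time S n..time S (n + 1)}|lborel. TI (\<lambda>z. a n z * dt_test \<psi> (t, z)))
    = TI (\<lambda>z. a n z * \<psi> (time S (n + 1), z)) - TI (\<lambda>z. a n z * \<psi> (time S n, z))"
    by (simp add: set_lebesgue_integral_def)
qed

text \<open>
  A discrete divergence tested with \<open>\<psi>\<close> at time \<open>t1\<close> becomes, after a translation, minus the flux \<open>f\<close> times a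
  difference quotient of \<open>\<psi>\<close>. It is compared with a flux \<open>g\<close> placed on the dual cells and paired with the
  derivative of \<open>\<psi>\<close> at time \<open>t\<close>. The direction is a unit vector \<open>e\<close> and the step is \<open>s\<close>, so both
  coordinates are covered, as are mass, momentum and pressure fluxes.
\<close>
lemma flux_consistency:
  assumes e: "norm e = 1" "good (pdiff (0, e) \<psi>)" and s: "s > 0"
    and f: "Linf f" and g: "Linf g" and t: "t \<in> {0..Tend P}" "t1 \<in> {0..Tend P}"
  shows "\<bar>TI (\<lambda>z. (f z - f (z - s *\<^sub>R e)) / s * \<psi> (t1, z)) + TI (\<lambda>z. g (z - (s / 2) *\<^sub>R e) * pdiff (0, e) \<psi> (t, z))\<bar>
    \<le> K * (TI (\<lambda>z. \<bar>f z - g z\<bar>) + TI (\<lambda>z. \<bar>g z\<bar>) * (\<bar>t1 - t\<bar> + 2 * s))"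
proof -
  let ?D = "pdiff (0, e) \<psi>"
  define Q where "Q z = (\<psi> (t1, z + s *\<^sub>R e) - \<psi> (t1, z)) / s" for z
  note Lp = good_Linf[OF good_psi t(2)] and LD = good_Linf[OF e(2) t(1)]
  have LQ: "Linf Q" unfolding Q_def[abs_def] by (intro Linf_divide Linf_diff Lp Linf_translate[OF Lp])
  have Qb: "\<bar>Q z\<bar> \<le> K" for z
  proof -
    obtain \<xi> where \<xi>: "\<psi> ((t1, z) + s *\<^sub>R (0, e)) - \<psi> (t1, z) = s * ?D ((t1, z) + \<xi> *\<^sub>R (0, e))"
      using pdiff_mvt[OF smooth_psi s] by metis
    then have "Q z = ?D (t1, z + \<xi> *\<^sub>R e)" using s by (simp add: Q_def)
    then show ?thesis using good_bound[OF e(2) t(2)] by simp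
  qed
  have QD: "\<bar>?D (t, z + (s / 2) *\<^sub>R e) - Q z\<bar> \<le> K * (\<bar>t1 - t\<bar> + 2 * s)" for z
  proof -
    have "\<bar>Q z - ?D (t, z + (s / 2) *\<^sub>R e)\<bar> \<le> K * (\<bar>t1 - t\<bar> + s + norm (z - (z + (s / 2) *\<^sub>R e)))"
      unfolding Q_def using e(2)
      by (intro tame_difference_quotient[OF smooth_psi _ e(1) K_nonneg s t(2,1)]) (simp add: good_def)
    also have "\<dots> \<le> K * (\<bar>t1 - t\<bar> + 2 * s)" using K_nonneg s e(1) by (intro mult_left_mono) auto
    finally show ?thesis by (simp add: abs_minus_commute)
  qed
  have "TI (\<lambda>z. f (z - s *\<^sub>R e) * \<psi> (t1, z)) = TI (\<lambda>z. f z * \<psi> (t1, z + s *\<^sub>R e))"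
    using tint_translate[OF Lx_pos Ly_pos, of "\<lambda>z. f z * \<psi> (t1, z + s *\<^sub>R e)" "- (s *\<^sub>R e)"]
    by (simp add: Linf_mult f Linf_translate[OF Lp])
  moreover have "TI (\<lambda>z. (f z - f (z - s *\<^sub>R e)) / s * \<psi> (t1, z)) = (TI (\<lambda>z. f z * \<psi> (t1, z)) - TI (\<lambda>z. f (z - s *\<^sub>R e) * \<psi> (t1, z))) / s"
  proof -
    have "TI (\<lambda>z. f z * \<psi> (t1, z)) - TI (\<lambda>z. f (z - s *\<^sub>R e) * \<psi> (t1, z)) = TI (\<lambda>z. f z * \<psi> (t1, z) - f (z - s *\<^sub>R e) * \<psi> (t1, z))"
      by (intro set_integral_diff(2)[symmetric] Linf_tintegrable Linf_mult f Lp Linf_translate_minus)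
    moreover have "TI (\<lambda>z. (f z - f (z - s *\<^sub>R e)) / s * \<psi> (t1, z))
        = TI (\<lambda>z. (f z * \<psi> (t1, z) - f (z - s *\<^sub>R e) * \<psi> (t1, z)) / s)"
      by (simp only: times_divide_eq_left left_diff_distrib)
    ultimately show ?thesis by (simp only: set_integral_divide_zero)
  qed
  moreover have "(TI (\<lambda>z. f z * \<psi> (t1, z)) - TI (\<lambda>z. f z * \<psi> (t1, z + s *\<^sub>R e))) / s = - TI (\<lambda>z. f z * Q z)"
  proof -
    have "TI (\<lambda>z. f z * \<psi> (t1, z)) - TI (\<lambda>z. f z * \<psi> (t1, z + s *\<^sub>R e)) = TI (\<lambda>z. f z * \<psi> (t1, z) - f z * \<psi> (t1, z + s *\<^sub>R e))"
      by (intro set_integral_diff(2)[symmetric] Linf_tintegrable Linf_mult f Lp Linf_translate[OF Lp])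
    also have "(\<lambda>z. f z * \<psi> (t1, z) - f z * \<psi> (t1, z + s *\<^sub>R e)) = (\<lambda>z. (- s) * (f z * Q z))"
    proof
      fix z
      have "s * Q z = \<psi> (t1, z + s *\<^sub>R e) - \<psi> (t1, z)" using s by (simp add: Q_def)
      moreover have "(- s) * (f z * Q z) = - (f z * (s * Q z))" by simp
      ultimately show "f z * \<psi> (t1, z) - f z * \<psi> (t1, z + s *\<^sub>R e) = (- s) * (f z * Q z)"
        by (simp add: right_diff_distrib)
    qed
    also have "TI \<dots> = (- s) * TI (\<lambda>z. f z * Q z)" by (rule set_integral_mult_right)
    finally show ?thesis using s by simp
  qed
  ultimately have 1: "TI (\<lambda>z. (f z - f (z - s *\<^sub>R e)) / s * \<psi> (t1, z)) = - TI (\<lambda>z. f z * Q z)"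
    by (simp only:)
  have 2: "TI (\<lambda>z. g (z - (s / 2) *\<^sub>R e) * ?D (t, z)) = TI (\<lambda>z. g z * ?D (t, z + (s / 2) *\<^sub>R e))"
    using tint_translate[OF Lx_pos Ly_pos, of "\<lambda>z. g z * ?D (t, z + (s / 2) *\<^sub>R e)" "- ((s / 2) *\<^sub>R e)"]
    by (simp add: Linf_mult g Linf_translate[OF LD])
  have "- TI (\<lambda>z. f z * Q z) + TI (\<lambda>z. g z * ?D (t, z + (s / 2) *\<^sub>R e))
      = TI (\<lambda>z. g z * (?D (t, z + (s / 2) *\<^sub>R e) - Q z)) - TI (\<lambda>z. (f z - g z) * Q z)"
  proof -
    have "TI (\<lambda>z. g z * (?D (t, z + (s / 2) *\<^sub>R e) - Q z)) = TI (\<lambda>z. g z * ?D (t, z + (s / 2) *\<^sub>R e)) - TI (\<lambda>z. g z * Q z)"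
      unfolding right_diff_distrib by (intro set_integral_diff(2) Linf_tintegrable Linf_mult g LQ Linf_translate[OF LD])
    moreover have "TI (\<lambda>z. (f z - g z) * Q z) = TI (\<lambda>z. f z * Q z) - TI (\<lambda>z. g z * Q z)"
      unfolding left_diff_distrib by (intro set_integral_diff(2) Linf_tintegrable Linf_mult f g LQ)
    ultimately show ?thesis by linarith
  qed
  moreover have "\<bar>TI (\<lambda>z. g z * (?D (t, z + (s / 2) *\<^sub>R e) - Q z))\<bar> \<le> (K * (\<bar>t1 - t\<bar> + 2 * s)) * TI (\<lambda>z. \<bar>g z\<bar>)"
    using Linf_diff[OF Linf_translate[OF LD] LQ]
    by (intro tint_mult_bound[OF Linf_tintegrable[OF g] _ QD]) (simp add: Linf_torus_def)
  moreover have "\<bar>TI (\<lambda>z. (f z - g z) * Q z)\<bar> \<le> K * TI (\<lambda>z. \<bar>f z - g z\<bar>)"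
    using LQ by (intro tint_mult_bound[OF Linf_tintegrable[OF Linf_diff[OF f g]] _ Qb]) (simp add: Linf_torus_def)
  moreover have "K * (TI (\<lambda>z. \<bar>f z - g z\<bar>) + TI (\<lambda>z. \<bar>g z\<bar>) * (\<bar>t1 - t\<bar> + 2 * s))
    = K * TI (\<lambda>z. \<bar>f z - g z\<bar>) + (K * (\<bar>t1 - t\<bar> + 2 * s)) * TI (\<lambda>z. \<bar>g z\<bar>)" by (simp add: algebra_simps)
  ultimately show ?thesis unfolding 1 2 by linarith
qed

text \<open>
  Averages over the two neighbouring half steps may be replaced by the function itself: translating the
  average onto the smooth factor leaves a difference of values of \<open>D\<close> at distance \<open>s / 2\<close>.
\<close>
lemma averaged_shift_consistency:
  assumes e: "norm e = 1" and D: "good D" and s: "s > 0" and G: "Linf G" and t: "t \<in> {0..Tend P}"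
  shows "\<bar>TI (\<lambda>z. (G (z - (s / 2) *\<^sub>R e) + G (z + (s / 2) *\<^sub>R e)) / 2 * D (t, z)) - TI (\<lambda>z. G z * D (t, z))\<bar>
    \<le> K * s * TI (\<lambda>z. \<bar>G z\<bar>)"
proof -
  note LD = good_Linf[OF D t]
  define d where "d = (s / 2) *\<^sub>R e"
  have nd: "norm d = s / 2" using s e by (simp add: d_def)
  have a: "TI (\<lambda>z. G (z - d) * D (t, z)) = TI (\<lambda>z. G z * D (t, z + d))"
    using tint_translate[OF Lx_pos Ly_pos, of "\<lambda>z. G z * D (t, z + d)" "- d"]
    by (simp add: Linf_mult G Linf_translate[OF LD])
  have b: "TI (\<lambda>z. G (z + d) * D (t, z)) = TI (\<lambda>z. G z * D (t, z - d))"
    using tint_translate[OF Lx_pos Ly_pos, of "\<lambda>z. G z * D (t, z - d)" "d"]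
    by (simp add: Linf_mult G Linf_translate_minus[OF LD])
  have split: "TI (\<lambda>z. (p z + q z) / 2) = (TI p + TI q) / 2" if "Linf p" "Linf q" for p q
    using set_integral_add(2)[OF Linf_tintegrable[OF that(1)] Linf_tintegrable[OF that(2)]]
    by (simp only: set_integral_divide_zero)
  have L: "Linf (\<lambda>z. G (z - d) * D (t, z))" "Linf (\<lambda>z. G (z + d) * D (t, z))"
    "Linf (\<lambda>z. G z * D (t, z + d))" "Linf (\<lambda>z. G z * D (t, z - d))" "Linf (\<lambda>z. G z * D (t, z))"
    by (intro Linf_mult Linf_translate[OF G] Linf_translate_minus[OF G] G LD Linf_translate[OF LD] Linf_translate_minus[OF LD])+
  have "TI (\<lambda>z. (G (z - d) + G (z + d)) / 2 * D (t, z)) = TI (\<lambda>z. (G (z - d) * D (t, z) + G (z + d) * D (t, z)) / 2)"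
    by (simp only: times_divide_eq_left distrib_right)
  also have "\<dots> = TI (\<lambda>z. (G z * D (t, z + d) + G z * D (t, z - d)) / 2)"
    unfolding split[OF L(1,2)] split[OF L(3,4)] a b ..
  also have "\<dots> - TI (\<lambda>z. G z * D (t, z)) = TI (\<lambda>z. (G z * D (t, z + d) + G z * D (t, z - d)) / 2 - G z * D (t, z))"
    by (intro set_integral_diff(2)[symmetric] Linf_tintegrable Linf_divide Linf_add L)
  also have "\<dots> = TI (\<lambda>z. G z * ((D (t, z + d) + D (t, z - d)) / 2 - D (t, z)))"
    by (simp only: right_diff_distrib distrib_left times_divide_eq_right)
  finally have "TI (\<lambda>z. (G (z - d) + G (z + d)) / 2 * D (t, z)) - TI (\<lambda>z. G z * D (t, z))
    = TI (\<lambda>z. G z * ((D (t, z + d) + D (t, z - d)) / 2 - D (t, z)))" .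
  also have "\<bar>\<dots>\<bar> \<le> (K * s) * TI (\<lambda>z. \<bar>G z\<bar>)"
  proof (rule tint_mult_bound[OF Linf_tintegrable[OF G]])
    have "Linf (\<lambda>z. (D (t, z + d) + D (t, z - d)) / 2 - D (t, z))"
      by (intro Linf_diff Linf_divide Linf_add LD Linf_translate[OF LD] Linf_translate_minus[OF LD])
    then show "(\<lambda>z. (D (t, z + d) + D (t, z - d)) / 2 - D (t, z)) \<in> borel_measurable borel" by (simp add: Linf_torus_def)
    fix z
    have "\<bar>D (t, z + d) - D (t, z)\<bar> \<le> K * (s / 2)" "\<bar>D (t, z - d) - D (t, z)\<bar> \<le> K * (s / 2)"
      using good_lipschitz[OF D t t, of "z + d" z] good_lipschitz[OF D t t, of "z - d" z] nd by simp_all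
    then have "\<bar>(D (t, z + d) + D (t, z - d)) / 2 - D (t, z)\<bar> \<le> K * (s / 2)" by (intro abs_midpoint_diff_le)
    also have "\<dots> \<le> K * s" using K_nonneg s by (intro mult_left_mono) auto
    finally show "\<bar>(D (t, z + d) + D (t, z - d)) / 2 - D (t, z)\<bar> \<le> K * s" .
  qed
  finally show ?thesis unfolding d_def .
qed

end

section \<open>Consistency of upwind transport\<close>

lemma abs_mult_le_weighted_squares:
  fixes a b l :: real
  assumes "l > 0"
  shows "\<bar>a * b\<bar> \<le> (l * a\<^sup>2 + b\<^sup>2 / l) / 2"
proof -
  have "0 \<le> (l * \<bar>a\<bar> - \<bar>b\<bar>)\<^sup>2" by simp
  then have "2 * l * \<bar>a * b\<bar> \<le> l\<^sup>2 * a\<^sup>2 + b\<^sup>2"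
    by (simp add: power2_eq_square abs_mult algebra_simps)
  then have "2 * l * \<bar>a * b\<bar> / (2 * l) \<le> (l\<^sup>2 * a\<^sup>2 + b\<^sup>2) / (2 * l)"
    using assms by (intro divide_right_mono) auto
  also have "(l\<^sup>2 * a\<^sup>2 + b\<^sup>2) / (2 * l) = (l * a\<^sup>2 + b\<^sup>2 / l) / 2"
    using assms by (simp add: power2_eq_square add_divide_distrib)
  finally show ?thesis using assms by simp
qed

lemma square_mean_le: "((a + b) / 2)\<^sup>2 \<le> (a\<^sup>2 + b\<^sup>2) / 2" for a b :: real
proof -
  have "0 \<le> (a - b)\<^sup>2" by simp
  then show ?thesis by (simp add: power2_eq_square field_simps)
qed

context sw_mesh
begin

lemma TI_add: "Linf f \<Longrightarrow> Linf g \<Longrightarrow> TI (\<lambda>z. f z + g z) = TI f + TI g"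
  by (intro set_integral_add(2) Linf_tintegrable)

lemma TI_diff: "Linf f \<Longrightarrow> Linf g \<Longrightarrow> TI (\<lambda>z. f z - g z) = TI f - TI g"
  by (intro set_integral_diff(2) Linf_tintegrable)

lemma TI_cmult: "TI (\<lambda>z. c * f z) = c * TI f"
  by (rule set_integral_mult_right)

lemma TI_mono: "Linf f \<Longrightarrow> Linf g \<Longrightarrow> (\<And>z. f z \<le> g z) \<Longrightarrow> TI f \<le> TI g"
  by (intro set_integral_mono Linf_tintegrable)

lemma TI_abs_pc: "grid_periodic M z \<Longrightarrow> TI (\<lambda>p. \<bar>pc M z p\<bar>) = GS (\<lambda>i j. \<bar>z i j\<bar>)"
  using TI_pc[OF gp_abs, of z] by (simp add: pc_def[abs_def])

lemma GS_pair_x: "grid_periodic M z \<Longrightarrow> GS (\<lambda>i j. z i j + z (i + 1) j) = 2 * GS z"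
  using GS_shift_x[of z 1] by (simp add: GS_add)

lemma GS_pair_y: "grid_periodic M z \<Longrightarrow> GS (\<lambda>i j. z i j + z i (j + 1)) = 2 * GS z"
  using GS_shift_y[of z 1] by (simp add: GS_add)

text \<open>
  The weight \<open>l\<close> is free: products of a stabilising term with a velocity are estimated with
  \<open>l = 1 / sqrt dt\<close>, which balances the two bounds of the energy estimate, and products of momentum
  and velocity with \<open>l = 1\<close>.
\<close>
lemma mean_times_upwind_le:
  fixes a a' w w' up l :: real
  assumes l: "l > 0" and up: "up = w \<or> up = w'"
  shows "\<bar>(a + a') / 2 * up\<bar> \<le> l / 4 * (a\<^sup>2 + a'\<^sup>2) + 1 / (2 * l) * (w\<^sup>2 + w'\<^sup>2)"
proof -
  have "up\<^sup>2 \<le> w\<^sup>2 + w'\<^sup>2" using up by auto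
  then have f1: "up\<^sup>2 / l \<le> (w\<^sup>2 + w'\<^sup>2) / l" using l by (intro divide_right_mono) auto
  have f2: "l * ((a + a') / 2)\<^sup>2 \<le> l * ((a\<^sup>2 + a'\<^sup>2) / 2)" using l square_mean_le by (intro mult_left_mono) auto
  have "(l * ((a + a') / 2)\<^sup>2 + up\<^sup>2 / l) / 2 \<le> (l * ((a\<^sup>2 + a'\<^sup>2) / 2) + (w\<^sup>2 + w'\<^sup>2) / l) / 2"
    by (rule divide_right_mono[OF add_mono[OF f2 f1]]) simp
  also have "\<dots> = l / 4 * (a\<^sup>2 + a'\<^sup>2) + 1 / (2 * l) * (w\<^sup>2 + w'\<^sup>2)"
    using l by (simp add: field_simps)
  finally show ?thesis using abs_mult_le_weighted_squares[OF l, of "(a + a') / 2" up] by (rule order_trans[rotated])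
qed

lemma GS_mean_upwind_x:
  assumes z: "grid_periodic M z" and w: "grid_periodic M w" and l: "l > 0"
    and up: "\<And>i j. up i j = w i j \<or> up i j = w (i + 1) j"
  shows "GS (\<lambda>i j. \<bar>mean_x z i j * up i j\<bar>) \<le> l / 2 * GS (\<lambda>i j. (z i j)\<^sup>2) + GS (\<lambda>i j. (w i j)\<^sup>2) / l"
proof -
  have "GS (\<lambda>i j. \<bar>mean_x z i j * up i j\<bar>)
    \<le> GS (\<lambda>i j. l / 4 * ((z i j)\<^sup>2 + (z (i + 1) j)\<^sup>2) + 1 / (2 * l) * ((w i j)\<^sup>2 + (w (i + 1) j)\<^sup>2))"
    unfolding mean_x_def by (intro GS_mono mean_times_upwind_le l up)
  also have "\<dots> = l / 4 * (2 * GS (\<lambda>i j. (z i j)\<^sup>2)) + 1 / (2 * l) * (2 * GS (\<lambda>i j. (w i j)\<^sup>2))"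
    using GS_pair_x[OF gp_power[OF z, of 2]] GS_pair_x[OF gp_power[OF w, of 2]]
    by (simp only: GS_add[of "\<lambda>i j. l / 4 * ((z i j)\<^sup>2 + (z (i + 1) j)\<^sup>2)"] GS_cmult)
  finally show ?thesis by simp
qed

lemma GS_mean_upwind_y:
  assumes z: "grid_periodic M z" and w: "grid_periodic M w" and l: "l > 0"
    and up: "\<And>i j. up i j = w i j \<or> up i j = w i (j + 1)"
  shows "GS (\<lambda>i j. \<bar>mean_y z i j * up i j\<bar>) \<le> l / 2 * GS (\<lambda>i j. (z i j)\<^sup>2) + GS (\<lambda>i j. (w i j)\<^sup>2) / l"
proof -
  have "GS (\<lambda>i j. \<bar>mean_y z i j * up i j\<bar>)
    \<le> GS (\<lambda>i j. l / 4 * ((z i j)\<^sup>2 + (z i (j + 1))\<^sup>2) + 1 / (2 * l) * ((w i j)\<^sup>2 + (w i (j + 1))\<^sup>2))"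
    unfolding mean_y_def by (intro GS_mono mean_times_upwind_le l up)
  also have "\<dots> = l / 4 * (2 * GS (\<lambda>i j. (z i j)\<^sup>2)) + 1 / (2 * l) * (2 * GS (\<lambda>i j. (w i j)\<^sup>2))"
    using GS_pair_y[OF gp_power[OF z, of 2]] GS_pair_y[OF gp_power[OF w, of 2]]
    by (simp only: GS_add[of "\<lambda>i j. l / 4 * ((z i j)\<^sup>2 + (z i (j + 1))\<^sup>2)"] GS_cmult)
  finally show ?thesis by simp
qed

end

context sw_scheme
begin

text \<open>
  The rate at which all consistency errors vanish. Time and space steps enter separately, since the mesh
  may be anisotropic.
\<close>
definition rate :: real where "rate = sqrt (dt S) + dt S + dx S + dy S"

lemma rate_bounds: "0 < sqrt (dt S)" "sqrt (dt S) \<le> rate" "dt S + dx S + dy S \<le> rate" "0 \<le> rate"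
  using dt_pos dx_pos dy_pos by (auto simp: rate_def)

lemma Tend_pos: "0 < Tend P" and nt_pos: "0 < nt S"
proof -
  show "0 < Tend P" using valid by (simp add: valid_problem_def)
  then show "0 < nt S" using nt_dt by (cases "nt S") auto
qed

lemma sum_dt: "(\<Sum>n<nt S. dt S * c) = Tend P * c"
  using nt_dt by (simp add: mult.assoc[symmetric])

lemma sum_dt_affine:
  "(\<Sum>n<nt S. dt S * (K * (x * (p n + q n) + C))) = K * (dt S * x * ((\<Sum>n<nt S. p n) + (\<Sum>n<nt S. q n)) + Tend P * C)"
proof -
  have "(\<Sum>n<nt S. dt S * (K * (x * (p n + q n) + C))) = (\<Sum>n<nt S. (K * dt S * x) * (p n + q n) + dt S * (K * C))"
    by (intro sum.cong refl) (simp add: algebra_simps)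
  also have "\<dots> = (\<Sum>n<nt S. (K * dt S * x) * (p n + q n)) + Tend P * (K * C)"
    by (simp only: sum.distrib sum_dt)
  also have "(\<Sum>n<nt S. (K * dt S * x) * (p n + q n)) = (K * dt S * x) * ((\<Sum>n<nt S. p n) + (\<Sum>n<nt S. q n))"
    by (simp only: sum_distrib_left[symmetric] sum.distrib)
  finally show ?thesis by (simp add: algebra_simps)
qed

lemma GS_hw_square:
  assumes "n < nt S" "GS (\<lambda>i j. (w i j)\<^sup>2) \<le> CU"
  shows "GS (\<lambda>i j. (h (n + 1) i j * w i j)\<^sup>2) \<le> hhi\<^sup>2 * CU"
proof -
  have "GS (\<lambda>i j. (h (n + 1) i j * w i j)\<^sup>2) \<le> GS (\<lambda>i j. hhi\<^sup>2 * (w i j)\<^sup>2)"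
  proof (intro GS_mono)
    fix i j
    have "(h (n + 1) i j)\<^sup>2 \<le> hhi\<^sup>2"
      using h_bounds(2)[of "n + 1" i j] h_pos[of "n + 1" i j] assms(1) by (intro power_mono) auto
    then show "(h (n + 1) i j * w i j)\<^sup>2 \<le> hhi\<^sup>2 * (w i j)\<^sup>2"
      unfolding power_mult_distrib by (intro mult_right_mono) auto
  qed
  also have "\<dots> \<le> hhi\<^sup>2 * CU" unfolding GS_cmult using assms(2) by (intro mult_left_mono) auto
  finally show ?thesis .
qed

lemma GS_abs_hw:
  assumes "n < nt S" "GS (\<lambda>i j. (w i j)\<^sup>2) \<le> CU"
  shows "GS (\<lambda>i j. \<bar>h (n + 1) i j * w i j\<bar>) \<le> hhi\<^sup>2 * CU + area"
proof -
  have "GS (\<lambda>i j. \<bar>h (n + 1) i j * w i j\<bar>) \<le> GS (\<lambda>i j. (h (n + 1) i j * w i j)\<^sup>2 + 1)"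
  proof (intro GS_mono)
    fix i j
    have "\<bar>x\<bar> \<le> x\<^sup>2 + 1" for x :: real
      using abs_mult_le_weighted_squares[of 1 x 1] zero_le_power2[of x] by simp
    then show "\<bar>h (n + 1) i j * w i j\<bar> \<le> (h (n + 1) i j * w i j)\<^sup>2 + 1" .
  qed
  also have "\<dots> = GS (\<lambda>i j. (h (n + 1) i j * w i j)\<^sup>2) + 1 * area" by (simp only: GS_add GS_const)
  finally show ?thesis using GS_hw_square[OF assms] by simp
qed

end

context sw_test
begin

text \<open>
  The numerical flux differs from the momentum \<open>m\<close> by the mean of a stabilising term. Its contribution is
  kept as a sum over cells, because it is small only after summation over the time steps.
\<close>
lemma transport_flux_error:
  assumes n: "n < nt S" and w: "grid_periodic S (w n)" and CW: "GS (\<lambda>i j. (w n i j)\<^sup>2) \<le> CW"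
    and t: "t \<in> {time S n..time S (n + 1)}"
  defines "fx \<equiv> pc S (\<lambda>i j. FF P \<eta> S n i j * upw_x P \<eta> S w n i j)"
    and "fy \<equiv> pc S (\<lambda>i j. GG P \<eta> S n i j * upw_y P \<eta> S w n i j)"
  shows "\<bar>TI (\<lambda>z. (fx z - fx (z - (dx S, 0))) / dx S * \<psi> (time S (n + 1), z))
      + TI (\<lambda>z. pc_Dx S (m_x S n) z * pc_Dx S (upw_x P \<eta> S w n) z * dx_test \<psi> (t, z))\<bar>
    \<le> K * (1 / (2 * sqrt (dt S)) * GS (\<lambda>i j. (qq P \<eta> S n i j)\<^sup>2) + sqrt (dt S) * CW + (hhi\<^sup>2 * CU + CW) * (dt S + 2 * dx S))"
    and "\<bar>TI (\<lambda>z. (fy z - fy (z - (0, dy S))) / dy S * \<psi> (time S (n + 1), z))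
      + TI (\<lambda>z. pc_Dy S (m_y S n) z * pc_Dy S (upw_y P \<eta> S w n) z * dy_test \<psi> (t, z))\<bar>
    \<le> K * (1 / (2 * sqrt (dt S)) * GS (\<lambda>i j. (rr P \<eta> S n i j)\<^sup>2) + sqrt (dt S) * CW + (hhi\<^sup>2 * CU + CW) * (dt S + 2 * dy S))"
proof -
  have tr: "t \<in> {0..Tend P}" "time S (n + 1) \<in> {0..Tend P}" using step_subset[OF n] t by auto
  have td: "\<bar>time S (n + 1) - t\<bar> \<le> dt S" using t by (auto simp: time_Suc)
  have hw0: "0 \<le> hhi\<^sup>2 * CU + CW"
    using CU_nonneg CW GS_nonneg[of "\<lambda>i j. (w n i j)\<^sup>2"] by (intro add_nonneg_nonneg) auto
  have sq: "1 / (1 / sqrt (dt S)) = sqrt (dt S)" by simp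
  have l: "1 / sqrt (dt S) > 0" using dt_pos by simp
  have u2: "GS (\<lambda>i j. (h (n + 1) i j * u n i j)\<^sup>2) \<le> hhi\<^sup>2 * CU" "GS (\<lambda>i j. (h (n + 1) i j * v n i j)\<^sup>2) \<le> hhi\<^sup>2 * CU"
    using GS_hw_square[OF n] u_bound[of n] v_bound[of n] n by auto
  have fin: "K * (a + b * (\<bar>time S (n + 1) - t\<bar> + 2 * s)) \<le> K * (A + B + (hhi\<^sup>2 * CU + CW) * (dt S + 2 * s))"
    if "a \<le> A + B" "b \<le> hhi\<^sup>2 * CU + CW" "0 \<le> b" "0 < s" for a b A B s
  proof -
    have "b * (\<bar>time S (n + 1) - t\<bar> + 2 * s) \<le> (hhi\<^sup>2 * CU + CW) * (dt S + 2 * s)"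
      using that td hw0 by (intro mult_mono) auto
    then show ?thesis using that K_nonneg by (intro mult_left_mono) auto
  qed
  have upx: "upw_x P \<eta> S w n i j = w n i j \<or> upw_x P \<eta> S w n i j = w n (i + 1) j" for i j by (simp add: upw_x_def)
  have upy: "upw_y P \<eta> S w n i j = w n i j \<or> upw_y P \<eta> S w n i j = w n i (j + 1)" for i j by (simp add: upw_y_def)
  have mgp: "grid_periodic S (m_x S n)" "grid_periodic S (m_y S n)"
    unfolding m_x_def m_y_def using n by (intro gp_intros gp_huv; simp)+
  \<comment> \<open>The weight in the Young inequality is \<open>1 / sqrt dt\<close>.\<close>
  have q: "sqrt (dt S) * CW \<ge> GS (\<lambda>i j. (w n i j)\<^sup>2) / (1 / sqrt (dt S))"
    using CW dt_pos mult_right_mono[OF CW, of "sqrt (dt S)"] by (simp add: mult.commute)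
  show "\<bar>TI (\<lambda>z. (fx z - fx (z - (dx S, 0))) / dx S * \<psi> (time S (n + 1), z))
      + TI (\<lambda>z. pc_Dx S (m_x S n) z * pc_Dx S (upw_x P \<eta> S w n) z * dx_test \<psi> (t, z))\<bar>
    \<le> K * (1 / (2 * sqrt (dt S)) * GS (\<lambda>i j. (qq P \<eta> S n i j)\<^sup>2) + sqrt (dt S) * CW + (hhi\<^sup>2 * CU + CW) * (dt S + 2 * dx S))"
  proof -
    define gx where "gx = pc S (\<lambda>i j. m_x S n i j * upw_x P \<eta> S w n i j)"
    have gpf: "grid_periodic S (\<lambda>i j. FF P \<eta> S n i j * upw_x P \<eta> S w n i j)"
      "grid_periodic S (\<lambda>i j. m_x S n i j * upw_x P \<eta> S w n i j)"
      using w mgp by (intro gp_mult gp_FF gp_upw_x n; simp)+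
    have L: "Linf fx" "Linf gx" unfolding fx_def gx_def by (intro Linf_pc gpf)+
    have e: "dx S *\<^sub>R (1, 0 :: real) = (dx S, 0)" "pc_Dx S (m_x S n) z * pc_Dx S (upw_x P \<eta> S w n) z = gx (z - (dx S / 2) *\<^sub>R (1, 0))" for z
      by (simp_all add: gx_def pc_Dx_eq pc_def)
    have "TI (\<lambda>z. \<bar>fx z - gx z\<bar>) = GS (\<lambda>i j. \<bar>mean_x (qq P \<eta> S n) i j * upw_x P \<eta> S w n i j\<bar>)"
    proof -
      have "fx z - gx z = pc S (\<lambda>i j. - (mean_x (qq P \<eta> S n) i j * upw_x P \<eta> S w n i j)) z" for z
        by (simp add: fx_def gx_def pc_def FF_def algebra_simps)
      then show ?thesis
        using TI_abs_pc[OF gp_minus[OF gp_mult[OF gp_mean_x[OF gp_qq[OF n]] gp_upw_x[where w = w, OF n w]]]] by simp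
    qed
    also have "\<dots> \<le> 1 / sqrt (dt S) / 2 * GS (\<lambda>i j. (qq P \<eta> S n i j)\<^sup>2) + GS (\<lambda>i j. (w n i j)\<^sup>2) / (1 / sqrt (dt S))"
      by (rule GS_mean_upwind_x[where w = "w n", OF gp_qq[OF n] w l upx])
    finally have a: "TI (\<lambda>z. \<bar>fx z - gx z\<bar>) \<le> 1 / (2 * sqrt (dt S)) * GS (\<lambda>i j. (qq P \<eta> S n i j)\<^sup>2) + sqrt (dt S) * CW"
      using q by simp
    have "TI (\<lambda>z. \<bar>gx z\<bar>) = GS (\<lambda>i j. \<bar>m_x S n i j * upw_x P \<eta> S w n i j\<bar>)"
      unfolding gx_def by (rule TI_abs_pc[OF gpf(2)])
    also have "\<dots> \<le> 1 / 2 * GS (\<lambda>i j. (h (n + 1) i j * u n i j)\<^sup>2) + GS (\<lambda>i j. (w n i j)\<^sup>2) / 1"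
      unfolding m_x_def using n by (intro GS_mean_upwind_x[where w = "w n"] gp_mult gp_huv w upx) auto
    also have "\<dots> \<le> hhi\<^sup>2 * CU + CW"
      using u2(1) CW GS_nonneg[of "\<lambda>i j. (h (n + 1) i j * u n i j)\<^sup>2"] by simp
    finally have b: "TI (\<lambda>z. \<bar>gx z\<bar>) \<le> hhi\<^sup>2 * CU + CW" .
    have g: "good (pdiff (0, (1, 0)) \<psi>)" using good_x by simp
    show ?thesis
      using flux_consistency[OF _ g dx_pos L tr(1,2)] fin[OF a b tint_nonneg dx_pos] unfolding e by force
  qed
  show "\<bar>TI (\<lambda>z. (fy z - fy (z - (0, dy S))) / dy S * \<psi> (time S (n + 1), z))
      + TI (\<lambda>z. pc_Dy S (m_y S n) z * pc_Dy S (upw_y P \<eta> S w n) z * dy_test \<psi> (t, z))\<bar>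
    \<le> K * (1 / (2 * sqrt (dt S)) * GS (\<lambda>i j. (rr P \<eta> S n i j)\<^sup>2) + sqrt (dt S) * CW + (hhi\<^sup>2 * CU + CW) * (dt S + 2 * dy S))"
  proof -
    define gy where "gy = pc S (\<lambda>i j. m_y S n i j * upw_y P \<eta> S w n i j)"
    have gpf: "grid_periodic S (\<lambda>i j. GG P \<eta> S n i j * upw_y P \<eta> S w n i j)"
      "grid_periodic S (\<lambda>i j. m_y S n i j * upw_y P \<eta> S w n i j)"
      using w mgp by (intro gp_mult gp_GG gp_upw_y n; simp)+
    have L: "Linf fy" "Linf gy" unfolding fy_def gy_def by (intro Linf_pc gpf)+
    have e: "dy S *\<^sub>R (0 :: real, 1) = (0, dy S)" "pc_Dy S (m_y S n) z * pc_Dy S (upw_y P \<eta> S w n) z = gy (z - (dy S / 2) *\<^sub>R (0, 1))" for z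
      by (simp_all add: gy_def pc_Dy_eq pc_def)
    have "TI (\<lambda>z. \<bar>fy z - gy z\<bar>) = GS (\<lambda>i j. \<bar>mean_y (rr P \<eta> S n) i j * upw_y P \<eta> S w n i j\<bar>)"
    proof -
      have "fy z - gy z = pc S (\<lambda>i j. - (mean_y (rr P \<eta> S n) i j * upw_y P \<eta> S w n i j)) z" for z
        by (simp add: fy_def gy_def pc_def GG_def algebra_simps)
      then show ?thesis
        using TI_abs_pc[OF gp_minus[OF gp_mult[OF gp_mean_y[OF gp_rr[OF n]] gp_upw_y[where w = w, OF n w]]]] by simp
    qed
    also have "\<dots> \<le> 1 / sqrt (dt S) / 2 * GS (\<lambda>i j. (rr P \<eta> S n i j)\<^sup>2) + GS (\<lambda>i j. (w n i j)\<^sup>2) / (1 / sqrt (dt S))"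
      by (rule GS_mean_upwind_y[where w = "w n", OF gp_rr[OF n] w l upy])
    finally have a: "TI (\<lambda>z. \<bar>fy z - gy z\<bar>) \<le> 1 / (2 * sqrt (dt S)) * GS (\<lambda>i j. (rr P \<eta> S n i j)\<^sup>2) + sqrt (dt S) * CW"
      using q by simp
    have "TI (\<lambda>z. \<bar>gy z\<bar>) = GS (\<lambda>i j. \<bar>m_y S n i j * upw_y P \<eta> S w n i j\<bar>)"
      unfolding gy_def by (rule TI_abs_pc[OF gpf(2)])
    also have "\<dots> \<le> 1 / 2 * GS (\<lambda>i j. (h (n + 1) i j * v n i j)\<^sup>2) + GS (\<lambda>i j. (w n i j)\<^sup>2) / 1"
      unfolding m_y_def using n by (intro GS_mean_upwind_y[where w = "w n"] gp_mult gp_huv w upy) auto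
    also have "\<dots> \<le> hhi\<^sup>2 * CU + CW"
      using u2(2) CW GS_nonneg[of "\<lambda>i j. (h (n + 1) i j * v n i j)\<^sup>2"] by simp
    finally have b: "TI (\<lambda>z. \<bar>gy z\<bar>) \<le> hhi\<^sup>2 * CU + CW" .
    have g: "good (pdiff (0, (0, 1)) \<psi>)" using good_y by simp
    show ?thesis
      using flux_consistency[OF _ g dy_pos L tr(1,2)] fin[OF a b tint_nonneg dy_pos] unfolding e by force
  qed
qed

definition transport_constant :: "real \<Rightarrow> real" where
  "transport_constant CW = \<eta>\<^sup>2 * CD + 2 * (Tend P * CW) + 2 * (Tend P * (hhi\<^sup>2 * CU + CW))"

text \<open>
  The transport part of the weak form, for an arbitrary transported grid function: the velocities give the
  momentum equations and the constant 1 gives the mass equation.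
\<close>
definition transport_form :: "(nat \<Rightarrow> grid) \<Rightarrow> nat \<Rightarrow> real \<Rightarrow> real \<times> real \<Rightarrow> real" where
  "transport_form w n t z = pc S (h n) z * pc S (w n) z * dt_test \<psi> (t, z)
     + pc_Dx S (m_x S n) z * pc_Dx S (upw_x P \<eta> S w n) z * dx_test \<psi> (t, z)
     + pc_Dy S (m_y S n) z * pc_Dy S (upw_y P \<eta> S w n) z * dy_test \<psi> (t, z)"

lemma Linf_pc_Dx: "grid_periodic S z \<Longrightarrow> Linf (pc_Dx S z)" and Linf_pc_Dy: "grid_periodic S z \<Longrightarrow> Linf (pc_Dy S z)"
  unfolding pc_Dx_eq[abs_def] pc_Dy_eq[abs_def] by (intro Linf_translate_minus Linf_pc; assumption)+

lemma Linf_fluxes: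
  assumes "n < nt S" "grid_periodic S (w n)"
  shows "Linf (\<lambda>z. pc_Dx S (m_x S n) z * pc_Dx S (upw_x P \<eta> S w n) z)"
    and "Linf (\<lambda>z. pc_Dy S (m_y S n) z * pc_Dy S (upw_y P \<eta> S w n) z)"
    and "Linf (\<lambda>z. pc S (h n) z * pc S (w n) z)"
  unfolding m_x_def m_y_def using assms
  by (intro Linf_mult Linf_pc_Dx Linf_pc_Dy Linf_pc gp_intros gp_huv gp_upw_x gp_upw_y; simp)+

lemma st_ok_transport:
  assumes w: "\<And>n. n \<le> nt S \<Longrightarrow> grid_periodic S (w n)"
  shows "st_ok (transport_form w)"
  unfolding transport_form_def[abs_def]
  by (intro st_add st_basic Linf_tintegrable Linf_fluxes good_t good_x good_y w) auto

text \<open>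
  The time terms telescope exactly to the initial value, since \<open>\<psi>\<close> vanishes at the final time. Only the
  spatial fluxes contribute to the error, by the lemma on flux consistency. The stabilising part is summed
  over time with the dissipation bound and yields the square root of the time step.
\<close>
lemma transport_consistency:
  assumes w: "\<And>n. n \<le> nt S \<Longrightarrow> grid_periodic S (w n)" and CW: "\<And>n. n < nt S \<Longrightarrow> GS (\<lambda>i j. (w n i j)\<^sup>2) \<le> CW"
  shows "\<bar>- TI (\<lambda>z. pc S (h 0) z * pc S (w 0) z * \<psi> (0, z)) - spacetime_sum P S (transport_form w)
      - (\<Sum>n<nt S. dt S * TI (\<lambda>z. pc S (transport P \<eta> S w n) z * \<psi> (time S (n + 1), z)))\<bar>
    \<le> K * transport_constant CW * rate"
proof -
  define W where "W n z = pc S (h n) z * pc S (w n) z" for n z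
  define fx where "fx n = pc S (\<lambda>i j. FF P \<eta> S n i j * upw_x P \<eta> S w n i j)" for n
  define fy where "fy n = pc S (\<lambda>i j. GG P \<eta> S n i j * upw_y P \<eta> S w n i j)" for n
  define \<psi>1 where "\<psi>1 n z = \<psi> (time S (n + 1), z)" for n z
  define Rx where "Rx n = TI (\<lambda>z. (fx n z - fx n (z - (dx S, 0))) / dx S * \<psi>1 n z)" for n
  define Ry where "Ry n = TI (\<lambda>z. (fy n z - fy n (z - (0, dy S))) / dy S * \<psi>1 n z)" for n
  define B where "B n t z = pc_Dx S (m_x S n) z * pc_Dx S (upw_x P \<eta> S w n) z * dx_test \<psi> (t, z)
     + pc_Dy S (m_y S n) z * pc_Dy S (upw_y P \<eta> S w n) z * dy_test \<psi> (t, z)" for n t z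
  have LW: "Linf (W n)" if "n \<le> nt S" for n
    unfolding W_def[abs_def] using that by (intro Linf_mult Linf_pc gp_huv w)
  have L1: "Linf (\<psi>1 n)" if "n < nt S" for n
    unfolding \<psi>1_def[abs_def] using time_range[of "n + 1"] that by (intro good_Linf[OF good_psi]) auto
  have Lf: "Linf (fx n)" "Linf (fy n)" if "n < nt S" for n
    unfolding fx_def fy_def using that by (intro Linf_pc gp_mult gp_FF gp_GG gp_upw_x gp_upw_y w; simp)+
  have okA: "st_ok (\<lambda>n t z. W n z * dt_test \<psi> (t, z))"
    by (intro st_basic Linf_tintegrable LW good_t) auto
  have okB: "st_ok B"
    unfolding B_def[abs_def] by (intro st_add st_basic Linf_tintegrable Linf_fluxes good_x good_y w) auto
  have split: "spacetime_sum P S (transport_form w) = spacetime_sum P S (\<lambda>n t z. W n z * dt_test \<psi> (t, z)) + spacetime_sum P S B"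
    using st_add(2)[OF okA okB] by (simp add: transport_form_def[abs_def] B_def[abs_def] W_def add.assoc)
  have A: "spacetime_sum P S (\<lambda>n t z. W n z * dt_test \<psi> (t, z))
      = (\<Sum>n<nt S. TI (\<lambda>z. W n z * \<psi>1 n z) - TI (\<lambda>z. W n z * \<psi> (time S n, z)))"
    unfolding \<psi>1_def by (intro st_time Linf_tintegrable LW) auto
  have T: "dt S * TI (\<lambda>z. pc S (transport P \<eta> S w n) z * \<psi>1 n z)
      = TI (\<lambda>z. W (n + 1) z * \<psi>1 n z) - TI (\<lambda>z. W n z * \<psi>1 n z) + dt S * (Rx n + Ry n)" if n: "n < nt S" for n
  proof -
    have pcT: "pc S (transport P \<eta> S w n) z = (W (n + 1) z - W n z) / dt S + (fx n z - fx n (z - (dx S, 0))) / dx S + (fy n z - fy n (z - (0, dy S))) / dy S" for z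
    proof -
      have d: "z - (dx S, 0) = z + (- dx S, 0)" "z - (0, dy S) = z + (0, - dy S)"
        by (simp_all add: prod_eq_iff)
      have "fx n (z - (dx S, 0)) = pc S (\<lambda>i j. FF P \<eta> S n (i - 1) j * upw_x P \<eta> S w n (i - 1) j) z"
        "fy n (z - (0, dy S)) = pc S (\<lambda>i j. GG P \<eta> S n i (j - 1) * upw_y P \<eta> S w n i (j - 1)) z"
        using pc_shift_x[of "\<lambda>i j. FF P \<eta> S n i j * upw_x P \<eta> S w n i j" "- 1" z]
          pc_shift_y[of "\<lambda>i j. GG P \<eta> S n i j * upw_y P \<eta> S w n i j" "- 1" z]
        by (simp_all add: fx_def fy_def d)
      then show ?thesis by (simp add: W_def fx_def fy_def transport_def pc_def)
    qed
    have L: "Linf (\<lambda>z. (1 / dt S) * (W (n + 1) z * \<psi>1 n z - W n z * \<psi>1 n z))"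
      "Linf (\<lambda>z. (fx n z - fx n (z - (dx S, 0))) / dx S * \<psi>1 n z)"
      "Linf (\<lambda>z. (fy n z - fy n (z - (0, dy S))) / dy S * \<psi>1 n z)"
      "Linf (\<lambda>z. W (n + 1) z * \<psi>1 n z)" "Linf (\<lambda>z. W n z * \<psi>1 n z)"
      using LW[of n] LW[of "n + 1"] L1[OF n] Lf[OF n] n
      by (intro Linf_cmult Linf_diff Linf_mult Linf_divide Linf_translate_minus; simp)+
    have eq: "(W (n + 1) z - W n z) / dt S * \<psi>1 n z = (1 / dt S) * (W (n + 1) z * \<psi>1 n z - W n z * \<psi>1 n z)" for z
      by (simp add: diff_divide_distrib left_diff_distrib)
    have "TI (\<lambda>z. pc S (transport P \<eta> S w n) z * \<psi>1 n z)
      = TI (\<lambda>z. (1 / dt S) * (W (n + 1) z * \<psi>1 n z - W n z * \<psi>1 n z) + (fx n z - fx n (z - (dx S, 0))) / dx S * \<psi>1 n z + (fy n z - fy n (z - (0, dy S))) / dy S * \<psi>1 n z)"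
      unfolding pcT distrib_right eq ..
    also have "\<dots> = (1 / dt S) * (TI (\<lambda>z. W (n + 1) z * \<psi>1 n z) - TI (\<lambda>z. W n z * \<psi>1 n z)) + Rx n + Ry n"
      unfolding Rx_def Ry_def using n
      using TI_add[OF Linf_add[OF L(1,2)] L(3)] TI_add[OF L(1,2)] TI_diff[OF L(4,5)]
      by (simp only: TI_cmult)
    finally have E: "TI (\<lambda>z. pc S (transport P \<eta> S w n) z * \<psi>1 n z)
      = (1 / dt S) * (TI (\<lambda>z. W (n + 1) z * \<psi>1 n z) - TI (\<lambda>z. W n z * \<psi>1 n z)) + Rx n + Ry n" .
    show ?thesis unfolding E using dt_pos by (simp add: distrib_left)
  qed
  \<comment> \<open>The sum telescopes because the flux terms are tested at the new time level.\<close>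
  have tel: "(\<Sum>n<nt S. TI (\<lambda>z. W (n + 1) z * \<psi>1 n z) - TI (\<lambda>z. W n z * \<psi> (time S n, z))) = - TI (\<lambda>z. W 0 z * \<psi> (0, z))"
  proof -
    have "(\<Sum>n<nt S. TI (\<lambda>z. W (n + 1) z * \<psi>1 n z) - TI (\<lambda>z. W n z * \<psi> (time S n, z)))
      = (\<Sum>n<nt S. (\<lambda>n. TI (\<lambda>z. W n z * \<psi> (time S n, z))) (Suc n) - (\<lambda>n. TI (\<lambda>z. W n z * \<psi> (time S n, z))) n)"
      by (simp add: \<psi>1_def)
    also have "\<dots> = TI (\<lambda>z. W (nt S) z * \<psi> (time S (nt S), z)) - TI (\<lambda>z. W 0 z * \<psi> (time S 0, z))"
      by (rule sum_lessThan_telescope)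
    finally show ?thesis using nt_dt psi_end by (simp add: time_def)
  qed
  have residual: "- TI (\<lambda>z. W 0 z * \<psi> (0, z)) - spacetime_sum P S (transport_form w) - (\<Sum>n<nt S. dt S * TI (\<lambda>z. pc S (transport P \<eta> S w n) z * \<psi>1 n z))
      = (\<Sum>n<nt S. dt S * (- (Rx n + Ry n))) - spacetime_sum P S B"
  proof -
    have "(\<Sum>n<nt S. dt S * TI (\<lambda>z. pc S (transport P \<eta> S w n) z * \<psi>1 n z))
      = (\<Sum>n<nt S. TI (\<lambda>z. W (n + 1) z * \<psi>1 n z) - TI (\<lambda>z. W n z * \<psi>1 n z) + dt S * (Rx n + Ry n))"
      by (intro sum.cong refl T) auto
    then show ?thesis unfolding split A tel[symmetric] by (simp add: sum.distrib sum_subtractf sum_negf del: minus_add_distrib)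
  qed
  have "\<bar>(\<Sum>n<nt S. dt S * (- (Rx n + Ry n))) - spacetime_sum P S B\<bar> \<le> (\<Sum>n<nt S. dt S * (K * (1 / (2 * sqrt (dt S)) * (GS (\<lambda>i j. (qq P \<eta> S n i j)\<^sup>2) + GS (\<lambda>i j. (rr P \<eta> S n i j)\<^sup>2))
      + (2 * sqrt (dt S) * CW + (hhi\<^sup>2 * CU + CW) * (2 * dt S + 2 * dx S + 2 * dy S)))))"
  proof (subst abs_minus_commute, rule st_bound[OF okB])
    fix n t assume n: "n < nt S" and t: "t \<in> {time S n..time S (n + 1)}"
    have tr: "t \<in> {0..Tend P}" using step_subset[OF n] t by auto
    define Bx where "Bx = TI (\<lambda>z. pc_Dx S (m_x S n) z * pc_Dx S (upw_x P \<eta> S w n) z * dx_test \<psi> (t, z))"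
    define By where "By = TI (\<lambda>z. pc_Dy S (m_y S n) z * pc_Dy S (upw_y P \<eta> S w n) z * dy_test \<psi> (t, z))"
    have TB: "TI (B n t) = Bx + By"
      unfolding B_def Bx_def By_def using n
      by (intro TI_add Linf_mult[OF Linf_fluxes(1)] Linf_mult[OF Linf_fluxes(2)] w good_Linf[OF good_x tr] good_Linf[OF good_y tr]) auto
    note flux = transport_flux_error[where w = w and n = n and CW = CW and t = t, OF n w[OF less_imp_le[OF n]] CW[OF n] t,
        folded fx_def fy_def \<psi>1_def, folded Rx_def Ry_def Bx_def By_def]
    have tri: "\<bar>b1 + b2 - - (r1 + r2)\<bar> \<le> p + q" if "\<bar>r1 + b1\<bar> \<le> p" "\<bar>r2 + b2\<bar> \<le> q" for b1 b2 r1 r2 p q :: real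
      using that by linarith
    have alg: "K * (x * p + s * c + y * (d + 2 * a)) + K * (x * q + s * c + y * (d + 2 * b))
      = K * (x * (p + q) + (2 * s * c + y * (2 * d + 2 * a + 2 * b)))" for x p q s c y d a b :: real
      by (simp add: algebra_simps)
    have "\<bar>TI (B n t) - - (Rx n + Ry n)\<bar>
      \<le> K * (1 / (2 * sqrt (dt S)) * GS (\<lambda>i j. (qq P \<eta> S n i j)\<^sup>2) + sqrt (dt S) * CW + (hhi\<^sup>2 * CU + CW) * (dt S + 2 * dx S))
        + K * (1 / (2 * sqrt (dt S)) * GS (\<lambda>i j. (rr P \<eta> S n i j)\<^sup>2) + sqrt (dt S) * CW + (hhi\<^sup>2 * CU + CW) * (dt S + 2 * dy S))"
      unfolding TB by (rule tri[OF flux])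
    also have "\<dots> = K * (1 / (2 * sqrt (dt S)) * (GS (\<lambda>i j. (qq P \<eta> S n i j)\<^sup>2) + GS (\<lambda>i j. (rr P \<eta> S n i j)\<^sup>2))
      + (2 * sqrt (dt S) * CW + (hhi\<^sup>2 * CU + CW) * (2 * dt S + 2 * dx S + 2 * dy S)))"
      by (rule alg)
    finally show "\<bar>TI (B n t) - - (Rx n + Ry n)\<bar> \<le> K * (1 / (2 * sqrt (dt S)) * (GS (\<lambda>i j. (qq P \<eta> S n i j)\<^sup>2) + GS (\<lambda>i j. (rr P \<eta> S n i j)\<^sup>2))
      + (2 * sqrt (dt S) * CW + (hhi\<^sup>2 * CU + CW) * (2 * dt S + 2 * dx S + 2 * dy S)))" .
  qed
  also have "\<dots> = K * (dt S * (1 / (2 * sqrt (dt S))) * ((\<Sum>n<nt S. GS (\<lambda>i j. (qq P \<eta> S n i j)\<^sup>2)) + (\<Sum>n<nt S. GS (\<lambda>i j. (rr P \<eta> S n i j)\<^sup>2)))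
      + Tend P * (2 * sqrt (dt S) * CW + (hhi\<^sup>2 * CU + CW) * (2 * dt S + 2 * dx S + 2 * dy S)))"
    by (rule sum_dt_affine[where p = "\<lambda>n. GS (\<lambda>i j. (qq P \<eta> S n i j)\<^sup>2)" and q = "\<lambda>n. GS (\<lambda>i j. (rr P \<eta> S n i j)\<^sup>2)"])
  also have "\<dots> \<le> K * (transport_constant CW * rate)"
  proof (intro mult_left_mono K_nonneg)
    have T0: "0 \<le> Tend P" using Tend_pos by simp
    have "0 \<le> CW" using CW[OF nt_pos] GS_nonneg[of "\<lambda>i j. (w 0 i j)\<^sup>2"] by simp
    then have CW0: "0 \<le> Tend P * CW" using T0 by simp
    have c0: "0 \<le> Tend P * (hhi\<^sup>2 * CU + CW)"
      using CW0 T0 CU_nonneg by (simp add: distrib_left)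
    have s: "dt S * (1 / (2 * sqrt (dt S))) = sqrt (dt S) / 2"
      using dt_pos by (simp add: real_div_sqrt)
    have "dt S * (1 / (2 * sqrt (dt S))) * ((\<Sum>n<nt S. GS (\<lambda>i j. (qq P \<eta> S n i j)\<^sup>2)) + (\<Sum>n<nt S. GS (\<lambda>i j. (rr P \<eta> S n i j)\<^sup>2)))
      \<le> sqrt (dt S) / 2 * (2 * (\<eta>\<^sup>2 * CD))"
      unfolding s using stabilisation_sum dt_pos by (intro mult_left_mono) auto
    also have "\<dots> \<le> \<eta>\<^sup>2 * CD * rate" using mult_left_mono[OF rate_bounds(2), of "\<eta>\<^sup>2 * CD"] CD_nonneg by (simp add: mult.commute)
    finally have 1: "dt S * (1 / (2 * sqrt (dt S))) * ((\<Sum>n<nt S. GS (\<lambda>i j. (qq P \<eta> S n i j)\<^sup>2)) + (\<Sum>n<nt S. GS (\<lambda>i j. (rr P \<eta> S n i j)\<^sup>2))) \<le> \<eta>\<^sup>2 * CD * rate" .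
    have 2: "2 * (Tend P * CW) * sqrt (dt S) \<le> 2 * (Tend P * CW) * rate"
      using CW0 rate_bounds(2) by (intro mult_left_mono) auto
    have 3: "2 * (Tend P * (hhi\<^sup>2 * CU + CW)) * (dt S + dx S + dy S) \<le> 2 * (Tend P * (hhi\<^sup>2 * CU + CW)) * rate"
      using c0 rate_bounds(3) by (intro mult_left_mono) auto
    have "Tend P * (2 * sqrt (dt S) * CW + (hhi\<^sup>2 * CU + CW) * (2 * dt S + 2 * dx S + 2 * dy S))
      = 2 * (Tend P * CW) * sqrt (dt S) + 2 * (Tend P * (hhi\<^sup>2 * CU + CW)) * (dt S + dx S + dy S)"
      by (simp add: algebra_simps)
    moreover have "transport_constant CW * rate = \<eta>\<^sup>2 * CD * rate + 2 * (Tend P * CW) * rate + 2 * (Tend P * (hhi\<^sup>2 * CU + CW)) * rate"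
      by (simp add: transport_constant_def algebra_simps)
    ultimately show "dt S * (1 / (2 * sqrt (dt S))) * ((\<Sum>n<nt S. GS (\<lambda>i j. (qq P \<eta> S n i j)\<^sup>2)) + (\<Sum>n<nt S. GS (\<lambda>i j. (rr P \<eta> S n i j)\<^sup>2)))
      + Tend P * (2 * sqrt (dt S) * CW + (hhi\<^sup>2 * CU + CW) * (2 * dt S + 2 * dx S + 2 * dy S)) \<le> transport_constant CW * rate"
      using 1 2 3 by linarith
  qed
  finally have "\<bar>(\<Sum>n<nt S. dt S * (- (Rx n + Ry n))) - spacetime_sum P S B\<bar> \<le> K * (transport_constant CW * rate)" .
  then show ?thesis unfolding residual[symmetric] W_def \<psi>1_def by (simp only: mult.assoc)
qed

end

section \<open>Consistency of mass, pressure and topography terms\<close>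

context sw_mesh
begin

lemma pc_mean_x: "pc M (mean_x z) p = (pc M z p + pc M z (p + (dx M, 0))) / 2"
  using pc_shift_x[of z 1 p] by (simp add: mean_x_def pc_def)

lemma pc_mean_y: "pc M (mean_y z) p = (pc M z p + pc M z (p + (0, dy M))) / 2"
  using pc_shift_y[of z 1 p] by (simp add: mean_y_def pc_def)

lemma pc_eth_x: "pc M (eth_x M z) p = (pc M z (p + (dx M, 0)) - pc M z (p - (dx M, 0))) / (2 * dx M)"
proof -
  have "eth_x M z i j = (z (i + 1) j - z (i - 1) j) / (2 * dx M)" for i j
    using dx_pos by (simp add: eth_x_def mean_x_def field_simps)
  moreover have d: "p - (dx M, 0) = p + (- dx M, 0)" by (simp add: prod_eq_iff)
  moreover note pc_shift_x[of z 1 p] pc_shift_x[of z "- 1" p]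
  ultimately show ?thesis by (simp add: pc_def)
qed

lemma pc_eth_y: "pc M (eth_y M z) p = (pc M z (p + (0, dy M)) - pc M z (p - (0, dy M))) / (2 * dy M)"
proof -
  have "eth_y M z i j = (z i (j + 1) - z i (j - 1)) / (2 * dy M)" for i j
    using dy_pos by (simp add: eth_y_def mean_y_def field_simps)
  moreover have d: "p - (0, dy M) = p + (0, - dy M)" by (simp add: prod_eq_iff)
  moreover note pc_shift_y[of z 1 p] pc_shift_y[of z "- 1" p]
  ultimately show ?thesis by (simp add: pc_def)
qed

lemma distance_to_cell_centre:
  "norm (p - (xc M \<lfloor>(fst p - x0 M) / dx M + 1/2\<rfloor>, yc M \<lfloor>(snd p - y0 M) / dy M + 1/2\<rfloor>)) \<le> dx M + dy M"
proof -
  have *: "\<bar>t - (o' + of_int \<lfloor>(t - o') / d + 1/2\<rfloor> * d)\<bar> \<le> d" if d: "d > 0" for t o' d :: real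
  proof -
    define k where "k = of_int \<lfloor>(t - o') / d + 1/2\<rfloor> - (t - o') / d"
    have "\<bar>k\<bar> \<le> 1" unfolding k_def by linarith
    then have "\<bar>k * d\<bar> \<le> d" using d by (simp add: abs_mult)
    moreover have "t - (o' + of_int \<lfloor>(t - o') / d + 1/2\<rfloor> * d) = - (k * d)"
    proof -
      have qd: "(t - o') / d * d = t - o'" using d by simp
      show ?thesis unfolding k_def left_diff_distrib qd by simp
    qed
    ultimately show ?thesis by simp
  qed
  have "norm (p - (xc M \<lfloor>(fst p - x0 M) / dx M + 1/2\<rfloor>, yc M \<lfloor>(snd p - y0 M) / dy M + 1/2\<rfloor>))
    \<le> norm (fst p - xc M \<lfloor>(fst p - x0 M) / dx M + 1/2\<rfloor>) + norm (snd p - yc M \<lfloor>(snd p - y0 M) / dy M + 1/2\<rfloor>)"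
    using norm_Pair_le[of "fst p - xc M \<lfloor>(fst p - x0 M) / dx M + 1/2\<rfloor>" "snd p - yc M \<lfloor>(snd p - y0 M) / dy M + 1/2\<rfloor>"]
    by (cases p) (simp del: norm_Pair_le)
  also have "\<dots> \<le> dx M + dy M"
    using *[OF dx_pos, of "fst p" "x0 M"] *[OF dy_pos, of "snd p" "y0 M"] by (simp add: xc_def yc_def)
  finally show ?thesis .
qed

end

context sw_test
begin

text \<open>
  The mass equation is transport of the constant 1. Its weak form has momenta on the primal cells, which
  replace the averaged momenta on the dual cells by the lemma on averaged shifts.
\<close>
lemma mass_consistency:
  "\<bar>- TI (\<lambda>z. pc S (h 0) z * \<psi> (0, z)) - spacetime_sum P S (\<lambda>n t z.
      pc S (h n) z * dt_test \<psi> (t, z) + pc S (h (n + 1)) z * pc S (u n) z * dx_test \<psi> (t, z)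
      + pc S (h (n + 1)) z * pc S (v n) z * dy_test \<psi> (t, z))\<bar>
    \<le> K * (transport_constant area + Tend P * (hhi\<^sup>2 * CU + area)) * rate"
proof -
  define w :: "nat \<Rightarrow> grid" where "w = (\<lambda>n i j. 1)"
  define g where "g n t z = pc S (h n) z * dt_test \<psi> (t, z) + pc S (h (n + 1)) z * pc S (u n) z * dx_test \<psi> (t, z)
      + pc S (h (n + 1)) z * pc S (v n) z * dy_test \<psi> (t, z)" for n t z
  have w: "grid_periodic S (w n)" for n by (simp add: w_def gp_const)
  have CW: "GS (\<lambda>i j. (w n i j)\<^sup>2) \<le> area" for n by (simp add: w_def GS_const)
  have up: "pc_Dx S (upw_x P \<eta> S w n) z = 1" "pc_Dy S (upw_y P \<eta> S w n) z = 1" "pc S (w n) z = 1" for n z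
    by (simp_all add: w_def upw_x_def upw_y_def pc_Dx_def pc_Dy_def pc_def)
  have T0: "pc S (transport P \<eta> S w n) z = 0" if "n < nt S" for n z
    using sol that unfolding numerical_solution_def mass_equation_def pc_def transport_def
    by (simp add: w_def upw_x_def upw_y_def)
  have "(\<Sum>n<nt S. dt S * TI (\<lambda>z. pc S (transport P \<eta> S w n) z * \<psi> (time S (n + 1), z))) = 0"
    by (intro sum.neutral ballI) (simp add: T0)
  then have A: "\<bar>- TI (\<lambda>z. pc S (h 0) z * \<psi> (0, z)) - spacetime_sum P S (transport_form w)\<bar> \<le> K * transport_constant area * rate"
    using transport_consistency[of w area, OF w CW] by (simp add: up)
  have Lhw: "Linf (\<lambda>z. pc S (h (n + 1)) z * pc S (u n) z)" "Linf (\<lambda>z. pc S (h (n + 1)) z * pc S (v n) z)" if "n < nt S" for n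
    using that by (intro Linf_mult Linf_pc gp_huv; simp)+
  have okg: "st_ok g"
    unfolding g_def[abs_def]
    by (intro st_add st_basic good_t good_x good_y Linf_tintegrable Lhw Linf_pc gp_huv) auto
  note okT = st_ok_transport[of w, OF w]
  have "\<bar>spacetime_sum P S (\<lambda>n t z. transport_form w n t z - g n t z) - (\<Sum>n<nt S. dt S * 0)\<bar>
    \<le> (\<Sum>n<nt S. dt S * (K * (dx S + dy S) * (hhi\<^sup>2 * CU + area)))"
  proof (rule st_bound[OF st_diff(1)[OF okT okg]])
    fix n t assume n: "n < nt S" and t: "t \<in> {time S n..time S (n + 1)}"
    have tr: "t \<in> {0..Tend P}" using step_subset[OF n] t by auto
    define Gu where "Gu z = pc S (h (n + 1)) z * pc S (u n) z" for z
    define Gv where "Gv z = pc S (h (n + 1)) z * pc S (v n) z" for z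
    define px where "px z = (Gu (z - (dx S / 2) *\<^sub>R (1, 0)) + Gu (z + (dx S / 2) *\<^sub>R (1, 0))) / 2" for z
    define py where "py z = (Gv (z - (dy S / 2) *\<^sub>R (0, 1)) + Gv (z + (dy S / 2) *\<^sub>R (0, 1))) / 2" for z
    have L: "Linf Gu" "Linf Gv" unfolding Gu_def[abs_def] Gv_def[abs_def] using Lhw[OF n] by auto
    have Lp: "Linf px" "Linf py" unfolding px_def[abs_def] py_def[abs_def]
      by (intro Linf_divide Linf_add Linf_translate Linf_translate_minus L)+
    have mx: "pc_Dx S (m_x S n) z = px z" for z
    proof -
      have e: "z - (1/2) *\<^sub>R (dx S, 0) = z - (dx S / 2) *\<^sub>R (1, 0)"
        "z - (dx S / 2) *\<^sub>R (1, 0) + (dx S, 0) = z + (dx S / 2) *\<^sub>R (1, 0)" by (simp_all add: prod_eq_iff)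
      have "pc_Dx S (m_x S n) z = (Gu (z - (1/2) *\<^sub>R (dx S, 0)) + Gu (z - (1/2) *\<^sub>R (dx S, 0) + (dx S, 0))) / 2"
        unfolding pc_Dx_eq m_x_def pc_mean_x by (simp add: Gu_def pc_def)
      then show ?thesis unfolding e px_def .
    qed
    have my: "pc_Dy S (m_y S n) z = py z" for z
    proof -
      have e: "z - (1/2) *\<^sub>R (0, dy S) = z - (dy S / 2) *\<^sub>R (0, 1)"
        "z - (dy S / 2) *\<^sub>R (0, 1) + (0, dy S) = z + (dy S / 2) *\<^sub>R (0, 1)" by (simp_all add: prod_eq_iff)
      have "pc_Dy S (m_y S n) z = (Gv (z - (1/2) *\<^sub>R (0, dy S)) + Gv (z - (1/2) *\<^sub>R (0, dy S) + (0, dy S))) / 2"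
        unfolding pc_Dy_eq m_y_def pc_mean_y by (simp add: Gv_def pc_def)
      then show ?thesis unfolding e py_def .
    qed
    note LD = good_Linf[OF good_x tr] good_Linf[OF good_y tr]
    have "TI (\<lambda>z. transport_form w n t z - g n t z)
      = TI (\<lambda>z. (px z * dx_test \<psi> (t, z) - Gu z * dx_test \<psi> (t, z)) + (py z * dy_test \<psi> (t, z) - Gv z * dy_test \<psi> (t, z)))"
      by (simp add: transport_form_def g_def up mx my Gu_def Gv_def algebra_simps)
    also have "\<dots> = (TI (\<lambda>z. px z * dx_test \<psi> (t, z)) - TI (\<lambda>z. Gu z * dx_test \<psi> (t, z)))
        + (TI (\<lambda>z. py z * dy_test \<psi> (t, z)) - TI (\<lambda>z. Gv z * dy_test \<psi> (t, z)))"
      using TI_add[OF Linf_diff[OF Linf_mult[OF Lp(1) LD(1)] Linf_mult[OF L(1) LD(1)]] Linf_diff[OF Linf_mult[OF Lp(2) LD(2)] Linf_mult[OF L(2) LD(2)]]]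
        TI_diff[OF Linf_mult[OF Lp(1) LD(1)] Linf_mult[OF L(1) LD(1)]] TI_diff[OF Linf_mult[OF Lp(2) LD(2)] Linf_mult[OF L(2) LD(2)]]
      by (simp only:)
    finally have E: "TI (\<lambda>z. transport_form w n t z - g n t z) = (TI (\<lambda>z. px z * dx_test \<psi> (t, z)) - TI (\<lambda>z. Gu z * dx_test \<psi> (t, z)))
        + (TI (\<lambda>z. py z * dy_test \<psi> (t, z)) - TI (\<lambda>z. Gv z * dy_test \<psi> (t, z)))" .
    have bu: "TI (\<lambda>z. \<bar>Gu z\<bar>) \<le> hhi\<^sup>2 * CU + area"
    proof -
      have "(\<lambda>z. \<bar>Gu z\<bar>) = (\<lambda>z. \<bar>pc S (\<lambda>i j. h (n + 1) i j * u n i j) z\<bar>)" by (simp add: Gu_def[abs_def] pc_def[abs_def])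
      moreover have "TI (\<lambda>z. \<bar>pc S (\<lambda>i j. h (n + 1) i j * u n i j) z\<bar>) \<le> hhi\<^sup>2 * CU + area"
        using n GS_abs_hw[OF n u_bound] by (subst TI_abs_pc) (auto intro!: gp_mult gp_huv)
      ultimately show ?thesis by (simp only:)
    qed
    have bv: "TI (\<lambda>z. \<bar>Gv z\<bar>) \<le> hhi\<^sup>2 * CU + area"
    proof -
      have "(\<lambda>z. \<bar>Gv z\<bar>) = (\<lambda>z. \<bar>pc S (\<lambda>i j. h (n + 1) i j * v n i j) z\<bar>)" by (simp add: Gv_def[abs_def] pc_def[abs_def])
      moreover have "TI (\<lambda>z. \<bar>pc S (\<lambda>i j. h (n + 1) i j * v n i j) z\<bar>) \<le> hhi\<^sup>2 * CU + area"
        using n GS_abs_hw[OF n v_bound] by (subst TI_abs_pc) (auto intro!: gp_mult gp_huv)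
      ultimately show ?thesis by (simp only:)
    qed
    have ex: "\<bar>TI (\<lambda>z. px z * dx_test \<psi> (t, z)) - TI (\<lambda>z. Gu z * dx_test \<psi> (t, z))\<bar> \<le> K * dx S * TI (\<lambda>z. \<bar>Gu z\<bar>)"
      unfolding px_def by (rule averaged_shift_consistency[OF _ good_x dx_pos L(1) tr]) simp
    also have "\<dots> \<le> K * dx S * (hhi\<^sup>2 * CU + area)"
      using bu K_nonneg dx_pos by (intro mult_left_mono) auto
    finally have ex: "\<bar>TI (\<lambda>z. px z * dx_test \<psi> (t, z)) - TI (\<lambda>z. Gu z * dx_test \<psi> (t, z))\<bar> \<le> K * dx S * (hhi\<^sup>2 * CU + area)" .
    have ey: "\<bar>TI (\<lambda>z. py z * dy_test \<psi> (t, z)) - TI (\<lambda>z. Gv z * dy_test \<psi> (t, z))\<bar> \<le> K * dy S * TI (\<lambda>z. \<bar>Gv z\<bar>)"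
      unfolding py_def by (rule averaged_shift_consistency[OF _ good_y dy_pos L(2) tr]) simp
    also have "\<dots> \<le> K * dy S * (hhi\<^sup>2 * CU + area)"
      using bv K_nonneg dy_pos by (intro mult_left_mono) auto
    finally have ey: "\<bar>TI (\<lambda>z. py z * dy_test \<psi> (t, z)) - TI (\<lambda>z. Gv z * dy_test \<psi> (t, z))\<bar> \<le> K * dy S * (hhi\<^sup>2 * CU + area)" .
    have tri: "\<bar>a + b - 0\<bar> \<le> p + q" if "\<bar>a\<bar> \<le> p" "\<bar>b\<bar> \<le> q" for a b p q :: real using that by linarith
    have "K * (dx S + dy S) * (hhi\<^sup>2 * CU + area) = K * dx S * (hhi\<^sup>2 * CU + area) + K * dy S * (hhi\<^sup>2 * CU + area)"
      by (simp only: distrib_left distrib_right)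
    then show "\<bar>TI (\<lambda>z. transport_form w n t z - g n t z) - 0\<bar> \<le> K * (dx S + dy S) * (hhi\<^sup>2 * CU + area)"
      unfolding E using tri[OF ex ey] by (simp only:)
  qed
  then have B: "\<bar>spacetime_sum P S (transport_form w) - spacetime_sum P S g\<bar> \<le> Tend P * (K * (dx S + dy S) * (hhi\<^sup>2 * CU + area))"
    unfolding st_diff(2)[OF okT okg] sum_dt by simp
  have c0: "0 \<le> K * (Tend P * (hhi\<^sup>2 * CU + area))"
    using K_nonneg Tend_pos CU_nonneg Lx_pos Ly_pos by (intro mult_nonneg_nonneg add_nonneg_nonneg) auto
  have "Tend P * (K * (dx S + dy S) * (hhi\<^sup>2 * CU + area)) = K * (Tend P * (hhi\<^sup>2 * CU + area)) * (dx S + dy S)" by simp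
  also have "\<dots> \<le> K * (Tend P * (hhi\<^sup>2 * CU + area)) * rate"
    using c0 rate_bounds(3) dt_pos by (intro mult_left_mono) auto
  finally have C: "Tend P * (K * (dx S + dy S) * (hhi\<^sup>2 * CU + area)) \<le> K * (Tend P * (hhi\<^sup>2 * CU + area)) * rate" .
  have "\<bar>- TI (\<lambda>z. pc S (h 0) z * \<psi> (0, z)) - spacetime_sum P S g\<bar> \<le> K * transport_constant area * rate + K * (Tend P * (hhi\<^sup>2 * CU + area)) * rate"
    using A B C by linarith
  also have "\<dots> = K * (transport_constant area + Tend P * (hhi\<^sup>2 * CU + area)) * rate"
    by (simp only: distrib_left distrib_right)
  finally show ?thesis unfolding g_def .
qed

definition H :: "nat \<Rightarrow> real \<times> real \<Rightarrow> real" where "H n = pc S (h (n + 1))"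

lemma Linf_H: "n < nt S \<Longrightarrow> Linf (H n)"
  unfolding H_def by (intro Linf_pc gp_huv) simp

lemma H_bounds: "n < nt S \<Longrightarrow> 0 < H n z" "n < nt S \<Longrightarrow> H n z \<le> hhi"
  using h_pos[of "n + 1"] h_bounds(2)[of "n + 1"] by (auto simp: H_def pc_def)

lemma H_abs: "n < nt S \<Longrightarrow> \<bar>H n z\<bar> \<le> hhi"
  using H_bounds[of n z] by simp

lemma TI_bounded: "Linf f \<Longrightarrow> (\<And>z. \<bar>f z\<bar> \<le> c) \<Longrightarrow> TI (\<lambda>z. \<bar>f z\<bar>) \<le> c * area"
proof -
  assume f: "Linf f" "\<And>z. \<bar>f z\<bar> \<le> c"
  have "TI (\<lambda>z. \<bar>f z\<bar>) \<le> TI (\<lambda>z. c)" by (intro TI_mono Linf_abs Linf_const f)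
  also have "TI (\<lambda>z. c) = GS (\<lambda>i j. c)" using TI_pc[OF gp_const, of c] by (simp add: pc_def[abs_def])
  finally show ?thesis by (simp add: GS_const)
qed

text \<open>
  The identity \<open>h\<^sub>i * (h\<^sub>i\<^sub>+\<^sub>1 - h\<^sub>i\<^sub>-\<^sub>1) = h\<^sub>i * h\<^sub>i\<^sub>+\<^sub>1 - h\<^sub>i\<^sub>-\<^sub>1 * h\<^sub>i\<close> writes the
  nonconservative pressure gradient as a divergence of the flux \<open>f\<close>. This flux differs from the mean \<open>g\<close> of
  neighbouring values of \<open>h\<^sup>2 / 2\<close> by a quarter of the squared jump of \<open>h\<close>, and squared jumps are small by
  the hypothesis on the gradient of \<open>h\<close>.
\<close>
lemma pressure_consistency:
  assumes e: "norm e = 1" "good (pdiff (0, e) \<psi>)" and s: "s > 0" and n: "n < nt S"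
    and jump: "TI (\<lambda>z. (H n (z + s *\<^sub>R e) - H n z)\<^sup>2) \<le> J * s" and t: "t \<in> {time S n..time S (n + 1)}"
  shows "\<bar>TI (\<lambda>z. H n z * ((H n (z + s *\<^sub>R e) - H n (z - s *\<^sub>R e)) / (2 * s)) * \<psi> (time S (n + 1), z))
      + TI (\<lambda>z. (H n z)\<^sup>2 / 2 * pdiff (0, e) \<psi> (t, z))\<bar>
    \<le> K * ((J / 4 + 2 * (hhi\<^sup>2 * area)) * (dt S + s))"
proof -
  have tr: "t \<in> {0..Tend P}" "time S (n + 1) \<in> {0..Tend P}" using step_subset[OF n] t by auto
  have td: "\<bar>time S (n + 1) - t\<bar> \<le> dt S" using t by (auto simp: time_Suc)
  define G where "G z = (H n z)\<^sup>2 / 2" for z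
  define f where "f z = H n z * H n (z + s *\<^sub>R e) / 2" for z
  define g where "g z = (G z + G (z + s *\<^sub>R e)) / 2" for z
  have LH: "Linf (H n)" by (rule Linf_H[OF n])
  have LG: "Linf G" unfolding G_def[abs_def] by (intro Linf_divide Linf_power2 LH)
  have Lf: "Linf f" unfolding f_def[abs_def] by (intro Linf_divide Linf_mult LH Linf_translate[OF LH])
  have Lg: "Linf g" unfolding g_def[abs_def] by (intro Linf_divide Linf_add LG Linf_translate[OF LG])
  have G0: "0 \<le> G z" "G z \<le> hhi\<^sup>2 / 2" for z
    using H_bounds[OF n, of z] by (auto simp: G_def intro!: power_mono)
  have G: "TI (\<lambda>z. \<bar>G z\<bar>) \<le> hhi\<^sup>2 / 2 * area" using G0 by (intro TI_bounded LG) auto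
  have g: "TI (\<lambda>z. \<bar>g z\<bar>) \<le> hhi\<^sup>2 / 2 * area"
  proof (intro TI_bounded Lg)
    fix z
    have "0 \<le> g z" using G0(1)[of z] G0(1)[of "z + s *\<^sub>R e"] by (simp add: g_def)
    moreover have "g z \<le> (hhi\<^sup>2 / 2 + hhi\<^sup>2 / 2) / 2"
      unfolding g_def by (intro divide_right_mono add_mono G0) simp
    ultimately show "\<bar>g z\<bar> \<le> hhi\<^sup>2 / 2" by simp
  qed
  have fg: "TI (\<lambda>z. \<bar>f z - g z\<bar>) \<le> J * s / 4"
  proof -
    have "\<bar>f z - g z\<bar> = 1 / 4 * (H n (z + s *\<^sub>R e) - H n z)\<^sup>2" for z
    proof -
      have "f z - g z = - (1 / 4 * (H n (z + s *\<^sub>R e) - H n z)\<^sup>2)"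
        by (simp add: f_def g_def G_def power2_eq_square field_simps)
      then show ?thesis by simp
    qed
    then have "TI (\<lambda>z. \<bar>f z - g z\<bar>) = 1 / 4 * TI (\<lambda>z. (H n (z + s *\<^sub>R e) - H n z)\<^sup>2)" by (simp only: TI_cmult)
    then show ?thesis using jump by simp
  qed
  have flux: "(f z - f (z - s *\<^sub>R e)) / s = H n z * ((H n (z + s *\<^sub>R e) - H n (z - s *\<^sub>R e)) / (2 * s))" for z
    using s by (simp add: f_def field_simps)
  have av: "g (z - (s / 2) *\<^sub>R e) = (G (z - (s / 2) *\<^sub>R e) + G (z + (s / 2) *\<^sub>R e)) / 2" for z
  proof -
    have "s *\<^sub>R e = (s / 2) *\<^sub>R e + (s / 2) *\<^sub>R e" by (simp add: scaleR_add_left[symmetric])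
    then have "z - (s / 2) *\<^sub>R e + s *\<^sub>R e = z + (s / 2) *\<^sub>R e" by simp
    then show ?thesis by (simp only: g_def)
  qed
  have "K * (TI (\<lambda>z. \<bar>f z - g z\<bar>) + TI (\<lambda>z. \<bar>g z\<bar>) * (\<bar>time S (n + 1) - t\<bar> + 2 * s))
    \<le> K * (J * s / 4 + hhi\<^sup>2 / 2 * area * (dt S + 2 * s))"
    using fg g td s K_nonneg Lx_pos Ly_pos by (intro mult_left_mono add_mono mult_mono) auto
  then have 1: "\<bar>TI (\<lambda>z. H n z * ((H n (z + s *\<^sub>R e) - H n (z - s *\<^sub>R e)) / (2 * s)) * \<psi> (time S (n + 1), z))
      + TI (\<lambda>z. g (z - (s / 2) *\<^sub>R e) * pdiff (0, e) \<psi> (t, z))\<bar> \<le> K * (J * s / 4 + hhi\<^sup>2 / 2 * area * (dt S + 2 * s))"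
    using flux_consistency[OF e s Lf Lg tr] unfolding flux by linarith
  have "K * s * TI (\<lambda>z. \<bar>G z\<bar>) \<le> K * s * (hhi\<^sup>2 / 2 * area)" using G K_nonneg s by (intro mult_left_mono) auto
  then have 2: "\<bar>TI (\<lambda>z. g (z - (s / 2) *\<^sub>R e) * pdiff (0, e) \<psi> (t, z)) - TI (\<lambda>z. G z * pdiff (0, e) \<psi> (t, z))\<bar> \<le> K * s * (hhi\<^sup>2 / 2 * area)"
    unfolding av using averaged_shift_consistency[OF e(1) e(2) s LG tr(1)] by linarith
  have tri: "\<bar>a + c\<bar> \<le> p + q" if "\<bar>a + b\<bar> \<le> p" "\<bar>b - c\<bar> \<le> q" for a b c p q :: real using that by linarith
  have J0: "0 \<le> J"
  proof -
    have "0 \<le> TI (\<lambda>z. (H n (z + s *\<^sub>R e) - H n z)\<^sup>2)" by (rule tint_nonneg) simp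
    then have "0 \<le> J * s" using jump by linarith
    then show ?thesis using s by (simp add: zero_le_mult_iff)
  qed
  have "K * (J * s / 4 + hhi\<^sup>2 / 2 * area * (dt S + 2 * s)) + K * s * (hhi\<^sup>2 / 2 * area)
    = K * (J / 4 * s + hhi\<^sup>2 * area * (dt S / 2 + 3 / 2 * s))" by (simp add: field_simps)
  also have "\<dots> \<le> K * (J / 4 * (dt S + s) + hhi\<^sup>2 * area * (2 * (dt S + s)))"
    using J0 s dt_pos K_nonneg Lx_pos Ly_pos by (intro mult_left_mono add_mono) auto
  also have "\<dots> = K * ((J / 4 + 2 * (hhi\<^sup>2 * area)) * (dt S + s))" by (simp add: algebra_simps)
  finally show ?thesis using tri[OF 1 2] unfolding G_def by linarith
qed

text \<open>
  Only averages of \<open>bx\<close> over cells are comparable with the discrete slope \<open>\<beta>\<close>. Therefore \<open>\<psi>\<close> is first replaced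
  by its values at the cell centres, in both terms; then the product of \<open>h\<close> and these values is constant
  on cells and the hypothesis on single cells applies.
\<close>
lemma bottom_consistency:
  assumes n: "n < nt S" and t: "t \<in> {time S n..time S (n + 1)}"
    and \<beta>: "grid_periodic S \<beta>" "\<And>i j. \<bar>\<beta> i j\<bar> \<le> C\<beta>" and bx: "TIable bx"
    and cell: "\<And>i j. \<bar>\<beta> i j * (dx S * dy S) - TI (\<lambda>z. cell_ind i j z * bx z)\<bar> \<le> C * (dx S * dy S)"
  shows "\<bar>TI (\<lambda>z. H n z * pc S \<beta> z * \<psi> (time S (n + 1), z)) - TI (\<lambda>z. bx z * H n z * \<psi> (t, z))\<bar>
    \<le> K * hhi * (C\<beta> * area * (dx S + dy S) + TI (\<lambda>z. \<bar>bx z\<bar>) * (dt S + dx S + dy S) + C * area)"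
proof -
  have tr: "t \<in> {0..Tend P}" "time S (n + 1) \<in> {0..Tend P}" using step_subset[OF n] t by auto
  have td: "\<bar>time S (n + 1) - t\<bar> \<le> dt S" using t by (auto simp: time_Suc)
  \<comment> \<open>The test function sampled at the cell centres is a periodic grid function.\<close>
  define \<psi>c where "\<psi>c i j = \<psi> (time S (n + 1), (xc S i, yc S j))" for i j
  have gc: "grid_periodic S \<psi>c"
  proof -
    have "xc S (i + int (nx S)) = xc S i + Lx P" for i using nx_dx by (simp add: xc_def distrib_right)
    moreover have "yc S (j + int (ny S)) = yc S j + Ly P" for j using ny_dy by (simp add: yc_def distrib_right)
    ultimately show ?thesis using periodic_psi unfolding grid_periodic_def \<psi>c_def doubly_periodic_def by simp
  qed
  have close: "\<bar>\<psi> (t', z) - pc S \<psi>c z\<bar> \<le> K * (\<bar>t' - time S (n + 1)\<bar> + (dx S + dy S))" if "t' \<in> {0..Tend P}" for t' z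
  proof -
    have "\<bar>\<psi> (t', z) - pc S \<psi>c z\<bar> \<le> K * (\<bar>t' - time S (n + 1)\<bar> + norm (z - (xc S \<lfloor>(fst z - x0 S) / dx S + 1/2\<rfloor>, yc S \<lfloor>(snd z - y0 S) / dy S + 1/2\<rfloor>)))"
      unfolding pc_def \<psi>c_def by (rule good_lipschitz[OF good_psi that tr(2)])
    also have "\<dots> \<le> K * (\<bar>t' - time S (n + 1)\<bar> + (dx S + dy S))"
      using distance_to_cell_centre[of z] K_nonneg by (intro mult_left_mono add_left_mono) auto
    finally show ?thesis .
  qed
  have Lc: "Linf (pc S \<psi>c)" and Lb: "Linf (pc S \<beta>)" by (intro Linf_pc gc \<beta>)+
  note LH = Linf_H[OF n] and Lp = good_Linf[OF good_psi tr(2)] and Lpt = good_Linf[OF good_psi tr(1)]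
  have mH: "H n \<in> borel_measurable borel" using LH by (simp add: Linf_torus_def)
  have bH: "TIable (\<lambda>z. bx z * H n z)" by (rule tintegrable_mult_bounded[OF bx mH H_abs[OF n]])
  have C\<beta>0: "0 \<le> C\<beta>" using \<beta>(2)[of 0 0] by linarith
  have 1: "\<bar>TI (\<lambda>z. H n z * pc S \<beta> z * \<psi> (time S (n + 1), z)) - TI (\<lambda>z. H n z * pc S \<beta> z * pc S \<psi>c z)\<bar>
    \<le> K * (dx S + dy S) * (hhi * C\<beta> * area)"
  proof -
    have "TI (\<lambda>z. H n z * pc S \<beta> z * \<psi> (time S (n + 1), z)) - TI (\<lambda>z. H n z * pc S \<beta> z * pc S \<psi>c z)
      = TI (\<lambda>z. H n z * pc S \<beta> z * (\<psi> (time S (n + 1), z) - pc S \<psi>c z))"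
      unfolding right_diff_distrib by (intro TI_diff[symmetric] Linf_mult LH Lb Lp Lc)
    moreover have "\<bar>TI (\<lambda>z. H n z * pc S \<beta> z * (\<psi> (time S (n + 1), z) - pc S \<psi>c z))\<bar> \<le> K * (dx S + dy S) * TI (\<lambda>z. \<bar>H n z * pc S \<beta> z\<bar>)"
    proof (rule tint_mult_bound[OF Linf_tintegrable[OF Linf_mult[OF LH Lb]]])
      show "(\<lambda>z. \<psi> (time S (n + 1), z) - pc S \<psi>c z) \<in> borel_measurable borel"
        using Linf_diff[OF Lp Lc] by (simp add: Linf_torus_def)
      show "\<bar>\<psi> (time S (n + 1), z) - pc S \<psi>c z\<bar> \<le> K * (dx S + dy S)" for z using close[OF tr(2), of z] by simp
    qed
    moreover have "TI (\<lambda>z. \<bar>H n z * pc S \<beta> z\<bar>) \<le> hhi * C\<beta> * area"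
    proof (intro TI_bounded Linf_mult LH Lb)
      show "\<bar>H n z * pc S \<beta> z\<bar> \<le> hhi * C\<beta>" for z
        unfolding abs_mult using H_abs[OF n, of z] pc_bound[of \<beta>, OF \<beta>(2)] hhi_pos by (intro mult_mono) auto
    qed
    moreover have "0 \<le> K * (dx S + dy S)" using K_nonneg dx_pos dy_pos by simp
    ultimately show ?thesis using mult_left_mono[of "TI (\<lambda>z. \<bar>H n z * pc S \<beta> z\<bar>)" "hhi * C\<beta> * area" "K * (dx S + dy S)"] by linarith
  qed
  have 2: "\<bar>TI (\<lambda>z. bx z * H n z * \<psi> (t, z)) - TI (\<lambda>z. bx z * H n z * pc S \<psi>c z)\<bar>
    \<le> K * (dt S + dx S + dy S) * (hhi * TI (\<lambda>z. \<bar>bx z\<bar>))"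
  proof -
    have mc: "pc S \<psi>c \<in> borel_measurable borel" by (rule pc_measurable)
    have bc: "\<bar>pc S \<psi>c z\<bar> \<le> K" for z
      unfolding pc_def \<psi>c_def by (rule good_bound[OF good_psi tr(2)])
    have "TI (\<lambda>z. bx z * H n z * \<psi> (t, z)) - TI (\<lambda>z. bx z * H n z * pc S \<psi>c z)
      = TI (\<lambda>z. bx z * H n z * (\<psi> (t, z) - pc S \<psi>c z))"
      unfolding right_diff_distrib
      by (intro set_integral_diff(2)[symmetric] tintegrable_mult_bounded[OF bH mc bc] good_TIable[OF bH good_psi tr(1)])
    moreover have "\<bar>TI (\<lambda>z. bx z * H n z * (\<psi> (t, z) - pc S \<psi>c z))\<bar> \<le> K * (dt S + dx S + dy S) * TI (\<lambda>z. \<bar>bx z * H n z\<bar>)"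
    proof (rule tint_mult_bound[OF bH])
      show "(\<lambda>z. \<psi> (t, z) - pc S \<psi>c z) \<in> borel_measurable borel"
        using Linf_diff[OF Lpt Lc] by (simp add: Linf_torus_def)
      fix z
      have "\<bar>t - time S (n + 1)\<bar> + (dx S + dy S) \<le> dt S + dx S + dy S" using td by (simp add: abs_minus_commute)
      then show "\<bar>\<psi> (t, z) - pc S \<psi>c z\<bar> \<le> K * (dt S + dx S + dy S)"
        using close[OF tr(1), of z] mult_left_mono[OF _ K_nonneg] order_trans by blast
    qed
    moreover have "TI (\<lambda>z. \<bar>bx z * H n z\<bar>) \<le> hhi * TI (\<lambda>z. \<bar>bx z\<bar>)"
    proof -
      have "TI (\<lambda>z. \<bar>bx z * H n z\<bar>) \<le> TI (\<lambda>z. hhi * \<bar>bx z\<bar>)"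
      proof (intro set_integral_mono set_integrable_abs bH)
        show "TIable (\<lambda>z. hhi * \<bar>bx z\<bar>)" using set_integrable_abs[OF bx] by simp
        show "\<bar>bx z * H n z\<bar> \<le> hhi * \<bar>bx z\<bar>" for z
          unfolding abs_mult using mult_left_mono[OF H_abs[OF n, of z], of "\<bar>bx z\<bar>"] by (simp add: mult.commute)
      qed
      then show ?thesis by (simp only: TI_cmult)
    qed
    moreover have "0 \<le> K * (dt S + dx S + dy S)" using K_nonneg dx_pos dy_pos dt_pos by simp
    ultimately show ?thesis using mult_left_mono[of "TI (\<lambda>z. \<bar>bx z * H n z\<bar>)" "hhi * TI (\<lambda>z. \<bar>bx z\<bar>)" "K * (dt S + dx S + dy S)"] by linarith
  qed
  have 3: "\<bar>TI (\<lambda>z. H n z * pc S \<beta> z * pc S \<psi>c z) - TI (\<lambda>z. bx z * H n z * pc S \<psi>c z)\<bar> \<le> K * hhi * C * area"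
  proof -
    define \<xi> where "\<xi> i j = h (n + 1) i j * \<psi>c i j" for i j
    have gx: "grid_periodic S \<xi>" unfolding \<xi>_def[abs_def] using n by (intro gp_mult gp_huv gc) simp
    have xb: "\<bar>\<xi> i j\<bar> \<le> hhi * K" for i j
      unfolding \<xi>_def abs_mult \<psi>c_def using n h_pos[of "n + 1" i j] h_bounds(2)[of "n + 1" i j] good_bound[OF good_psi tr(2)] hhi_pos
      by (intro mult_mono) auto
    have "TI (\<lambda>z. H n z * pc S \<beta> z * pc S \<psi>c z) = TI (pc S (\<lambda>i j. \<xi> i j * \<beta> i j))"
      by (simp add: H_def \<xi>_def pc_def[abs_def] mult_ac)
    also have "\<dots> = GS (\<lambda>i j. \<xi> i j * \<beta> i j)" by (intro TI_pc gp_mult gx \<beta>)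
    finally have a: "TI (\<lambda>z. H n z * pc S \<beta> z * pc S \<psi>c z) = GS (\<lambda>i j. \<xi> i j * \<beta> i j)" .
    have "TI (\<lambda>z. bx z * H n z * pc S \<psi>c z) = TI (\<lambda>z. pc S \<xi> z * bx z)"
      by (simp add: H_def \<xi>_def pc_def[abs_def] mult_ac)
    also have "\<dots> = (\<Sum>i\<in>{0..<int (nx S)}. \<Sum>j\<in>{0..<int (ny S)}. \<xi> i j * TI (\<lambda>p. cell_ind i j p * bx p))"
      by (rule TI_sum_cell_ind[OF gx bx])
    finally have b: "TI (\<lambda>z. bx z * H n z * pc S \<psi>c z) = (\<Sum>i\<in>{0..<int (nx S)}. \<Sum>j\<in>{0..<int (ny S)}. \<xi> i j * TI (\<lambda>p. cell_ind i j p * bx p))" .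
    have "TI (\<lambda>z. H n z * pc S \<beta> z * pc S \<psi>c z) - TI (\<lambda>z. bx z * H n z * pc S \<psi>c z)
      = (\<Sum>i\<in>{0..<int (nx S)}. \<Sum>j\<in>{0..<int (ny S)}. \<xi> i j * (\<beta> i j * (dx S * dy S) - TI (\<lambda>p. cell_ind i j p * bx p)))"
      unfolding a b GS_def by (simp add: sum_subtractf right_diff_distrib mult.assoc)
    moreover have "\<bar>(\<Sum>i\<in>{0..<int (nx S)}. \<Sum>j\<in>{0..<int (ny S)}. \<xi> i j * (\<beta> i j * (dx S * dy S) - TI (\<lambda>p. cell_ind i j p * bx p)))\<bar>
      \<le> (\<Sum>i\<in>{0..<int (nx S)}. \<Sum>j\<in>{0..<int (ny S)}. (hhi * K * C) * (dx S * dy S))"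
    proof (intro order_trans[OF sum_abs] sum_mono)
      fix i j
      have "\<bar>\<xi> i j * (\<beta> i j * (dx S * dy S) - TI (\<lambda>p. cell_ind i j p * bx p))\<bar> \<le> (hhi * K) * (C * (dx S * dy S))"
        unfolding abs_mult using xb[of i j] cell[of i j] hhi_pos K_nonneg by (intro mult_mono) auto
      then show "\<bar>\<xi> i j * (\<beta> i j * (dx S * dy S) - TI (\<lambda>p. cell_ind i j p * bx p))\<bar> \<le> (hhi * K * C) * (dx S * dy S)"
        by (simp add: mult.assoc)
    qed
    moreover have "(\<Sum>i\<in>{0..<int (nx S)}. \<Sum>j\<in>{0..<int (ny S)}. (hhi * K * C) * (dx S * dy S)) = hhi * K * C * area"
      using GS_const[of "hhi * K * C"] by (simp only: GS_def)
    moreover have "hhi * K * C * area = K * hhi * C * area" by simp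
    ultimately show ?thesis by (simp only:)
  qed
  have tri: "\<bar>a - d\<bar> \<le> p + q + r" if "\<bar>a - b\<bar> \<le> p" "\<bar>d - c\<bar> \<le> q" "\<bar>b - c\<bar> \<le> r" for a b c d p q r :: real
    using that by linarith
  have "K * (dx S + dy S) * (hhi * C\<beta> * area) + K * (dt S + dx S + dy S) * (hhi * TI (\<lambda>z. \<bar>bx z\<bar>)) + K * hhi * C * area
    = K * hhi * (C\<beta> * area * (dx S + dy S) + TI (\<lambda>z. \<bar>bx z\<bar>) * (dt S + dx S + dy S) + C * area)"
    by (simp add: algebra_simps)
  then show ?thesis using tri[OF 1 2 3] by (simp only:)
qed

end

section \<open>Consistency of the momentum equations and the limit\<close>

context sw_test
begin

text \<open>
  \<open>J\<close> bounds the jumps of \<open>h\<close>, \<open>C\<beta>\<close> the discrete slope of the topography, \<open>I\<close> the integral of \<open>\<bar>bx\<bar>\<close>, \<open>C\<close> the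
  second derivative of the topography, and \<open>\<sigma>\<close> is the Coriolis parameter with the sign of the equation.
\<close>
definition source_constant :: "real \<Rightarrow> real \<Rightarrow> real \<Rightarrow> real \<Rightarrow> real \<Rightarrow> real" where
  "source_constant J C\<beta> I C \<sigma> =
     Tend P * (grav P * (J / 4 + 2 * (hhi\<^sup>2 * area)) + grav P * (hhi * (C\<beta> * area + I + C * area)) + \<bar>\<sigma>\<bar> * (hhi\<^sup>2 * CU + area))
     + \<bar>\<sigma>\<bar> * (\<eta>\<^sup>2 * CD + Tend P * area)"

text \<open>
  A stabilising term is not small at a single time, only its square is summable. The elementary bound by
  \<open>\<rho>\<^sup>2 / sqrt dt + sqrt dt\<close> makes its sum over the time steps of order \<open>sqrt dt\<close>.
\<close>
lemma small_source_sum: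
  assumes \<rho>: "\<And>n. n < nt S \<Longrightarrow> grid_periodic S (\<rho> n)" "(\<Sum>n<nt S. GS (\<lambda>i j. (\<rho> n i j)\<^sup>2)) \<le> \<eta>\<^sup>2 * CD"
  shows "\<bar>\<Sum>n<nt S. dt S * TI (\<lambda>z. pc S (\<rho> n) z * \<psi> (time S (n + 1), z))\<bar> \<le> K * (\<eta>\<^sup>2 * CD + Tend P * area) * rate"
proof -
  have sq: "0 < sqrt (dt S)" using dt_pos by simp
  have "\<bar>TI (\<lambda>z. pc S (\<rho> n) z * \<psi> (time S (n + 1), z))\<bar> \<le> K * (1 / sqrt (dt S) * GS (\<lambda>i j. (\<rho> n i j)\<^sup>2) + sqrt (dt S) * area)" if n: "n < nt S" for n
  proof -
    have tr: "time S (n + 1) \<in> {0..Tend P}" using time_range[of "n + 1"] n by simp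
    have "\<bar>TI (\<lambda>z. pc S (\<rho> n) z * \<psi> (time S (n + 1), z))\<bar> \<le> K * TI (\<lambda>z. \<bar>pc S (\<rho> n) z\<bar>)"
      by (rule tint_mult_bound[OF Linf_tintegrable[OF Linf_pc[OF \<rho>(1)[OF n]]] good_measurable[OF good_psi] good_bound[OF good_psi tr]])
    also have "TI (\<lambda>z. \<bar>pc S (\<rho> n) z\<bar>) = GS (\<lambda>i j. \<bar>\<rho> n i j\<bar>)" by (rule TI_abs_pc[OF \<rho>(1)[OF n]])
    also have "K * \<dots> \<le> K * GS (\<lambda>i j. 1 / sqrt (dt S) * (\<rho> n i j)\<^sup>2 + sqrt (dt S))"
    proof (intro mult_left_mono GS_mono K_nonneg)
      fix i j
      have "\<bar>\<rho> n i j * 1\<bar> \<le> (1 / sqrt (dt S) * (\<rho> n i j)\<^sup>2 + 1\<^sup>2 / (1 / sqrt (dt S))) / 2"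
        using sq by (intro abs_mult_le_weighted_squares) simp
      also have "\<dots> \<le> 1 / sqrt (dt S) * (\<rho> n i j)\<^sup>2 + sqrt (dt S)"
      proof -
        have "0 \<le> 1 / sqrt (dt S) * (\<rho> n i j)\<^sup>2" using sq by simp
        then show ?thesis using sq by (simp add: field_simps)
      qed
      finally show "\<bar>\<rho> n i j\<bar> \<le> 1 / sqrt (dt S) * (\<rho> n i j)\<^sup>2 + sqrt (dt S)" by simp
    qed
    also have "\<dots> = K * (1 / sqrt (dt S) * GS (\<lambda>i j. (\<rho> n i j)\<^sup>2) + sqrt (dt S) * area)"
      by (simp only: GS_add GS_cmult GS_const)
    finally show ?thesis .
  qed
  then have "\<bar>\<Sum>n<nt S. dt S * TI (\<lambda>z. pc S (\<rho> n) z * \<psi> (time S (n + 1), z))\<bar>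
    \<le> (\<Sum>n<nt S. dt S * (K * (1 / sqrt (dt S) * GS (\<lambda>i j. (\<rho> n i j)\<^sup>2) + sqrt (dt S) * area)))"
    using dt_pos by (intro order_trans[OF sum_abs] sum_mono) (simp add: abs_mult)
  also have "\<dots> = K * (dt S * (1 / sqrt (dt S)) * (\<Sum>n<nt S. GS (\<lambda>i j. (\<rho> n i j)\<^sup>2)) + Tend P * (sqrt (dt S) * area))"
    using sum_dt_affine[of K "1 / sqrt (dt S)" "\<lambda>n. GS (\<lambda>i j. (\<rho> n i j)\<^sup>2)" "\<lambda>n. 0" "sqrt (dt S) * area"] by simp
  also have "dt S * (1 / sqrt (dt S)) = sqrt (dt S)" using dt_pos by (simp add: real_div_sqrt)
  also have "K * (sqrt (dt S) * (\<Sum>n<nt S. GS (\<lambda>i j. (\<rho> n i j)\<^sup>2)) + Tend P * (sqrt (dt S) * area))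
    \<le> K * (sqrt (dt S) * (\<eta>\<^sup>2 * CD) + Tend P * (sqrt (dt S) * area))"
    using \<rho>(2) sq K_nonneg by (intro mult_left_mono add_right_mono) auto
  also have "\<dots> = K * (\<eta>\<^sup>2 * CD + Tend P * area) * sqrt (dt S)" by (simp add: algebra_simps)
  also have "\<dots> \<le> K * (\<eta>\<^sup>2 * CD + Tend P * area) * rate"
    using K_nonneg CD_nonneg Tend_pos Lx_pos Ly_pos rate_bounds(2)
    by (intro mult_left_mono mult_nonneg_nonneg add_nonneg_nonneg) auto
  finally show ?thesis .
qed

text \<open>
  One statement for both components, in which \<open>e\<close> is the direction, \<open>s\<close> the step, \<open>w\<close> the transported and \<open>w'\<close> the
  other velocity component, \<open>\<rho>\<close> the stabilising term of the Coriolis force, and \<open>\<epsilon>\<close> and \<open>\<beta>\<close> are the discrete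
  gradients of height and topography.
\<close>
lemma momentum_consistency:
  assumes e: "norm e = 1" "good (pdiff (0, e) \<psi>)" and s: "0 < s" "s \<le> dx S + dy S"
    and w: "\<And>n. n \<le> nt S \<Longrightarrow> grid_periodic S (w n)" "\<And>n. n < nt S \<Longrightarrow> GS (\<lambda>i j. (w n i j)\<^sup>2) \<le> CU"
    and w': "\<And>n. n \<le> nt S \<Longrightarrow> grid_periodic S (w' n)" "\<And>n. n < nt S \<Longrightarrow> GS (\<lambda>i j. (w' n i j)\<^sup>2) \<le> CU"
    and \<rho>: "\<And>n. n < nt S \<Longrightarrow> grid_periodic S (\<rho> n)" "(\<Sum>n<nt S. GS (\<lambda>i j. (\<rho> n i j)\<^sup>2)) \<le> \<eta>\<^sup>2 * CD"
    and \<epsilon>: "\<And>n z. n < nt S \<Longrightarrow> pc S (\<epsilon> n) z = (H n (z + s *\<^sub>R e) - H n (z - s *\<^sub>R e)) / (2 * s)"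
    and jump: "\<And>n. n < nt S \<Longrightarrow> TI (\<lambda>z. (H n (z + s *\<^sub>R e) - H n z)\<^sup>2) \<le> J * s"
    and \<beta>: "grid_periodic S \<beta>" "\<And>i j. \<bar>\<beta> i j\<bar> \<le> C\<beta>" and bx: "TIable bx"
    and cell: "\<And>i j. \<bar>\<beta> i j * (dx S * dy S) - TI (\<lambda>z. cell_ind i j z * bx z)\<bar> \<le> (C * s) * (dx S * dy S)" and C: "0 \<le> C"
    and eq: "\<And>n i j. n < nt S \<Longrightarrow> transport P \<eta> S w n i j
      = - (h (n + 1) i j * (grav P * (\<epsilon> n i j + \<beta> i j))) + \<sigma> * (h (n + 1) i j * w' n i j) - \<sigma> * \<rho> n i j"
  shows "\<bar>- TI (\<lambda>z. pc S (h 0) z * pc S (w 0) z * \<psi> (0, z))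
      - spacetime_sum P S (\<lambda>n t z. transport_form w n t z + pc S (pressure P S (n + 1)) z * pdiff (0, e) \<psi> (t, z))
      - spacetime_sum P S (\<lambda>n t z. - grav P * pc S (h (n + 1)) z * bx z * \<psi> (t, z) + \<sigma> * pc S (h (n + 1)) z * pc S (w' n) z * \<psi> (t, z))\<bar>
    \<le> K * (transport_constant CU + source_constant J C\<beta> (TI (\<lambda>z. \<bar>bx z\<bar>)) C \<sigma>) * rate"
proof -
  define f1 where "f1 n t z = pc S (pressure P S (n + 1)) z * pdiff (0, e) \<psi> (t, z)" for n t z
  define f2 where "f2 n t z = - grav P * pc S (h (n + 1)) z * bx z * \<psi> (t, z) + \<sigma> * pc S (h (n + 1)) z * pc S (w' n) z * \<psi> (t, z)" for n t z
  define I where "I = TI (\<lambda>z. \<bar>bx z\<bar>)"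
  define I1 where "I1 n = TI (\<lambda>z. H n z * ((H n (z + s *\<^sub>R e) - H n (z - s *\<^sub>R e)) / (2 * s)) * \<psi> (time S (n + 1), z))" for n
  define I2 where "I2 n = TI (\<lambda>z. H n z * pc S \<beta> z * \<psi> (time S (n + 1), z))" for n
  define I3 where "I3 n = TI (\<lambda>z. H n z * pc S (w' n) z * \<psi> (time S (n + 1), z))" for n
  define I4 where "I4 n = TI (\<lambda>z. pc S (\<rho> n) z * \<psi> (time S (n + 1), z))" for n
  define R where "R n = - grav P * I1 n - grav P * I2 n + \<sigma> * I3 n" for n
  define p1 where "p1 = K * ((J / 4 + 2 * (hhi\<^sup>2 * area)) * (dt S + s))"
  define p2 where "p2 = K * hhi * (C\<beta> * area * (dx S + dy S) + I * (dt S + dx S + dy S) + (C * s) * area)"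
  define p3 where "p3 = K * dt S * (hhi\<^sup>2 * CU + area)"
  have prs: "pc S (pressure P S (n + 1)) z = grav P * ((H n z)\<^sup>2 / 2)" for n z
    by (simp add: H_def pc_def pressure_def)
  have mH: "H n \<in> borel_measurable borel" if "n < nt S" for n using Linf_H[OF that] by (simp add: Linf_torus_def)
  have Lw': "Linf (pc S (w' n))" if "n < nt S" for n using that by (intro Linf_pc w') simp
  have bH: "TIable (\<lambda>z. bx z * H n z)" if "n < nt S" for n
    by (rule tintegrable_mult_bounded[OF bx mH[OF that] H_abs[OF that]])
  have gH: "TIable (\<lambda>z. - grav P * H n z * bx z)" if "n < nt S" for n
  proof -
    have "TIable (\<lambda>z. - grav P * (bx z * H n z))" using bH[OF that] by (intro set_integrable_mult_right)
    moreover have "(\<lambda>z. - grav P * (bx z * H n z)) = (\<lambda>z. - grav P * H n z * bx z)" by (simp add: fun_eq_iff)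
    ultimately show ?thesis by (simp only:)
  qed
  have LP: "Linf (\<lambda>z. grav P * ((H n z)\<^sup>2 / 2))" if "n < nt S" for n
    by (intro Linf_cmult Linf_divide Linf_power2 Linf_H that)
  have ok1: "st_ok f1"
    unfolding f1_def[abs_def] prs by (intro st_basic Linf_tintegrable LP e)
  have ok2: "st_ok f2"
    unfolding f2_def[abs_def] H_def[symmetric]
    by (intro st_add st_basic gH good_psi Linf_tintegrable Linf_mult Linf_const Linf_H Lw')
  have okT: "st_ok (transport_form w)" by (rule st_ok_transport[of w, OF w(1)])
  have TR: "TI (\<lambda>z. pc S (transport P \<eta> S w n) z * \<psi> (time S (n + 1), z)) = R n - \<sigma> * I4 n" if n: "n < nt S" for n
  proof -
    have tr: "time S (n + 1) \<in> {0..Tend P}" using time_range[of "n + 1"] n by simp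
    note Lp = good_Linf[OF good_psi tr] and LH = Linf_H[OF n]
    define a1 where "a1 z = H n z * ((H n (z + s *\<^sub>R e) - H n (z - s *\<^sub>R e)) / (2 * s)) * \<psi> (time S (n + 1), z)" for z
    define a2 where "a2 z = H n z * pc S \<beta> z * \<psi> (time S (n + 1), z)" for z
    define a3 where "a3 z = H n z * pc S (w' n) z * \<psi> (time S (n + 1), z)" for z
    define a4 where "a4 z = pc S (\<rho> n) z * \<psi> (time S (n + 1), z)" for z
    have L: "Linf a1" "Linf a2" "Linf a3" "Linf a4"
      unfolding a1_def[abs_def] a2_def[abs_def] a3_def[abs_def] a4_def[abs_def]
      by (intro Linf_mult Linf_divide Linf_diff Linf_translate[OF LH] Linf_translate_minus[OF LH] LH Lp Lw' n Linf_pc \<beta> \<rho>)+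
    have pT: "pc S (transport P \<eta> S w n) z = - (H n z * (grav P * (pc S (\<epsilon> n) z + pc S \<beta> z))) + \<sigma> * (H n z * pc S (w' n) z) - \<sigma> * pc S (\<rho> n) z" for z
      using eq[OF n] by (simp add: pc_def H_def)
    have pw: "pc S (transport P \<eta> S w n) z * \<psi> (time S (n + 1), z) = (- grav P * a1 z + - grav P * a2 z) + (\<sigma> * a3 z - \<sigma> * a4 z)" for z
      unfolding pT a1_def a2_def a3_def a4_def \<epsilon>[OF n, symmetric] by (simp add: algebra_simps)
    have "TI (\<lambda>z. pc S (transport P \<eta> S w n) z * \<psi> (time S (n + 1), z)) = (- grav P * TI a1 + - grav P * TI a2) + (\<sigma> * TI a3 - \<sigma> * TI a4)"
      unfolding pw using TI_add[OF Linf_add[OF Linf_cmult[OF L(1)] Linf_cmult[OF L(2)]] Linf_diff[OF Linf_cmult[OF L(3)] Linf_cmult[OF L(4)]]]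
        TI_add[OF Linf_cmult[OF L(1)] Linf_cmult[OF L(2)]] TI_diff[OF Linf_cmult[OF L(3)] Linf_cmult[OF L(4)]]
      by (simp only: TI_cmult)
    moreover have "TI a1 = I1 n" "TI a2 = I2 n" "TI a3 = I3 n" "TI a4 = I4 n"
      by (simp_all add: I1_def I2_def I3_def I4_def a1_def[abs_def] a2_def[abs_def] a3_def[abs_def] a4_def[abs_def])
    ultimately show ?thesis by (simp add: R_def)
  qed
  have err: "\<bar>spacetime_sum P S (\<lambda>n t z. f1 n t z + f2 n t z) - (\<Sum>n<nt S. dt S * R n)\<bar>
    \<le> (\<Sum>n<nt S. dt S * (grav P * p1 + grav P * p2 + \<bar>\<sigma>\<bar> * p3))"
  proof (rule st_bound[OF st_add(1)[OF ok1 ok2]])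
    fix n t assume n: "n < nt S" and t: "t \<in> {time S n..time S (n + 1)}"
    have tr: "t \<in> {0..Tend P}" "time S (n + 1) \<in> {0..Tend P}" using step_subset[OF n] t by auto
    have td: "\<bar>t - time S (n + 1)\<bar> \<le> dt S" using t by (auto simp: time_Suc)
    define A1 where "A1 = TI (\<lambda>z. (H n z)\<^sup>2 / 2 * pdiff (0, e) \<psi> (t, z))"
    define A2 where "A2 = TI (\<lambda>z. bx z * H n z * \<psi> (t, z))"
    define A3 where "A3 = TI (\<lambda>z. H n z * pc S (w' n) z * \<psi> (t, z))"
    have LHw: "Linf (\<lambda>z. H n z * pc S (w' n) z)" by (intro Linf_mult Linf_H Lw' n)
    have t1: "TI (f1 n t) = grav P * A1"
    proof -
      have "f1 n t = (\<lambda>z. grav P * ((H n z)\<^sup>2 / 2 * pdiff (0, e) \<psi> (t, z)))"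
        by (rule ext) (simp only: f1_def prs mult.assoc)
      then show ?thesis unfolding A1_def by (simp only: TI_cmult)
    qed
    have t2: "TI (f2 n t) = - grav P * A2 + \<sigma> * A3"
    proof -
      have "f2 n t = (\<lambda>z. - grav P * (bx z * H n z * \<psi> (t, z)) + \<sigma> * (H n z * pc S (w' n) z * \<psi> (t, z)))"
        by (simp add: f2_def H_def fun_eq_iff)
      moreover have "TI (\<lambda>z. - grav P * (bx z * H n z * \<psi> (t, z)) + \<sigma> * (H n z * pc S (w' n) z * \<psi> (t, z)))
        = TI (\<lambda>z. - grav P * (bx z * H n z * \<psi> (t, z))) + TI (\<lambda>z. \<sigma> * (H n z * pc S (w' n) z * \<psi> (t, z)))"
        by (intro set_integral_add(2) set_integrable_mult_right good_TIable[OF bH[OF n] good_psi tr(1)]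
            good_TIable[OF Linf_tintegrable[OF LHw] good_psi tr(1)])
      ultimately show ?thesis unfolding A2_def A3_def by (simp only: TI_cmult)
    qed
    have "TI (\<lambda>z. f1 n t z + f2 n t z) = TI (f1 n t) + TI (f2 n t)"
      using ok1 ok2 n t unfolding st_ok_def by (intro set_integral_add(2)) auto
    then have E: "TI (\<lambda>z. f1 n t z + f2 n t z) - R n = grav P * (I1 n + A1) + grav P * (I2 n - A2) + \<sigma> * (A3 - I3 n)"
      unfolding t1 t2 R_def by (simp add: algebra_simps)
    have b1: "\<bar>grav P * (I1 n + A1)\<bar> \<le> grav P * p1"
      unfolding abs_mult I1_def A1_def p1_def using pressure_consistency[OF e s(1) n jump[OF n] t] grav_pos
      by (simp add: mult_left_mono)
    have b2: "\<bar>grav P * (I2 n - A2)\<bar> \<le> grav P * p2"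
      unfolding abs_mult I2_def A2_def p2_def I_def using bottom_consistency[OF n t \<beta> bx cell] grav_pos
      by (simp add: mult_left_mono)
    have "\<bar>A3 - I3 n\<bar> \<le> K * \<bar>t - time S (n + 1)\<bar> * TI (\<lambda>z. \<bar>H n z * pc S (w' n) z\<bar>)"
      unfolding A3_def I3_def by (rule good_TI_diff[OF Linf_tintegrable[OF LHw] good_psi tr])
    also have "\<dots> \<le> K * dt S * (hhi\<^sup>2 * CU + area)"
    proof (intro mult_mono mult_left_mono td K_nonneg order_refl abs_ge_zero)
      have "TI (\<lambda>z. \<bar>H n z * pc S (w' n) z\<bar>) = TI (\<lambda>z. \<bar>pc S (\<lambda>i j. h (n + 1) i j * w' n i j) z\<bar>)"
        by (simp add: H_def pc_def[abs_def])
      also have "\<dots> \<le> hhi\<^sup>2 * CU + area"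
        using n GS_abs_hw[OF n w'(2)] by (subst TI_abs_pc) (auto intro!: gp_mult gp_huv w'(1))
      finally show "TI (\<lambda>z. \<bar>H n z * pc S (w' n) z\<bar>) \<le> hhi\<^sup>2 * CU + area" .
      show "0 \<le> K * dt S" using K_nonneg dt_pos by simp
      show "0 \<le> TI (\<lambda>z. \<bar>H n z * pc S (w' n) z\<bar>)" by (rule tint_nonneg) simp
    qed
    finally have b3: "\<bar>\<sigma> * (A3 - I3 n)\<bar> \<le> \<bar>\<sigma>\<bar> * p3" unfolding abs_mult p3_def by (intro mult_left_mono) auto
    have tri: "\<bar>a + b + c\<bar> \<le> x + y + z" if "\<bar>a\<bar> \<le> x" "\<bar>b\<bar> \<le> y" "\<bar>c\<bar> \<le> z" for a b c x y z :: real using that by linarith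
    show "\<bar>TI (\<lambda>z. f1 n t z + f2 n t z) - R n\<bar> \<le> grav P * p1 + grav P * p2 + \<bar>\<sigma>\<bar> * p3"
      unfolding E by (rule tri[OF b1 b2 b3])
  qed
  have sumT: "(\<Sum>n<nt S. dt S * TI (\<lambda>z. pc S (transport P \<eta> S w n) z * \<psi> (time S (n + 1), z)))
    = (\<Sum>n<nt S. dt S * R n) - \<sigma> * (\<Sum>n<nt S. dt S * I4 n)"
  proof -
    have "(\<Sum>n<nt S. dt S * TI (\<lambda>z. pc S (transport P \<eta> S w n) z * \<psi> (time S (n + 1), z))) = (\<Sum>n<nt S. dt S * R n - \<sigma> * (dt S * I4 n))"
    proof (intro sum.cong refl)
      fix n assume "n \<in> {..<nt S}"
      then have n: "n < nt S" by simp
      show "dt S * TI (\<lambda>z. pc S (transport P \<eta> S w n) z * \<psi> (time S (n + 1), z)) = dt S * R n - \<sigma> * (dt S * I4 n)"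
        unfolding TR[OF n] by (simp add: right_diff_distrib)
    qed
    then show ?thesis by (simp only: sum_subtractf sum_distrib_left)
  qed
  have small: "\<bar>\<sigma> * (\<Sum>n<nt S. dt S * I4 n)\<bar> \<le> \<bar>\<sigma>\<bar> * (K * (\<eta>\<^sup>2 * CD + Tend P * area) * rate)"
    unfolding abs_mult I4_def by (intro mult_left_mono small_source_sum \<rho>) auto
  note trans = transport_consistency[of w CU, OF w]
  have split: "spacetime_sum P S (\<lambda>n t z. transport_form w n t z + f1 n t z) = spacetime_sum P S (transport_form w) + spacetime_sum P S f1"
    "spacetime_sum P S (\<lambda>n t z. f1 n t z + f2 n t z) = spacetime_sum P S f1 + spacetime_sum P S f2"
    by (rule st_add(2)[OF okT ok1], rule st_add(2)[OF ok1 ok2])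
  have J0: "0 \<le> J"
  proof -
    have "0 \<le> TI (\<lambda>z. (H 0 (z + s *\<^sub>R e) - H 0 z)\<^sup>2)" by (rule tint_nonneg) simp
    then have "0 \<le> J * s" using jump[OF nt_pos] by linarith
    then show ?thesis using s(1) by (simp add: zero_le_mult_iff)
  qed
  have A0: "0 \<le> area" using Lx_pos Ly_pos by simp
  have I0: "0 \<le> I" unfolding I_def by (rule tint_nonneg) simp
  have C\<beta>0: "0 \<le> C\<beta>" using \<beta>(2)[of 0 0] by linarith
  define r where "r = dt S + dx S + dy S"
  have r: "dt S + s \<le> r" "dx S + dy S \<le> r" "s \<le> r" "dt S \<le> r" "r \<le> rate" "0 \<le> r"
    using s dt_pos dx_pos dy_pos rate_bounds(3) by (auto simp: r_def)
  have q1: "p1 \<le> K * ((J / 4 + 2 * (hhi\<^sup>2 * area)) * r)"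
    unfolding p1_def using J0 A0 r(1) K_nonneg by (intro mult_left_mono) auto
  have q2: "p2 \<le> K * (hhi * ((C\<beta> * area + I + C * area) * r))"
  proof -
    have "C\<beta> * area * (dx S + dy S) + I * (dt S + dx S + dy S) + (C * s) * area \<le> C\<beta> * area * r + I * r + (C * r) * area"
      using C\<beta>0 A0 I0 C r by (intro add_mono mult_left_mono mult_right_mono) (auto simp: r_def)
    also have "\<dots> = (C\<beta> * area + I + C * area) * r" by (simp add: algebra_simps)
    finally show ?thesis unfolding p2_def mult.assoc using K_nonneg hhi_pos by (intro mult_left_mono) auto
  qed
  have q3: "p3 \<le> K * ((hhi\<^sup>2 * CU + area) * r)"
    unfolding p3_def mult.assoc using A0 CU_nonneg r(4) K_nonneg
    by (subst mult.commute[of "dt S"]) (intro mult_left_mono, auto)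
  define B where "B = grav P * (J / 4 + 2 * (hhi\<^sup>2 * area)) + grav P * (hhi * (C\<beta> * area + I + C * area)) + \<bar>\<sigma>\<bar> * (hhi\<^sup>2 * CU + area)"
  have B0: "0 \<le> B" unfolding B_def
    using grav_pos J0 Lx_pos Ly_pos hhi_pos C\<beta>0 I0 C CU_nonneg by (intro add_nonneg_nonneg mult_nonneg_nonneg) auto
  have "grav P * p1 + grav P * p2 + \<bar>\<sigma>\<bar> * p3
    \<le> grav P * (K * ((J / 4 + 2 * (hhi\<^sup>2 * area)) * r)) + grav P * (K * (hhi * ((C\<beta> * area + I + C * area) * r))) + \<bar>\<sigma>\<bar> * (K * ((hhi\<^sup>2 * CU + area) * r))"
    using q1 q2 q3 grav_pos by (intro add_mono mult_left_mono) auto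
  also have "\<dots> = K * B * r" by (simp add: B_def algebra_simps)
  also have "\<dots> \<le> K * B * rate" using B0 K_nonneg r(5) by (intro mult_left_mono) auto
  finally have "Tend P * (grav P * p1 + grav P * p2 + \<bar>\<sigma>\<bar> * p3) \<le> Tend P * (K * B * rate)"
    using Tend_pos by (intro mult_left_mono) auto
  then have err': "\<bar>spacetime_sum P S (\<lambda>n t z. f1 n t z + f2 n t z) - (\<Sum>n<nt S. dt S * R n)\<bar> \<le> Tend P * (K * B * rate)"
    using err unfolding sum_dt by linarith
  have tri: "\<bar>a - (b + c) - d\<bar> \<le> x + (y + z)" if "\<bar>a - b - (r1 - r2)\<bar> \<le> x" "\<bar>(c + d) - r1\<bar> \<le> y" "\<bar>r2\<bar> \<le> z"
    for a b c d r1 r2 x y z :: real using that by linarith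
  have "\<bar>- TI (\<lambda>z. pc S (h 0) z * pc S (w 0) z * \<psi> (0, z)) - (spacetime_sum P S (transport_form w) + spacetime_sum P S f1) - spacetime_sum P S f2\<bar>
    \<le> K * transport_constant CU * rate + (Tend P * (K * B * rate) + \<bar>\<sigma>\<bar> * (K * (\<eta>\<^sup>2 * CD + Tend P * area) * rate))"
    by (rule tri[OF trans[unfolded sumT] err'[unfolded split(2)] small])
  also have "\<dots> = K * (transport_constant CU + source_constant J C\<beta> I C \<sigma>) * rate"
    unfolding source_constant_def B_def[symmetric] by (simp add: algebra_simps)
  finally show ?thesis unfolding split(1)[symmetric] f1_def f2_def I_def .
qed


end

text \<open>
  The central difference of the averaged topography is a difference of integrals against translates of one
  cell indicator, in either coordinate direction.
\<close>
lemma (in sw_scheme) slope_cell_estimate: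
  assumes e: "(s, e) = (dx S, (1, 0)) \<and> (\<forall>i j. \<beta> i j = (b (i + 1) j - b (i - 1) j) / (2 * s))
      \<or> (s, e) = (dy S, (0, 1)) \<and> (\<forall>i j. \<beta> i j = (b i (j + 1) - b i (j - 1)) / (2 * s))"
    and w: "weak_pdiff (Lx P) (Ly P) e (bot P) f'" "weak_pdiff (Lx P) (Ly P) e (bot P) f1" "weak_pdiff (Lx P) (Ly P) e f1 f2"
    and f1: "Linf f1" and f2: "Linf f2" "AE z in lborel. \<bar>f2 z\<bar> \<le> C2"
  shows "\<bar>\<beta> i j * (dx S * dy S) - TI (\<lambda>z. cell_ind i j z * f' z)\<bar> \<le> (C2 * s) * (dx S * dy S)"
proof -
  define V where "V = dx S * dy S"
  have V: "V > 0" using dx_pos dy_pos by (simp add: V_def)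
  have s: "s > 0" using e dx_pos dy_pos by auto
  define B where "B = TI (\<lambda>z. cell_ind i j z * f' z)"
  have b: "TI (\<lambda>p. bot P p * cell_ind i' j' p) = b i' j' * V" for i' j'
    using cell_average_eq[OF Linf_bot, of i' j'] V unfolding V_def[symmetric]
    by (simp add: mult.commute[of "cell_ind i' j' _"])
  have dif: "TI (\<lambda>z. bot P z * cell_ind i j (z - s *\<^sub>R e)) - TI (\<lambda>z. bot P z * cell_ind i j (z + s *\<^sub>R e)) = 2 * s * (\<beta> i j * V)"
  proof -
    from e show ?thesis
    proof
      assume x: "(s, e) = (dx S, (1, 0)) \<and> (\<forall>i j. \<beta> i j = (b (i + 1) j - b (i - 1) j) / (2 * s))"
      have "cell_ind i j (z - s *\<^sub>R e) = cell_ind (i + 1) j z" "cell_ind i j (z + s *\<^sub>R e) = cell_ind (i - 1) j z" for z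
        using cell_ind_shift_x[of i 1 j z] cell_ind_shift_x[of i "- 1" j z] x by (simp_all add: diff_conv_add_uminus del: add_uminus_conv_diff)
      then show ?thesis using x s by (simp add: b left_diff_distrib)
    next
      assume y: "(s, e) = (dy S, (0, 1)) \<and> (\<forall>i j. \<beta> i j = (b i (j + 1) - b i (j - 1)) / (2 * s))"
      have "cell_ind i j (z - s *\<^sub>R e) = cell_ind i (j + 1) z" "cell_ind i j (z + s *\<^sub>R e) = cell_ind i (j - 1) z" for z
        using cell_ind_shift_y[of i j 1 z] cell_ind_shift_y[of i j "- 1" z] y by (simp_all add: diff_conv_add_uminus del: add_uminus_conv_diff)
      then show ?thesis using y s by (simp add: b left_diff_distrib)
    qed
  qed
  have "\<bar>2 * s * (\<beta> i j * V) - 2 * s * B\<bar> \<le> 2 * C2 * s\<^sup>2 * V"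
    using weak_pdiff_cell[OF Linf_bot w f1 f2 s, of i j] unfolding dif TI_cell_ind V_def B_def
    by (simp add: mult.commute[of "cell_ind i j _"])
  moreover have "2 * s * (\<beta> i j * V) - 2 * s * B = (2 * s) * (\<beta> i j * V - B)" by (simp add: right_diff_distrib)
  moreover have "2 * C2 * s\<^sup>2 * V = (2 * s) * ((C2 * s) * V)" by (simp add: power2_eq_square)
  ultimately have "(2 * s) * \<bar>\<beta> i j * V - B\<bar> \<le> (2 * s) * ((C2 * s) * V)" using s by (simp add: abs_mult)
  then have "\<bar>\<beta> i j * V - B\<bar> \<le> (C2 * s) * V" using s by (subst (asm) mult_le_cancel_left_pos) auto
  then show ?thesis by (simp add: V_def B_def)
qed

lemma (in sw_scheme) slope_bound:
  assumes "\<bar>\<beta> i j * (dx S * dy S) - TI (\<lambda>z. cell_ind i j z * f1 z)\<bar> \<le> (C2 * s) * (dx S * dy S)"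
    and f1: "Linf f1" "AE z in lborel. \<bar>f1 z\<bar> \<le> C1" and s: "s \<le> L" and C2: "0 \<le> C2"
  shows "\<bar>\<beta> i j\<bar> \<le> C1 + C2 * L"
proof -
  define V where "V = dx S * dy S"
  have V: "V > 0" using dx_pos dy_pos by (simp add: V_def)
  have "\<bar>TI (\<lambda>z. cell_ind i j z * f1 z)\<bar> \<le> C1 * V"
    using TI_AE_bound[OF f1 Linf_cell_ind cell_ind_nonneg] TI_cell_ind by (simp add: V_def)
  then have "\<bar>\<beta> i j * V\<bar> \<le> C1 * V + (C2 * s) * V" using assms(1) unfolding V_def by linarith
  also have "\<dots> \<le> (C1 + C2 * L) * V"
    unfolding distrib_right using s C2 V by (intro add_left_mono mult_right_mono mult_left_mono) auto
  finally show ?thesis using V by (simp add: abs_mult)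
qed

lemma (in sw_mesh) step_le_period: "dx M \<le> Lx P" "dy M \<le> Ly P"
  using nx_pos ny_pos dx_pos dy_pos mult_right_mono[of 1 "real (nx M)" "dx M"] mult_right_mono[of 1 "real (ny M)" "dy M"]
  by (simp_all add: nx_dx ny_dy)

text \<open>
  The gradient bound is a bound of order \<open>s powr (-1/2)\<close> for difference quotients in \<open>L\<^sup>2\<close>. For the squared
  differences this leaves one power of the step \<open>s\<close>, whatever the other step sizes are.
\<close>
lemma (in sw_mesh) jump_from_gradient:
  assumes "Linf G" and s: "s > 0" and b: "L2_norm_torus (Lx P) (Ly P) (\<lambda>z. (G (z - d + d') - G (z - d)) / s) \<le> c * s powr (-1/2)"
  shows "TI (\<lambda>z. (G (z + d') - G z)\<^sup>2) \<le> c\<^sup>2 * s"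
proof -
  define D where "D z = ((G (z + d') - G z) / s)\<^sup>2" for z
  have LD: "Linf D" unfolding D_def[abs_def] by (intro Linf_power2 Linf_divide Linf_diff assms(1) Linf_translate[OF assms(1)])
  have t: "TI (\<lambda>z. D (z + - d)) = TI D" by (rule tint_translate[OF Lx_pos Ly_pos LD])
  have TD: "TI D = TI (\<lambda>z. (G (z + d') - G z)\<^sup>2) / s\<^sup>2"
    unfolding D_def power_divide by (rule set_integral_divide_zero)
  have TD0: "0 \<le> TI D" by (rule tint_nonneg) (simp add: D_def)
  have "L2_norm_torus (Lx P) (Ly P) (\<lambda>z. (G (z - d + d') - G (z - d)) / s) = sqrt (TI D)"
    using t by (simp add: L2_norm_torus_def D_def)
  then have "sqrt (TI D) \<le> c * s powr (-1/2)" using b by simp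
  then have "(sqrt (TI D))\<^sup>2 \<le> (c * s powr (-1/2))\<^sup>2" using TD0 by (intro power_mono) auto
  moreover have "(c * s powr (-1/2))\<^sup>2 = c\<^sup>2 / s"
  proof -
    have "(s powr (-1/2))\<^sup>2 = s powr (-1/2) * s powr (-1/2)" by (rule power2_eq_square)
    also have "\<dots> = s powr (-1/2 + -1/2)" by (rule powr_add[symmetric])
    also have "\<dots> = 1 / s" using s by (simp add: powr_minus_divide)
    finally show ?thesis by (simp add: power_mult_distrib)
  qed
  ultimately have "TI (\<lambda>z. (G (z + d') - G z)\<^sup>2) / s\<^sup>2 \<le> c\<^sup>2 / s" using TD0 TD by simp
  then have "TI (\<lambda>z. (G (z + d') - G z)\<^sup>2) \<le> c\<^sup>2 / s * s\<^sup>2" using s by (simp add: pos_divide_le_eq)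
  also have "\<dots> = c\<^sup>2 * s" using s by (simp add: power2_eq_square)
  finally show ?thesis .
qed

context sw_test
begin

lemma x_momentum_consistency:
  assumes grad: "gradient_bounds P c S"
    and w: "weak_pdiff (Lx P) (Ly P) (1, 0) (bot P) bx" "weak_pdiff (Lx P) (Ly P) (1, 0) (bot P) f1" "weak_pdiff (Lx P) (Ly P) (1, 0) f1 f2"
    and f1: "Linf f1" "AE z in lborel. \<bar>f1 z\<bar> \<le> C1" and f2: "Linf f2" "AE z in lborel. \<bar>f2 z\<bar> \<le> C2" and C2: "0 \<le> C2"
  shows "\<bar>- TI (\<lambda>z. pc S (h 0) z * pc S (u 0) z * \<psi> (0, z))
      - spacetime_sum P S (\<lambda>n t z. transport_form u n t z + pc S (pressure P S (n + 1)) z * dx_test \<psi> (t, z))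
      - spacetime_sum P S (\<lambda>n t z. - grav P * pc S (h (n + 1)) z * bx z * \<psi> (t, z) + cor P * pc S (h (n + 1)) z * pc S (v n) z * \<psi> (t, z))\<bar>
    \<le> K * (transport_constant CU + source_constant (c\<^sup>2) (C1 + C2 * Lx P) (TI (\<lambda>z. \<bar>bx z\<bar>)) C2 (cor P)) * rate"
proof (rule momentum_consistency[where s = "dx S" and \<epsilon> = "\<lambda>n. eth_x S (h (n + 1))" and \<beta> = "eth_x S b" and \<rho> = "rr P \<eta> S"])
  have eth: "eth_x S b i j = (b (i + 1) j - b (i - 1) j) / (2 * dx S)" for i j
    using dx_pos by (simp add: eth_x_def mean_x_def field_simps)
  note cell = slope_cell_estimate[where s = "dx S" and e = "(1, 0)" and \<beta> = "eth_x S b", OF disjI1[OF conjI[OF refl allI[OF allI[OF eth]]]]]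
  show "\<bar>eth_x S b i j * (dx S * dy S) - TI (\<lambda>z. cell_ind i j z * bx z)\<bar> \<le> (C2 * dx S) * (dx S * dy S)" for i j
    by (rule cell[OF w f1(1) f2])
  show "\<bar>eth_x S b i j\<bar> \<le> C1 + C2 * Lx P" for i j
    by (rule slope_bound[OF cell[OF w(2,2,3) f1(1) f2] f1 step_le_period(1) C2])
  show "pc S (eth_x S (h (n + 1))) z = (H n (z + dx S *\<^sub>R (1, 0)) - H n (z - dx S *\<^sub>R (1, 0))) / (2 * dx S)" for n z
    by (simp add: pc_eth_x H_def)
  show "TI (\<lambda>z. (H n (z + dx S *\<^sub>R (1, 0)) - H n z)\<^sup>2) \<le> c\<^sup>2 * dx S" if n: "n < nt S" for n
  proof (rule jump_from_gradient[OF Linf_H[OF n] dx_pos, where d = "(1/2) *\<^sub>R (dx S, 0)"])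
    have "eth_x_E S (h (n + 1)) = (\<lambda>z. (H n (z - (1/2) *\<^sub>R (dx S, 0) + dx S *\<^sub>R (1, 0)) - H n (z - (1/2) *\<^sub>R (dx S, 0))) / dx S)"
    proof
      fix z
      show "eth_x_E S (h (n + 1)) z = (H n (z - (1/2) *\<^sub>R (dx S, 0) + dx S *\<^sub>R (1, 0)) - H n (z - (1/2) *\<^sub>R (dx S, 0))) / dx S"
        using pc_shift_x[of "h (n + 1)" 1 "z - (1/2) *\<^sub>R (dx S, 0)"]
        unfolding eth_x_E_def pc_Dx_eq H_def by (simp add: pc_def)
    qed
    then show "L2_norm_torus (Lx P) (Ly P) (\<lambda>z. (H n (z - (1/2) *\<^sub>R (dx S, 0) + dx S *\<^sub>R (1, 0)) - H n (z - (1/2) *\<^sub>R (dx S, 0))) / dx S) \<le> c * dx S powr (-1/2)"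
      using grad n unfolding gradient_bounds_def by metis
  qed
  show "transport P \<eta> S u n i j = - (h (n + 1) i j * (grav P * (eth_x S (h (n + 1)) i j + eth_x S b i j)))
      + cor P * (h (n + 1) i j * v n i j) - cor P * rr P \<eta> S n i j" if n: "n < nt S" for n i j
  proof -
    have "eth_x S (phi P S (n + 1)) i j = grav P * (eth_x S (h (n + 1)) i j + eth_x S b i j)"
      by (simp add: eth_x_def mean_x_def phi_def add_divide_distrib diff_divide_distrib algebra_simps)
    moreover have "transport P \<eta> S u n i j + h (n + 1) i j * eth_x S (phi P S (n + 1)) i j = cor P * h (n + 1) i j * v n i j - cor P * rr P \<eta> S n i j"
      using sol n unfolding numerical_solution_def x_momentum_equation_def by blast
    ultimately show ?thesis by (simp add: mult.assoc)
  qed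
  show "TIable bx" using w(1) by (simp add: weak_pdiff_def L1_torus_def)
  show "good (pdiff (0, (1, 0)) \<psi>)" by (rule good_x)
  show "grid_periodic S (eth_x S b)" by (intro gp_eth_x gp_b)
  show "(\<Sum>n<nt S. GS (\<lambda>i j. (rr P \<eta> S n i j)\<^sup>2)) \<le> \<eta>\<^sup>2 * CD" by (rule stabilisation_sum(2))
qed (use dx_pos dy_pos C2 u_bound v_bound in \<open>auto intro: gp_huv gp_rr\<close>)

lemma y_momentum_consistency:
  assumes grad: "gradient_bounds P c S"
    and w: "weak_pdiff (Lx P) (Ly P) (0, 1) (bot P) b_y" "weak_pdiff (Lx P) (Ly P) (0, 1) (bot P) f1" "weak_pdiff (Lx P) (Ly P) (0, 1) f1 f2"
    and f1: "Linf f1" "AE z in lborel. \<bar>f1 z\<bar> \<le> C1" and f2: "Linf f2" "AE z in lborel. \<bar>f2 z\<bar> \<le> C2" and C2: "0 \<le> C2"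
  shows "\<bar>- TI (\<lambda>z. pc S (h 0) z * pc S (v 0) z * \<psi> (0, z))
      - spacetime_sum P S (\<lambda>n t z. transport_form v n t z + pc S (pressure P S (n + 1)) z * dy_test \<psi> (t, z))
      - spacetime_sum P S (\<lambda>n t z. - grav P * pc S (h (n + 1)) z * b_y z * \<psi> (t, z) + (- cor P) * pc S (h (n + 1)) z * pc S (u n) z * \<psi> (t, z))\<bar>
    \<le> K * (transport_constant CU + source_constant (c\<^sup>2) (C1 + C2 * Ly P) (TI (\<lambda>z. \<bar>b_y z\<bar>)) C2 (- cor P)) * rate"
proof (rule momentum_consistency[where s = "dy S" and \<epsilon> = "\<lambda>n. eth_y S (h (n + 1))" and \<beta> = "eth_y S b" and \<rho> = "qq P \<eta> S"])
  have eth: "eth_y S b i j = (b i (j + 1) - b i (j - 1)) / (2 * dy S)" for i j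
    using dy_pos by (simp add: eth_y_def mean_y_def field_simps)
  note cell = slope_cell_estimate[where s = "dy S" and e = "(0, 1)" and \<beta> = "eth_y S b", OF disjI2[OF conjI[OF refl allI[OF allI[OF eth]]]]]
  show "\<bar>eth_y S b i j * (dx S * dy S) - TI (\<lambda>z. cell_ind i j z * b_y z)\<bar> \<le> (C2 * dy S) * (dx S * dy S)" for i j
    by (rule cell[OF w f1(1) f2])
  show "\<bar>eth_y S b i j\<bar> \<le> C1 + C2 * Ly P" for i j
    by (rule slope_bound[OF cell[OF w(2,2,3) f1(1) f2] f1 step_le_period(2) C2])
  show "pc S (eth_y S (h (n + 1))) z = (H n (z + dy S *\<^sub>R (0, 1)) - H n (z - dy S *\<^sub>R (0, 1))) / (2 * dy S)" for n z
    by (simp add: pc_eth_y H_def)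
  show "TI (\<lambda>z. (H n (z + dy S *\<^sub>R (0, 1)) - H n z)\<^sup>2) \<le> c\<^sup>2 * dy S" if n: "n < nt S" for n
  proof (rule jump_from_gradient[OF Linf_H[OF n] dy_pos, where d = "(1/2) *\<^sub>R (0, dy S)"])
    have "eth_y_E S (h (n + 1)) = (\<lambda>z. (H n (z - (1/2) *\<^sub>R (0, dy S) + dy S *\<^sub>R (0, 1)) - H n (z - (1/2) *\<^sub>R (0, dy S))) / dy S)"
    proof
      fix z
      show "eth_y_E S (h (n + 1)) z = (H n (z - (1/2) *\<^sub>R (0, dy S) + dy S *\<^sub>R (0, 1)) - H n (z - (1/2) *\<^sub>R (0, dy S))) / dy S"
        using pc_shift_y[of "h (n + 1)" 1 "z - (1/2) *\<^sub>R (0, dy S)"]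
        unfolding eth_y_E_def pc_Dy_eq H_def by (simp add: pc_def)
    qed
    then show "L2_norm_torus (Lx P) (Ly P) (\<lambda>z. (H n (z - (1/2) *\<^sub>R (0, dy S) + dy S *\<^sub>R (0, 1)) - H n (z - (1/2) *\<^sub>R (0, dy S))) / dy S) \<le> c * dy S powr (-1/2)"
      using grad n unfolding gradient_bounds_def by metis
  qed
  show "transport P \<eta> S v n i j = - (h (n + 1) i j * (grav P * (eth_y S (h (n + 1)) i j + eth_y S b i j)))
      + (- cor P) * (h (n + 1) i j * u n i j) - (- cor P) * qq P \<eta> S n i j" if n: "n < nt S" for n i j
  proof -
    have "eth_y S (phi P S (n + 1)) i j = grav P * (eth_y S (h (n + 1)) i j + eth_y S b i j)"
      by (simp add: eth_y_def mean_y_def phi_def add_divide_distrib diff_divide_distrib algebra_simps)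
    moreover have "transport P \<eta> S v n i j + h (n + 1) i j * eth_y S (phi P S (n + 1)) i j = - cor P * h (n + 1) i j * u n i j + cor P * qq P \<eta> S n i j"
      using sol n unfolding numerical_solution_def y_momentum_equation_def by blast
    ultimately show ?thesis by (simp add: mult.assoc)
  qed
  show "TIable b_y" using w(1) by (simp add: weak_pdiff_def L1_torus_def)
  show "good (pdiff (0, (0, 1)) \<psi>)" by (rule good_y)
  show "grid_periodic S (eth_y S b)" by (intro gp_eth_y gp_b)
  show "(\<Sum>n<nt S. GS (\<lambda>i j. (qq P \<eta> S n i j)\<^sup>2)) \<le> \<eta>\<^sup>2 * CD" by (rule stabilisation_sum(1))
qed (use dx_pos dy_pos C2 u_bound v_bound in \<open>auto intro: gp_huv gp_qq\<close>)

end

lemma (in sw_mesh) step_le_mesh_size: "dx M \<le> mesh_size M" "dy M \<le> mesh_size M"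
proof -
  have "diameter (cell M 0 0) \<le> mesh_size M"
    unfolding mesh_size_def using nx_pos ny_pos
    by (intro Max_ge) (auto intro!: image_eqI[where x = "(0, 0)"])
  moreover have "bounded (cell M 0 0)" unfolding cell_def by (intro bounded_Times) auto
  moreover have "(xc M 0 - dx M / 2, yc M 0) \<in> cell M 0 0" "(xc M 0 + dx M / 2, yc M 0) \<in> cell M 0 0"
    "(xc M 0, yc M 0 - dy M / 2) \<in> cell M 0 0" "(xc M 0, yc M 0 + dy M / 2) \<in> cell M 0 0"
    using dx_pos dy_pos by (auto simp: cell_def)
  ultimately have "dist (xc M 0 - dx M / 2, yc M 0) (xc M 0 + dx M / 2, yc M 0) \<le> mesh_size M"
    "dist (xc M 0, yc M 0 - dy M / 2) (xc M 0, yc M 0 + dy M / 2) \<le> mesh_size M"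
    using diameter_bounded_bound order_trans by metis+
  then show "dx M \<le> mesh_size M" "dy M \<le> mesh_size M"
    using dx_pos dy_pos by (auto simp: dist_Pair_Pair dist_real_def)
qed

text \<open>
  The constant \<open>Q\<close> must not depend on the run; the step sizes are bounded by the mesh size.
\<close>
lemma vanishing_mesh_tendsto_0:
  assumes b: "\<And>S. S \<in> A \<Longrightarrow> \<bar>E S\<bar> \<le> Q * (sqrt (dt S) + dt S + dx S + dy S)"
    and m: "\<And>S. S \<in> A \<Longrightarrow> 0 < dt S \<and> 0 < dx S \<and> 0 < dy S \<and> dt S \<le> c * mesh_size S \<and> dx S \<le> mesh_size S \<and> dy S \<le> mesh_size S"
  shows "((\<lambda>S. \<bar>E S\<bar>) \<longlongrightarrow> 0) (vanishing_mesh A)"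
proof (rule Lim_null_comparison)
  define \<phi> where "\<phi> d = \<bar>Q\<bar> * (sqrt (c * d) + c * d + d + d)" for d
  show "\<forall>\<^sub>F S in vanishing_mesh A. norm \<bar>E S\<bar> \<le> \<phi> (mesh_size S)"
    unfolding vanishing_mesh_def eventually_inf_principal
  proof (intro always_eventually allI impI)
    fix S assume S: "S \<in> A"
    let ?r = "sqrt (dt S) + dt S + dx S + dy S"
    have "?r \<le> sqrt (c * mesh_size S) + c * mesh_size S + mesh_size S + mesh_size S"
      using m[OF S] by (intro add_mono real_sqrt_le_mono) auto
    then have "\<bar>Q\<bar> * ?r \<le> \<phi> (mesh_size S)" unfolding \<phi>_def by (intro mult_left_mono) auto
    moreover have "Q * ?r \<le> \<bar>Q\<bar> * ?r" using m[OF S] by (intro mult_right_mono abs_ge_self add_nonneg_nonneg) auto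
    ultimately show "norm \<bar>E S\<bar> \<le> \<phi> (mesh_size S)" using b[OF S] by simp
  qed
  have "filterlim mesh_size (at_right 0) (vanishing_mesh A)"
    unfolding vanishing_mesh_def
    by (rule filterlim_mono[OF filterlim_filtercomap order_refl inf_le1])
  moreover have "(\<phi> \<longlongrightarrow> 0) (at_right 0)"
  proof -
    have "(\<phi> \<longlongrightarrow> \<bar>Q\<bar> * (sqrt (c * 0) + c * 0 + 0 + 0)) (at_right 0)"
      unfolding \<phi>_def[abs_def] by (intro tendsto_intros)
    then show ?thesis by simp
  qed
  ultimately show "((\<lambda>S. \<phi> (mesh_size S)) \<longlongrightarrow> 0) (vanishing_mesh A)"
    by (rule filterlim_compose[rotated])
qed

lemma test_function_tame:
  assumes "Lx P > 0" "Ly P > 0" "test_function P \<psi>"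
  obtains K where "0 \<le> K" "tame (Tend P) K \<psi>" "tame (Tend P) K (dt_test \<psi>)"
    "tame (Tend P) K (dx_test \<psi>)" "tame (Tend P) K (dy_test \<psi>)"
proof -
  have s: "smooth \<psi>" and p: "\<And>t. doubly_periodic (Lx P) (Ly P) (\<lambda>z. \<psi> (t, z))"
    using assms(3) by (auto simp: test_function_def)
  have e: "\<exists>K\<ge>0. tame (Tend P) K (pdiff e \<psi>)" for e
    using smooth_spatially_periodic_tame[OF assms(1,2) smooth_pdiff[OF s] spatially_periodic_pdiff[OF s p], of "Tend P" e] by metis
  obtain K0 where "0 \<le> K0" "tame (Tend P) K0 \<psi>"
    using smooth_spatially_periodic_tame[OF assms(1,2) s p, of "Tend P"] by metis
  moreover obtain K1 K2 K3 where "0 \<le> K1" "tame (Tend P) K1 (dt_test \<psi>)" "0 \<le> K2" "tame (Tend P) K2 (dx_test \<psi>)"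
    "0 \<le> K3" "tame (Tend P) K3 (dy_test \<psi>)" using e by metis
  ultimately show ?thesis by (intro that[of "K0 + K1 + K2 + K3"]) (auto elim!: tame_mono)
qed

lemma W_inf_2_weak_pdiff:
  assumes "W_inf 2 L M f" "e \<in> {(1, 0), (0, 1)}"
  obtains f1 f2 C1 C2 where "weak_pdiff L M e f f1" "weak_pdiff L M e f1 f2" "Linf_torus L M f1" "Linf_torus L M f2"
    "AE z in lborel. \<bar>f1 z\<bar> \<le> C1" "AE z in lborel. \<bar>f2 z\<bar> \<le> C2" "0 \<le> C2"
proof -
  obtain f1 where f1: "weak_pdiff L M e f f1" "W_inf (Suc 0) L M f1"
    using assms by (metis W_inf.simps(2) numeral_2_eq_2)
  then obtain f2 where f2: "weak_pdiff L M e f1 f2" "Linf_torus L M f2" "Linf_torus L M f1"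
    using assms(2) by (metis W_inf.simps)
  obtain C1 C2 where C: "AE z in lborel. \<bar>f1 z\<bar> \<le> C1" "AE z in lborel. \<bar>f2 z\<bar> \<le> C2"
    using f2 by (auto simp: Linf_torus_def)
  have "AE z in lborel. \<bar>f2 z\<bar> \<le> \<bar>C2\<bar>" by (rule eventually_mono[OF C(2)]) auto
  then show ?thesis using that[OF f1(1) f2(1,3,2) C(1)] by simp
qed

theorem theorem1p9:
  fixes P :: sw_problem and bx b_y :: "real \<times> real \<Rightarrow> real" and \<eta> \<zeta> hlo hhi c :: real
  assumes "valid_problem P"
    and "weak_pdiff (Lx P) (Ly P) (1, 0) (bot P) bx"
    and "weak_pdiff (Lx P) (Ly P) (0, 1) (bot P) b_y"
    and "0 < hlo" and "hlo \<le> hhi"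
    and "\<eta> > 3/2 * hhi"
    and "0 < \<zeta>" and "\<zeta> < 1"
  shows "\<exists>\<delta>0>0. \<exists>Cmass Cmomx Cmomy :: sw_run \<Rightarrow> (real \<times> real \<times> real \<Rightarrow> real) \<Rightarrow> real.
    (let A = {S \<in> admissible_runs P \<eta> \<zeta> hlo hhi c. 0 < mesh_size S \<and> mesh_size S \<le> \<delta>0} in
      (\<forall>\<psi>. test_function P \<psi> \<longrightarrow>
        (\<forall>S\<in>A.
          - (LINT z:Omega P|lborel. pc S (hh S 0) z * \<psi> (0, z)) =
            spacetime_sum P S (\<lambda>n t z.
              pc S (hh S n) z * dt_test \<psi> (t, z)
              + pc S (hh S (n + 1)) z * pc S (uu S n) z * dx_test \<psi> (t, z)
              + pc S (hh S (n + 1)) z * pc S (vv S n) z * dy_test \<psi> (t, z))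
            + Cmass S \<psi>) \<and>
        ((\<lambda>S. \<bar>Cmass S \<psi>\<bar>) \<longlongrightarrow> 0) (vanishing_mesh A)) \<and>
      (\<forall>\<Psi>. test_function P \<Psi> \<longrightarrow>
        (\<forall>S\<in>A.
          - (LINT z:Omega P|lborel. pc S (hh S 0) z * pc S (uu S 0) z * \<Psi> (0, z)) =
            spacetime_sum P S (\<lambda>n t z.
              pc S (hh S n) z * pc S (uu S n) z * dt_test \<Psi> (t, z)
              + pc_Dx S (m_x S n) z * pc_Dx S (upw_x P \<eta> S (uu S) n) z * dx_test \<Psi> (t, z)
              + pc_Dy S (m_y S n) z * pc_Dy S (upw_y P \<eta> S (uu S) n) z * dy_test \<Psi> (t, z)
              + pc S (pressure P S (n + 1)) z * dx_test \<Psi> (t, z))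
            + spacetime_sum P S (\<lambda>n t z.
              - grav P * pc S (hh S (n + 1)) z * bx z * \<Psi> (t, z)
              + cor P * pc S (hh S (n + 1)) z * pc S (vv S n) z * \<Psi> (t, z))
            + Cmomx S \<Psi>) \<and>
        ((\<lambda>S. \<bar>Cmomx S \<Psi>\<bar>) \<longlongrightarrow> 0) (vanishing_mesh A)) \<and>
      (\<forall>\<Phi>. test_function P \<Phi> \<longrightarrow>
        (\<forall>S\<in>A.
          - (LINT z:Omega P|lborel. pc S (hh S 0) z * pc S (vv S 0) z * \<Phi> (0, z)) =
            spacetime_sum P S (\<lambda>n t z.
              pc S (hh S n) z * pc S (vv S n) z * dt_test \<Phi> (t, z)
              + pc_Dx S (m_x S n) z * pc_Dx S (upw_x P \<eta> S (vv S) n) z * dx_test \<Phi> (t, z)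
              + pc_Dy S (m_y S n) z * pc_Dy S (upw_y P \<eta> S (vv S) n) z * dy_test \<Phi> (t, z)
              + pc S (pressure P S (n + 1)) z * dy_test \<Phi> (t, z))
            + spacetime_sum P S (\<lambda>n t z.
              - grav P * pc S (hh S (n + 1)) z * b_y z * \<Phi> (t, z)
              - cor P * pc S (hh S (n + 1)) z * pc S (uu S n) z * \<Phi> (t, z))
            + Cmomy S \<Phi>) \<and>
        ((\<lambda>S. \<bar>Cmomy S \<Phi>\<bar>) \<longlongrightarrow> 0) (vanishing_mesh A)))"
proof -
  have L: "0 < Lx P" "0 < Ly P" using assms(1) by (auto simp: valid_problem_def)
  obtain Bb Bu Bv where B: "AE z in lborel. \<bar>bot P z\<bar> \<le> Bb" "AE z in lborel. \<bar>u_init P z\<bar> \<le> Bu" "AE z in lborel. \<bar>v_init P z\<bar> \<le> Bv"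
    using assms(1) by (auto simp: valid_problem_def Linf_torus_def numeral_2_eq_2)
  have W: "W_inf 2 (Lx P) (Ly P) (bot P)" using assms(1) by (simp add: valid_problem_def)
  obtain f1 f2 C1 C2 where X: "weak_pdiff (Lx P) (Ly P) (1, 0) (bot P) f1" "weak_pdiff (Lx P) (Ly P) (1, 0) f1 f2"
    "Linf_torus (Lx P) (Ly P) f1" "Linf_torus (Lx P) (Ly P) f2"
    "AE z in lborel. \<bar>f1 z\<bar> \<le> C1" "AE z in lborel. \<bar>f2 z\<bar> \<le> C2" "0 \<le> C2"
    by (rule W_inf_2_weak_pdiff[OF W, of "(1, 0)"]) auto
  obtain g1 g2 D1 D2 where Y: "weak_pdiff (Lx P) (Ly P) (0, 1) (bot P) g1" "weak_pdiff (Lx P) (Ly P) (0, 1) g1 g2"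
    "Linf_torus (Lx P) (Ly P) g1" "Linf_torus (Lx P) (Ly P) g2"
    "AE z in lborel. \<bar>g1 z\<bar> \<le> D1" "AE z in lborel. \<bar>g2 z\<bar> \<le> D2" "0 \<le> D2"
    by (rule W_inf_2_weak_pdiff[OF W, of "(0, 1)"]) auto
  \<comment> \<open>The estimates hold for every mesh size, so the threshold 1 is an arbitrary choice.\<close>
  define A where "A = {S \<in> admissible_runs P \<eta> \<zeta> hlo hhi c. 0 < mesh_size S \<and> mesh_size S \<le> 1}"
  have scheme: "sw_scheme P S \<eta> \<zeta> hlo hhi Bb Bu Bv" and grad: "gradient_bounds P c S"
    and mesh: "0 < dt S \<and> 0 < dx S \<and> 0 < dy S \<and> dt S \<le> c * mesh_size S \<and> dx S \<le> mesh_size S \<and> dy S \<le> mesh_size S" if "S \<in> A" for S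
  proof -
    have S: "numerical_solution P \<eta> S" "energy_stability_conditions P \<eta> \<zeta> S" "height_bounds hlo hhi S"
      "gradient_bounds P c S" "dt S \<le> c * mesh_size S"
      using that by (auto simp: A_def admissible_runs_def)
    interpret sw_mesh P S by unfold_locales (use L S(1) in \<open>auto simp: numerical_solution_def\<close>)
    show "sw_scheme P S \<eta> \<zeta> hlo hhi Bb Bu Bv" by unfold_locales (use assms S B in auto)
    show "gradient_bounds P c S" by (rule S(4))
    show "0 < dt S \<and> 0 < dx S \<and> 0 < dy S \<and> dt S \<le> c * mesh_size S \<and> dx S \<le> mesh_size S \<and> dy S \<le> mesh_size S"
      using dt_pos dx_pos dy_pos S(5) step_le_mesh_size by auto
  qed
  have test: "\<exists>K. \<forall>S\<in>A. sw_test P S \<eta> \<zeta> hlo hhi Bb Bu Bv \<psi> K" if \<psi>: "test_function P \<psi>" for \<psi>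
  proof -
    obtain K where K: "0 \<le> K" "tame (Tend P) K \<psi>" "tame (Tend P) K (dt_test \<psi>)"
      "tame (Tend P) K (dx_test \<psi>)" "tame (Tend P) K (dy_test \<psi>)"
      by (rule test_function_tame[OF L \<psi>])
    have "sw_test P S \<eta> \<zeta> hlo hhi Bb Bu Bv \<psi> K" if "S \<in> A" for S
      using scheme[OF that] K \<psi> by (intro sw_test.intro sw_test_axioms.intro)
    then show ?thesis by blast
  qed
  note rate = sw_scheme.rate_def[OF scheme]
  \<comment> \<open>The errors are defined as the residuals of the weak form.\<close>
  define Cmass where "Cmass S \<psi> = - (LINT z:Omega P|lborel. pc S (hh S 0) z * \<psi> (0, z))
      - spacetime_sum P S (\<lambda>n t z.
              pc S (hh S n) z * dt_test \<psi> (t, z)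
              + pc S (hh S (n + 1)) z * pc S (uu S n) z * dx_test \<psi> (t, z)
              + pc S (hh S (n + 1)) z * pc S (vv S n) z * dy_test \<psi> (t, z))" for S \<psi>
  define Cx where "Cx S \<Psi> = - (LINT z:Omega P|lborel. pc S (hh S 0) z * pc S (uu S 0) z * \<Psi> (0, z))
      - spacetime_sum P S (\<lambda>n t z.
              pc S (hh S n) z * pc S (uu S n) z * dt_test \<Psi> (t, z)
              + pc_Dx S (m_x S n) z * pc_Dx S (upw_x P \<eta> S (uu S) n) z * dx_test \<Psi> (t, z)
              + pc_Dy S (m_y S n) z * pc_Dy S (upw_y P \<eta> S (uu S) n) z * dy_test \<Psi> (t, z)
              + pc S (pressure P S (n + 1)) z * dx_test \<Psi> (t, z))
      - spacetime_sum P S (\<lambda>n t z.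
              - grav P * pc S (hh S (n + 1)) z * bx z * \<Psi> (t, z)
              + cor P * pc S (hh S (n + 1)) z * pc S (vv S n) z * \<Psi> (t, z))" for S \<Psi>
  define Cy where "Cy S \<Phi> = - (LINT z:Omega P|lborel. pc S (hh S 0) z * pc S (vv S 0) z * \<Phi> (0, z))
      - spacetime_sum P S (\<lambda>n t z.
              pc S (hh S n) z * pc S (vv S n) z * dt_test \<Phi> (t, z)
              + pc_Dx S (m_x S n) z * pc_Dx S (upw_x P \<eta> S (vv S) n) z * dx_test \<Phi> (t, z)
              + pc_Dy S (m_y S n) z * pc_Dy S (upw_y P \<eta> S (vv S) n) z * dy_test \<Phi> (t, z)
              + pc S (pressure P S (n + 1)) z * dy_test \<Phi> (t, z))
      - spacetime_sum P S (\<lambda>n t z.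
              - grav P * pc S (hh S (n + 1)) z * b_y z * \<Phi> (t, z)
              - cor P * pc S (hh S (n + 1)) z * pc S (uu S n) z * \<Phi> (t, z))" for S \<Phi>
  define area where "area = Lx P * Ly P"
  \<comment> \<open>The locale constants take no run as argument, so one constant serves all runs.\<close>
  define CU where "CU = sw_scheme.CU P hlo hhi Bb Bu Bv"
  define TC where "TC = sw_test.transport_constant P \<eta> \<zeta> hlo hhi Bb Bu Bv"
  define SC where "SC = sw_test.source_constant P \<eta> \<zeta> hlo hhi Bb Bu Bv"
  have mass: "((\<lambda>S. \<bar>Cmass S \<psi>\<bar>) \<longlongrightarrow> 0) (vanishing_mesh A)" if \<psi>: "test_function P \<psi>" for \<psi>
  proof -
    obtain K where K: "\<And>S. S \<in> A \<Longrightarrow> sw_test P S \<eta> \<zeta> hlo hhi Bb Bu Bv \<psi> K" using test[OF \<psi>] by blast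
    have "\<bar>Cmass S \<psi>\<bar> \<le> (K * (TC area + Tend P * (hhi\<^sup>2 * CU + area))) * (sqrt (dt S) + dt S + dx S + dy S)" if S: "S \<in> A" for S
      using sw_test.mass_consistency[OF K[OF S]] unfolding rate[OF S] Cmass_def TC_def CU_def area_def .
    then show ?thesis by (rule vanishing_mesh_tendsto_0[where c = c, OF _ mesh])
  qed
  have momx: "((\<lambda>S. \<bar>Cx S \<Psi>\<bar>) \<longlongrightarrow> 0) (vanishing_mesh A)" if \<psi>: "test_function P \<Psi>" for \<Psi>
  proof -
    obtain K where K: "\<And>S. S \<in> A \<Longrightarrow> sw_test P S \<eta> \<zeta> hlo hhi Bb Bu Bv \<Psi> K" using test[OF \<psi>] by blast
    define Q where "Q = K * (TC CU + SC (c\<^sup>2) (C1 + C2 * Lx P) (tint (Lx P) (Ly P) (\<lambda>z. \<bar>bx z\<bar>)) C2 (cor P))"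
    have "\<bar>Cx S \<Psi>\<bar> \<le> Q * (sqrt (dt S) + dt S + dx S + dy S)" if S: "S \<in> A" for S
      using sw_test.x_momentum_consistency[OF K[OF S] grad[OF S] assms(2) X(1,2,3,5,4,6,7)]
      unfolding rate[OF S] Cx_def Q_def TC_def CU_def SC_def sw_test.transport_form_def[OF K[OF S]] .
    then show ?thesis by (rule vanishing_mesh_tendsto_0[where c = c, OF _ mesh])
  qed
  have momy: "((\<lambda>S. \<bar>Cy S \<Phi>\<bar>) \<longlongrightarrow> 0) (vanishing_mesh A)" if \<psi>: "test_function P \<Phi>" for \<Phi>
  proof -
    obtain K where K: "\<And>S. S \<in> A \<Longrightarrow> sw_test P S \<eta> \<zeta> hlo hhi Bb Bu Bv \<Phi> K" using test[OF \<psi>] by blast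
    define Q where "Q = K * (TC CU + SC (c\<^sup>2) (D1 + D2 * Ly P) (tint (Lx P) (Ly P) (\<lambda>z. \<bar>b_y z\<bar>)) D2 (- cor P))"
    have minus: "x + (- cor P) * y * z * w = x - cor P * y * z * w" for x y z w by simp
    have "\<bar>Cy S \<Phi>\<bar> \<le> Q * (sqrt (dt S) + dt S + dx S + dy S)" if S: "S \<in> A" for S
      using sw_test.y_momentum_consistency[OF K[OF S] grad[OF S] assms(3) Y(1,2,3,5,4,6,7)]
      unfolding minus rate[OF S] Cy_def Q_def TC_def CU_def SC_def sw_test.transport_form_def[OF K[OF S]] .
    then show ?thesis by (rule vanishing_mesh_tendsto_0[where c = c, OF _ mesh])
  qed
  have residual1: "a = s + (a - s)" for a s :: real by simp
  have residual2: "a = s1 + s2 + (a - s1 - s2)" for a s1 s2 :: real by simp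
  show ?thesis
    unfolding Let_def
    by (rule exI[of _ 1], intro conjI zero_less_one, rule exI[of _ Cmass], rule exI[of _ Cx], rule exI[of _ Cy],
        unfold A_def[symmetric], intro conjI allI impI ballI mass momx momy)
      (assumption | (unfold Cmass_def Cx_def Cy_def)?, (rule residual2 | rule residual1))+
qed

end
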